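(* Assume that $\tau$ is in the limit circle case at $a$ and $b$. Then the following statements hold (with $I=I_{L^2_r((a,b))}$). (i) If $\alpha,\beta\in(0,\pi)$, then $T_{0,0}$ and $T_{\alpha,\beta}$ are relatively prime with respect to $T_{min}$. Moreover, for each $z\in\rho(T_{0,0})\cap\rho(T_{\alpha,\beta})$ the matrix $$K_{\alpha,\beta}(z)=\begin{pmatrix}\cot(\beta)+\widetilde u_1^{\,\prime}(z,b)&-\widetilde u_1^{\,\prime}(z,a)\\ \widetilde u_2^{\,\prime}(z,b)&-\cot(\alpha)-\widetilde u_2^{\,\prime}(z,a)\end{pmatrix}$$ is invertible and $$(T_{\alpha,\beta}-zI)^{-1}=(T_{0,0}-zI)^{-1}+\sum_{j,k=1}^2\big[K_{\alpha,\beta}(z)^{-1}\big]_{j,k}(u_j(\overline z,\cdot),\cdot)_{L^2_r((a,b))}u_k(z,\cdot).$$ (ii) If $\beta\in(0,\pi)$, then the maximal common part of $T_{0,0}$ and $T_{0,\beta}$ is the restriction of $T_{max}$ to $\{y\in\mathrm{dom}(T_{max}) : \widetilde y(a)=\widetilde y(b)=\widetilde y^{\,\prime}(b)=0\}$. Moreover, for each $z\in\rho(T_{0,0})\cap\rho(T_{0,\beta})$ the scalar $K_{0,\beta}(z)=\cot(\beta)+\widetilde u_1^{\,\prime}(z,b)$ is nonzero and $$(T_{0,\beta}-zI)^{-1}=(T_{0,0}-zI)^{-1}+K_{0,\beta}(z)^{-1}(u_1(\overline z,\cdot),\cdot)_{L^2_r((a,b))}u_1(z,\cdot).$$ (iii)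 If $\alpha\in(0,\pi)$, then the maximal common part of $T_{0,0}$ and $T_{\alpha,0}$ is the restriction of $T_{max}$ to $\{y\in\mathrm{dom}(T_{max}) : \widetilde y(a)=\widetilde y(b)=\widetilde y^{\,\prime}(a)=0\}$. Moreover, for each $z\in\rho(T_{0,0})\cap\rho(T_{\alpha,0})$ the scalar $K_{\alpha,0}(z)=-\cot(\alpha)-\widetilde u_2^{\,\prime}(z,a)$ is nonzero and $$(T_{\alpha,0}-zI)^{-1}=(T_{0,0}-zI)^{-1}+K_{\alpha,0}(z)^{-1}(u_2(\overline z,\cdot),\cdot)_{L^2_r((a,b))}u_2(z,\cdot).$$ (iv) Let $\varphi\in[0,2\pi)$ and $R\in SL(2,\mathbb R)$. If $R_{1,2}\neq0$, then $T_{0,0}$ and $T_{\varphi,R}$ are relatively prime with respect to $T_{min}$. Moreover, for each $z\in\rho(T_{0,0})\cap\rho(T_{\varphi,R})$ the matrix $$K_{\varphi,R}(z)=\begin{pmatrix}-\dfrac{R_{2,2}}{R_{1,2}}+\widetilde u_1^{\,\prime}(z,b)&\dfrac{e^{-i\varphi}}{R_{1,2}}-\widetilde u_1^{\,\prime}(z,a)\\ \dfrac{e^{i\varphi}}{R_{1,2}}+\widetilde u_2^{\,\prime}(z,b)&-\dfrac{R_{1,1}}{R_{1,2}}-\widetilde u_2^{\,\prime}(z,a)\end{pmatrix}$$ is invertible and $$(T_{\varphi,R}-zI)^{-1}=(T_{0,0}-zI)^{-1}+\sum_{j,k=1}^2\big[K_{\varphi,R}(z)^{-1}\big]_{j,k}(u_j(\overline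 z,\cdot),\cdot)_{L^2_r((a,b))}u_k(z,\cdot).$$ (v) Let $\varphi\in[0,2\pi)$ and $R\in SL(2,\mathbb R)$. If $R_{1,2}=0$, then the maximal common part of $T_{\varphi,R}$ and $T_{0,0}$ is the restriction of $T_{max}$ to $\{y\in\mathrm{dom}(T_{max}) : \widetilde y(a)=\widetilde y(b)=0,\ \widetilde y^{\,\prime}(b)=e^{i\varphi}R_{2,2}\widetilde y^{\,\prime}(a)\}$. Moreover, for each $z\in\rho(T_{0,0})\cap\rho(T_{\varphi,R})$ the scalar $$k_{\varphi,R}(z)=-R_{2,1}R_{2,2}-e^{i\varphi}R_{2,2}\widetilde u_{\varphi,R}^{\,\prime}(z,a)+\widetilde u_{\varphi,R}^{\,\prime}(z,b)$$ is nonzero, and $$(T_{\varphi,R}-zI)^{-1}=(T_{0,0}-zI)^{-1}+k_{\varphi,R}(z)^{-1}(u_{\varphi,R}(\overline z,\cdot),\cdot)_{L^2_r((a,b))}u_{\varphi,R}(z,\cdot),$$ where $u_{\varphi,R}(\zeta,\cdot)=e^{-i\varphi}R_{2,2}u_2(\zeta,\cdot)+u_1(\zeta,\cdot)$, $\zeta\in\rho(T_{0,0})$.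
   Context: Let $(a,b)\subseteq\mathbb R$ (possibly unbounded) and let $p,q,r$ be Lebesgue measurable functions on $(a,b)$ with $r>0$ a.e., $r\in L^1_{loc}((a,b))$; $p>0$ a.e., $1/p\in L^1_{loc}((a,b))$; $q$ real-valued a.e., $q\in L^1_{loc}((a,b))$. Put $\tau f=\frac1r\big[-(pf')'+qf\big]$, $f^{[1]}=pf'$, and $W(f,g)(x)=f(x)g^{[1]}(x)-f^{[1]}(x)g(x)$. Let $L^2_r((a,b))=L^2((a,b);r\,dx)$ with inner product $(\cdot,\cdot)_{L^2_r((a,b))}$ linear in the second argument. The maximal operator is $T_{max}f=\tau f$ with $\mathrm{dom}(T_{max})=\{g\in L^2_r((a,b)) : g,g^{[1]}\in AC_{loc}((a,b)),\ \tau g\in L^2_r((a,b))\}$. The minimal operator $T_{min}$ is the closure of the restriction of $T_{max}$ to those $g\in\mathrm{dom}(T_{max})$ with compact support in $(a,b)$. For $f,g\in\mathrm{dom}(T_{max})$ the limits $W(f,g)(a)=\lim_{x\downarrow a}W(f,g)(x)$ and $W(f,g)(b)=\lim_{x\uparrow b}W(f,g)(x)$ exist. $\tau$ is in the limit circle case at an endpoint if for every $z\in\mathbb C$ all solutions of $\tau u=zu$ are in $L^2_r$ near that endpoint. Generalized boundary values: fix real-valued $v_1,v_2\in\mathrm{dom}(T_{max})$ with $W(v_1,v_2)(a)=W(v_1,v_2)(b)=1$ and, for $g\in\mathrm{dom}(T_{max})$ and $d\in\{a,b\}$, set $\widetilde g(d)=-W(v_2,g)(d)$ and $\widetilde g^{\,\prime}(d)=W(v_1,g)(d)$.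 (If $T_{min}$ is bounded from below one takes $v_1,v_2$ equal near each endpoint $d$ to a nonprincipal solution $\widehat u_d(\lambda_0,\cdot)$ and a principal solution $u_d(\lambda_0,\cdot)$ of $\tau u=\lambda_0u$ with $W(\widehat u_d,u_d)=1$, $\lambda_0\in\mathbb R$.) Self-adjoint extensions of $T_{min}$ (all are restrictions of $T_{max}$): for $\alpha,\beta\in[0,\pi)$, $\mathrm{dom}(T_{\alpha,\beta})$ consists of all $g\in\mathrm{dom}(T_{max})$ with $\cos(\alpha)\widetilde g(a)+\sin(\alpha)\widetilde g^{\,\prime}(a)=0$ and $\cos(\beta)\widetilde g(b)+\sin(\beta)\widetilde g^{\,\prime}(b)=0$; for $\varphi\in[0,2\pi)$ and $R=(R_{j,k})_{j,k=1}^2\in SL(2,\mathbb R)$, $\mathrm{dom}(T_{\varphi,R})$ consists of all $g\in\mathrm{dom}(T_{max})$ with $(\widetilde g(b),\widetilde g^{\,\prime}(b))^\top=e^{i\varphi}R\,(\widetilde g(a),\widetilde g^{\,\prime}(a))^\top$. In particular $\mathrm{dom}(T_{0,0})=\{g\in\mathrm{dom}(T_{max}):\widetilde g(a)=\widetilde g(b)=0\}$. For $z\in\rho(T_{0,0})$, $u_1(z,\cdot),u_2(z,\cdot)$ are the solutions of $\tau u=zu$ with $\widetilde u_1(z,a)=0$, $\widetilde u_1(z,b)=1$, $\widetilde u_2(z,a)=1$, $\widetilde u_2(z,b)=0$; $\widetilde u_j^{\,\prime}(z,d)$ denotes the second generalized boundary value of $u_j(z,\cdot)$ at $d\in\{a,b\}$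 (and similarly for $u_{\varphi,R}$). If $T,T'$ are self-adjoint extensions of a symmetric operator $S$, their maximal common part is the operator $C_{T,T'}u=Tu$ with domain $\{f\in\mathrm{dom}(T)\cap\mathrm{dom}(T') : Tf=T'f\}$; $T$ and $T'$ are relatively prime with respect to $S$ if $C_{T,T'}=S$. The symbol $(f,\cdot)_{L^2_r((a,b))}\,h$ denotes the rank-one operator $g\mapsto(f,g)_{L^2_r((a,b))}h$. *)

theory Defs
  imports "HOL-Analysis.Analysis"
begin

section \<open>Absolute continuity and local integrability\<close>

text \<open>The usual epsilon-delta definition; a finite family of non-overlapping compact intervals
  is a division of its union.\<close>

definition absolutely_continuous_on :: "real set \<Rightarrow> (real \<Rightarrow> 'a::real_normed_vector) \<Rightarrow> bool" where
  "absolutely_continuous_on S f \<longleftrightarrow>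
     (\<forall>e>0. \<exists>d>0. \<forall>D. D division_of \<Union>D \<and> \<Union>D \<subseteq> S \<and> (\<Sum>K\<in>D. Sup K - Inf K) < d
        \<longrightarrow> (\<Sum>K\<in>D. norm (f (Sup K) - f (Inf K))) < e)"

definition AC_loc :: "real set \<Rightarrow> (real \<Rightarrow> 'a::real_normed_vector) set" where
  "AC_loc I = {f. \<forall>c d. {c..d} \<subseteq> I \<longrightarrow> absolutely_continuous_on {c..d} f}"

definition locally_integrable_on :: "(real \<Rightarrow> real) \<Rightarrow> real set \<Rightarrow> bool" where
  "locally_integrable_on f I \<longleftrightarrow> (\<forall>K. compact K \<and> K \<subseteq> I \<longrightarrow> set_integrable lebesgue K f)"


section \<open>Operators in an $L^2$ space\<close>

text \<open>Elements of $L^2(M)$ are represented by square-integrable functions, equality in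
  $L^2(M)$ being equality almost everywhere.  An operator is represented by its graph, as a
  relation on representatives; the operators below are closed under changing either component
  on a null set (see \<open>realization\<close> and \<open>op_closure\<close>), so that set equality of graphs is
  equality of operators.\<close>

definition L2 :: "'a measure \<Rightarrow> ('a \<Rightarrow> complex) set" where
  "L2 M = {f \<in> borel_measurable M. integrable M (\<lambda>x. (cmod (f x))\<^sup>2)}"

definition L2_inner :: "'a measure \<Rightarrow> ('a \<Rightarrow> complex) \<Rightarrow> ('a \<Rightarrow> complex) \<Rightarrow> complex" where
  "L2_inner M f g = (LINT x|M. cnj (f x) * g x)"

definition L2_norm :: "'a measure \<Rightarrow> ('a \<Rightarrow> complex) \<Rightarrow> real" where
  "L2_norm M f = sqrt (LINT x|M. (cmod (f x))\<^sup>2)"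

type_synonym 'a op = "(('a \<Rightarrow> complex) \<times> ('a \<Rightarrow> complex)) set"

text \<open>The operator whose graph is the closure of the graph of \<open>T\<close> in $L^2(M) \times L^2(M)$.\<close>

definition op_closure :: "'a measure \<Rightarrow> 'a op \<Rightarrow> 'a op" where
  "op_closure M T = {(f, g). f \<in> L2 M \<and> g \<in> L2 M \<and>
     (\<forall>e>0. \<exists>(u, v)\<in>T. L2_norm M (\<lambda>x. f x - u x) < e \<and> L2_norm M (\<lambda>x. g x - v x) < e)}"

text \<open>The operator $T - zI$.\<close>

definition op_shift :: "'a op \<Rightarrow> complex \<Rightarrow> 'a op" where
  "op_shift T z = {(f, \<lambda>x. g x - z * f x) | f g. (f, g) \<in> T}"

text \<open>$T - zI$ maps onto $L^2(M)$ and has a bounded inverse; the norm bound contains injectivity.\<close>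

definition resolvent_set :: "'a measure \<Rightarrow> 'a op \<Rightarrow> complex set" where
  "resolvent_set M T = {z. (\<forall>h\<in>L2 M. \<exists>f. (f, h) \<in> op_shift T z) \<and>
     (\<exists>C. \<forall>(f, h)\<in>op_shift T z. L2_norm M f \<le> C * L2_norm M h)}"

text \<open>$(T - zI)^{-1}h$ for \<open>z\<close> in the resolvent set; determined up to a null set.\<close>

definition resolvent :: "'a op \<Rightarrow> complex \<Rightarrow> ('a \<Rightarrow> complex) \<Rightarrow> ('a \<Rightarrow> complex)" where
  "resolvent T z h = (SOME f. (f, h) \<in> op_shift T z)"

definition rank_one ::
    "'a measure \<Rightarrow> ('a \<Rightarrow> complex) \<Rightarrow> ('a \<Rightarrow> complex) \<Rightarrow> ('a \<Rightarrow> complex) \<Rightarrow> ('a \<Rightarrow> complex)" where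
  "rank_one M f h g = (\<lambda>x. L2_inner M f g * h x)"

text \<open>For graphs of operators, the graph of $u \mapsto Tu$ on
  $\{u \in \mathrm{dom}\,T \cap \mathrm{dom}\,T' : Tu = T'u\}$.\<close>

definition max_common_part :: "'a op \<Rightarrow> 'a op \<Rightarrow> 'a op" where
  "max_common_part T T' =
     {(f, h). f \<in> Domain T \<inter> Domain T' \<and> (f, h) \<in> T \<and> (f, h) \<in> T'}"

text \<open>Used for self-adjoint extensions \<open>T\<close>, \<open>T'\<close> of the symmetric operator \<open>S\<close>.\<close>

definition relatively_prime :: "'a op \<Rightarrow> 'a op \<Rightarrow> 'a op \<Rightarrow> bool" where
  "relatively_prime S T T' \<longleftrightarrow> max_common_part T T' = S"


section \<open>The Sturm--Liouville expression\<close>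

record sl_data =
  lend :: ereal
  rend :: ereal
  p_coeff :: "real \<Rightarrow> real"
  q_coeff :: "real \<Rightarrow> real"
  r_coeff :: "real \<Rightarrow> real"

definition sl_int :: "sl_data \<Rightarrow> real set" where
  "sl_int S = einterval (lend S) (rend S)"

definition sturm_liouville :: "sl_data \<Rightarrow> bool" where
  "sturm_liouville S \<longleftrightarrow>
     lend S < rend S \<and>
     p_coeff S \<in> borel_measurable (restrict_space lebesgue (sl_int S)) \<and>
     q_coeff S \<in> borel_measurable (restrict_space lebesgue (sl_int S)) \<and>
     r_coeff S \<in> borel_measurable (restrict_space lebesgue (sl_int S)) \<and>
     (AE x in lebesgue. x \<in> sl_int S \<longrightarrow> 0 < r_coeff S x) \<and>
     locally_integrable_on (r_coeff S) (sl_int S) \<and>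
     (AE x in lebesgue. x \<in> sl_int S \<longrightarrow> 0 < p_coeff S x) \<and>
     locally_integrable_on (\<lambda>x. 1 / p_coeff S x) (sl_int S) \<and>
     locally_integrable_on (q_coeff S) (sl_int S)"

text \<open>The measure $r\,dx$ on $(a,b)$.  Values of functions outside $(a,b)$ play no role.\<close>

definition sl_measure :: "sl_data \<Rightarrow> real measure" where
  "sl_measure S = density (restrict_space lebesgue (sl_int S)) (\<lambda>x. ennreal (r_coeff S x))"

text \<open>$pf'$ is defined only almost everywhere, and $f^{[1]}$ is its locally absolutely continuous
  representative, which is unique on $(a,b)$ if it exists.\<close>

definition is_quasi_deriv :: "sl_data \<Rightarrow> (real \<Rightarrow> complex) \<Rightarrow> (real \<Rightarrow> complex) \<Rightarrow> bool" where
  "is_quasi_deriv S f f1 \<longleftrightarrow> f1 \<in> AC_loc (sl_int S) \<and>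
     (AE x in lebesgue. x \<in> sl_int S \<longrightarrow>
        f1 x = complex_of_real (p_coeff S x) * vector_derivative f (at x))"

definition quasi_deriv :: "sl_data \<Rightarrow> (real \<Rightarrow> complex) \<Rightarrow> (real \<Rightarrow> complex)" where
  "quasi_deriv S f = (SOME f1. is_quasi_deriv S f f1)"

text \<open>The functions with $f, f^{[1]} \in AC_{loc}((a,b))$, to which $\tau$ can be applied.\<close>

definition sl_regular :: "sl_data \<Rightarrow> (real \<Rightarrow> complex) set" where
  "sl_regular S = {f \<in> AC_loc (sl_int S). \<exists>f1. is_quasi_deriv S f f1}"

definition tau :: "sl_data \<Rightarrow> (real \<Rightarrow> complex) \<Rightarrow> (real \<Rightarrow> complex)" where
  "tau S f = (\<lambda>x. 1 / complex_of_real (r_coeff S x) *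
     (- vector_derivative (quasi_deriv S f) (at x) + complex_of_real (q_coeff S x) * f x))"

definition sl_solution :: "sl_data \<Rightarrow> complex \<Rightarrow> (real \<Rightarrow> complex) \<Rightarrow> bool" where
  "sl_solution S z u \<longleftrightarrow> u \<in> sl_regular S \<and>
     (AE x in lebesgue. x \<in> sl_int S \<longrightarrow> tau S u x = z * u x)"

text \<open>\<open>d\<close> is one of the endpoints of $(a,b)$.\<close>

definition limit_circle_at :: "sl_data \<Rightarrow> ereal \<Rightarrow> bool" where
  "limit_circle_at S d \<longleftrightarrow> (\<forall>z u. sl_solution S z u \<longrightarrow>
     (\<exists>c\<in>sl_int S. interval_lebesgue_integrable (sl_measure S) d (ereal c) (\<lambda>x. (cmod (u x))\<^sup>2)))"


section \<open>Maximal and minimal operator\<close>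

definition dom_max :: "sl_data \<Rightarrow> (real \<Rightarrow> complex) set" where
  "dom_max S = {g \<in> L2 (sl_measure S). g \<in> sl_regular S \<and> tau S g \<in> L2 (sl_measure S)}"

text \<open>For $D \subseteq \mathrm{dom}(T_{max})$, the graph of the restriction of $T_{max}$ to \<open>D\<close>.
  The sets \<open>D\<close> consist of the absolutely continuous representatives, which have pointwise
  (and boundary) values; the graph contains all almost everywhere equal functions.\<close>

definition realization :: "sl_data \<Rightarrow> (real \<Rightarrow> complex) set \<Rightarrow> real op" where
  "realization S D = {(f, h). f \<in> L2 (sl_measure S) \<and> h \<in> L2 (sl_measure S) \<and>
     (\<exists>g\<in>D. (AE x in sl_measure S. f x = g x) \<and> (AE x in sl_measure S. h x = tau S g x))}"

definition T_max :: "sl_data \<Rightarrow> real op" where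
  "T_max S = realization S (dom_max S)"

definition T_min :: "sl_data \<Rightarrow> real op" where
  "T_min S = op_closure (sl_measure S) (realization S
     {g \<in> dom_max S. \<exists>K. compact K \<and> K \<subseteq> sl_int S \<and> (\<forall>x\<in>sl_int S - K. g x = 0)})"


section \<open>Generalized boundary values and self-adjoint extensions\<close>

definition wronskian :: "sl_data \<Rightarrow> (real \<Rightarrow> complex) \<Rightarrow> (real \<Rightarrow> complex) \<Rightarrow> real \<Rightarrow> complex" where
  "wronskian S f g x = f x * quasi_deriv S g x - quasi_deriv S f x * g x"

text \<open>$W(f,g)(d)$ for an endpoint \<open>d\<close>, i.e. the one-sided limit from inside $(a,b)$.\<close>

definition wronskian_end ::
    "sl_data \<Rightarrow> (real \<Rightarrow> complex) \<Rightarrow> (real \<Rightarrow> complex) \<Rightarrow> ereal \<Rightarrow> complex" where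
  "wronskian_end S f g d =
     Lim (at d within {lend S<..<rend S}) (\<lambda>x. wronskian S f g (real_of_ereal x))"

definition boundary_pair :: "sl_data \<Rightarrow> (real \<Rightarrow> complex) \<Rightarrow> (real \<Rightarrow> complex) \<Rightarrow> bool" where
  "boundary_pair S v1 v2 \<longleftrightarrow> v1 \<in> dom_max S \<and> v2 \<in> dom_max S \<and>
     (\<forall>x\<in>sl_int S. v1 x \<in> \<real> \<and> v2 x \<in> \<real>) \<and>
     wronskian_end S v1 v2 (lend S) = 1 \<and> wronskian_end S v1 v2 (rend S) = 1"

text \<open>The generalized boundary values $\widetilde g(d)$ and $\widetilde g^{\,\prime}(d)$ at an endpoint
  \<open>d\<close>.  Both take the pair \<open>v1\<close>, \<open>v2\<close> for uniformity.\<close>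

definition bv ::
    "sl_data \<Rightarrow> (real \<Rightarrow> complex) \<Rightarrow> (real \<Rightarrow> complex) \<Rightarrow> (real \<Rightarrow> complex) \<Rightarrow> ereal \<Rightarrow> complex" where
  "bv S v1 v2 g d = - wronskian_end S v2 g d"

definition bv' ::
    "sl_data \<Rightarrow> (real \<Rightarrow> complex) \<Rightarrow> (real \<Rightarrow> complex) \<Rightarrow> (real \<Rightarrow> complex) \<Rightarrow> ereal \<Rightarrow> complex" where
  "bv' S v1 v2 g d = wronskian_end S v1 g d"

text \<open>$T_{\alpha,\beta}$.\<close>

definition T_sep ::
    "sl_data \<Rightarrow> (real \<Rightarrow> complex) \<Rightarrow> (real \<Rightarrow> complex) \<Rightarrow> real \<Rightarrow> real \<Rightarrow> real op" where
  "T_sep S v1 v2 \<alpha> \<beta> = realization S {g \<in> dom_max S.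
     complex_of_real (cos \<alpha>) * bv S v1 v2 g (lend S)
       + complex_of_real (sin \<alpha>) * bv' S v1 v2 g (lend S) = 0 \<and>
     complex_of_real (cos \<beta>) * bv S v1 v2 g (rend S)
       + complex_of_real (sin \<beta>) * bv' S v1 v2 g (rend S) = 0}"

text \<open>$T_{\varphi,R}$.\<close>

definition T_coupled ::
    "sl_data \<Rightarrow> (real \<Rightarrow> complex) \<Rightarrow> (real \<Rightarrow> complex) \<Rightarrow> real \<Rightarrow> real^2^2 \<Rightarrow> real op" where
  "T_coupled S v1 v2 \<phi> R = realization S {g \<in> dom_max S.
     (vector [bv S v1 v2 g (rend S), bv' S v1 v2 g (rend S)] :: complex^2) =
       exp (\<i> * complex_of_real \<phi>) *s
         ((\<chi> j k. complex_of_real (R $ j $ k)) *v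
           vector [bv S v1 v2 g (lend S), bv' S v1 v2 g (lend S)])}"

end

theory Submission
  imports Defs
begin

text \<open>
The proof has two parts, one on the operators and one on their resolvents.

A locally absolutely continuous function is the indefinite integral of its derivative
(\<open>AC_loc_imp_primitive_on\<close>, \<open>primitive_on_imp_AC_loc\<close>), so that $\tau f = h$ is equivalent
to the pair of integral equations $f' = f^{[1]}/p$, $(f^{[1]})' = qf - rh$ recorded by
\<open>sl_pair\<close>.  The product rule for indefinite integrals gives the Lagrange identity
\<open>wronskian_diff\<close>.  Hence $W(f,g)$ has limits at both endpoints for $f, g \in
\mathrm{dom}(T_{max})$, and \<open>green\<close> expresses the difference of the limits as an integral.
The Pluecker identity among four functions yields
$W(f,g)(d) = \widetilde f(d)\,\widetilde g^{\,\prime}(d) - \widetilde f^{\,\prime}(d)\,\widetilde g(d)$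
(\<open>wronskian_end_bv\<close>).

The minimal operator is the restriction of $T_{max}$ to functions all of whose four boundary
values vanish (\<open>T_min_eq\<close>).  For one inclusion, $f$ and $f^{[1]}$ are bounded on compact
subintervals by the graph norm of $f$ (\<open>compact_interval_estimate\<close>).  It follows that
$T_{max}$ is closed (\<open>T_max_closed\<close>) and that the boundary values are bounded in the graph
norm (\<open>wronskian_end_bounded\<close>); they vanish for functions with compact support, hence on
the closure.  For the other inclusion, let all boundary values of $g$ vanish, and let $x_n$
tend to an endpoint.  Beyond $x_n$ replace $g$ by the combination of $v_1, v_2$ with the same
values of $g$ and $g^{[1]}$ at $x_n$.  Its coefficients are Wronskians of $g$ with the $v_i$ at
$x_n$, divided by $W(v_1,v_2)(x_n)$, and tend to $0$.  Subtracting the same combination of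
cut-offs of $v_1, v_2$, elements of $\mathrm{dom}(T_{max})$ that agree with $v_1, v_2$ near
that endpoint and vanish near the other one (\<open>transition_functions\<close>), gives compactly
supported functions, if done at both endpoints, that converge to $g$ in the graph norm (\<open>D_min_approximation\<close>).  The
cut-offs are obtained by varying constants, so no solution of $\tau u = zu$ has to be
constructed.  Comparing boundary conditions then gives the maximal common parts.

For the resolvents, let $z$ be in both resolvent sets and $f = (T - z)^{-1}h$,
$g = (T_{0,0} - z)^{-1}h$.  In the limit circle case $u_1(z,\cdot), u_2(z,\cdot)$ are in
$\mathrm{dom}(T_{max})$, and
$f - g - \widetilde f(b)u_1(z,\cdot) - \widetilde f(a)u_2(z,\cdot)$ is in the kernel of
$T_{0,0} - z$, hence zero (\<open>resolvent_decomposition\<close>).  By Green's formula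
$(u_1(\overline z,\cdot),h) = -\widetilde g^{\,\prime}(b)$ and
$(u_2(\overline z,\cdot),h) = \widetilde g^{\,\prime}(a)$ (\<open>inner_solution\<close>).  Inserting this
into the boundary conditions of $T$ gives a linear system for
$(\widetilde f(b), \widetilde f(a))$ whose matrix is the transpose of $K(z)$.  The system is
injective, because a nonzero solution of the homogeneous system would give an eigenfunction of
$T$ with eigenvalue $z$ (\<open>krein_matrix\<close>).  If the boundary conditions of $T$ confine
$(\widetilde f(b), \widetilde f(a))$ to a line, one scalar equation remains
(\<open>krein_scalar\<close>).
\<close>

section \<open>Differentiability of indefinite integrals almost everywhere\<close>

text \<open>Let $F$ be the indefinite integral of $f$.  The points $x$ such that
$\vert F(y) - F(x) - (y-x)f(x)\vert > \vert y-x\vert/(n+1)$ for some $y$ arbitrarily close to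
$x$ are Vitali covered by the intervals between $x$ and $y$.  For disjoint such intervals the
Henstock lemma bounds the total length by an arbitrary positive number.\<close>

lemma negligible_not_vector_derivative_indefinite_integral:
  fixes f :: "real \<Rightarrow> 'a::euclidean_space"
  assumes f: "f integrable_on {a..b}"
  shows "negligible {x \<in> {a<..<b}.
           \<not> ((\<lambda>u. integral {a..u} f) has_vector_derivative f x) (at x)}"
proof -
  define F where "F = (\<lambda>u. integral {a..u} f)"
  define bad where "bad = (\<lambda>(n::nat) x y. y \<noteq> x \<and>
      \<bar>y - x\<bar> / Suc n < norm (F y - F x - (y - x) *\<^sub>R f x))"
  define E where "E = (\<lambda>n. {x \<in> {a<..<b}. \<forall>d>0. \<exists>y\<in>{a<..<b}. \<bar>y - x\<bar> < d \<and> bad n x y})"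
  define J where "J = (\<lambda>(x::real, y::real). {min x y..max x y})"
  have J_cball: "cball ((x + y) / 2) (\<bar>y - x\<bar> / 2) = J (x, y)" for x y
    by (auto simp: J_def cball_eq_atLeastAtMost min_def max_def field_simps)
  have diff: "F y - F x = integral {x..y} f" if "a < x" "x \<le> y" "y < b" for x y
  proof -
    have "f integrable_on {a..y}"
      by (rule integrable_subinterval_real[OF f]) (use that in auto)
    from Henstock_Kurzweil_Integration.integral_combine[OF _ \<open>x \<le> y\<close> this] that show ?thesis
      unfolding F_def by (metis add_diff_cancel_left' less_eq_real_def)
  qed
  have "negligible (E n)" for n
    unfolding negligible_outer_le
  proof (intro allI impI)
    fix e :: real assume "e > 0"
    then have e': "e / Suc n > 0" by simp
    obtain \<gamma> where \<gamma>: "gauge \<gamma>"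
      and H: "\<And>p. \<lbrakk>p tagged_partial_division_of (cbox a b); \<gamma> fine p\<rbrakk> \<Longrightarrow>
             (\<Sum>(x,k)\<in>p. norm (measure lborel k *\<^sub>R f x - integral k f)) < e / Suc n"
      using Henstock_lemma[of f a b, OF _ e'] f by auto
    \<comment> \<open>The intervals fine with respect to the gauge, so that the Henstock lemma applies to them
      with tag \<open>x\<close>, which is one of their endpoints.\<close>
    define K where "K = {(x, y). x \<in> E n \<and> y \<in> {a<..<b} \<and> bad n x y \<and> J (x, y) \<subseteq> \<gamma> x}"
    obtain C where C: "countable C" "C \<subseteq> K"
      "pairwise (\<lambda>i j. disjnt (cball ((fst i + snd i) / 2) (\<bar>snd i - fst i\<bar> / 2))
                              (cball ((fst j + snd j) / 2) (\<bar>snd j - fst j\<bar> / 2))) C"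
      "negligible (E n - (\<Union>i\<in>C. cball ((fst i + snd i) / 2) (\<bar>snd i - fst i\<bar> / 2)))"
    proof (rule Vitali_covering_theorem_cballs
        [of K "\<lambda>i. \<bar>snd i - fst i\<bar> / 2" "E n" "\<lambda>i. (fst i + snd i) / 2"])
      show "0 < \<bar>snd i - fst i\<bar> / 2" if "i \<in> K" for i
        using that by (auto simp: K_def bad_def)
      fix x d :: real assume x: "x \<in> E n" and "0 < d"
      have "open (\<gamma> x)" "x \<in> \<gamma> x" using \<gamma> by (auto simp: gauge_def)
      then obtain d' where d': "d' > 0" "ball x d' \<subseteq> \<gamma> x"
        using open_contains_ball_eq by blast
      have "min d d' > 0" using d' \<open>0 < d\<close> by simp
      moreover have "\<forall>d>0. \<exists>y\<in>{a<..<b}. \<bar>y - x\<bar> < d \<and> bad n x y" using x by (simp add: E_def)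
      ultimately obtain y where y: "y \<in> {a<..<b}" "\<bar>y - x\<bar> < min d d'" "bad n x y"
        by meson
      have "J (x, y) \<subseteq> ball x d'"
        using y(2) by (auto simp: J_def dist_real_def)
      then have "(x, y) \<in> K" using x y d' by (auto simp: K_def)
      moreover have "x \<in> J (x, y)" by (auto simp: J_def)
      ultimately show "\<exists>i. i \<in> K \<and> x \<in> cball ((fst i + snd i) / 2) (\<bar>snd i - fst i\<bar> / 2)
          \<and> \<bar>snd i - fst i\<bar> / 2 < d"
        using y \<open>0 < d\<close> by (intro exI[of _ "(x, y)"]) (simp add: J_cball)
    qed blast
    have ball_J: "cball ((fst i + snd i) / 2) (\<bar>snd i - fst i\<bar> / 2) = J i" for i
      using J_cball by (cases i) auto
    note C = C[unfolded ball_J]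
    have bound: "measure lebesgue (\<Union>i\<in>C'. J i) \<le> e" if C': "C' \<subseteq> C" "finite C'" for C'
    proof -
      have J_mem: "fst i \<in> J i" for i by (auto simp: J_def split: prod.splits)
      have disj: "i = j" if "i \<in> C'" "j \<in> C'" "x \<in> J i" "x \<in> J j" for i j x
        using C(3) C' that by (auto simp: pairwise_def disjnt_iff)
      define p where "p = (\<lambda>i. (fst i, J i)) ` C'"
      have inj: "inj_on (\<lambda>i. (fst i, J i)) C'"
        by (rule inj_onI) (metis disj J_mem prod.inject)
      have "p tagged_partial_division_of cbox a b"
        unfolding tagged_partial_division_of_def
      proof (intro conjI allI impI)
        show "finite p" using C' by (simp add: p_def)
        fix x k assume "(x, k) \<in> p"
        then obtain i where i: "i \<in> C'" "x = fst i" "k = J i" by (auto simp: p_def)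
        then have "i \<in> K" using C C' by auto
        with i show "x \<in> k" "k \<subseteq> cbox a b" "\<exists>a b. k = cbox a b"
          by (auto simp: J_def K_def E_def split: prod.splits)
      next
        fix x1 K1 x2 K2 assume "(x1, K1) \<in> p \<and> (x2, K2) \<in> p \<and> (x1, K1) \<noteq> (x2, K2)"
        then have "K1 \<inter> K2 = {}"
          using disj by (fastforce simp: p_def)
        then show "interior K1 \<inter> interior K2 = {}"
          using interior_subset by blast
      qed
      moreover have "\<gamma> fine p"
        using C(2) C' by (fastforce simp: fine_def p_def K_def)
      ultimately have "(\<Sum>(x,k)\<in>p. norm (measure lborel k *\<^sub>R f x - integral k f)) < e / Suc n"
        by (rule H)
      then have S: "(\<Sum>i\<in>C'. norm (measure lborel (J i) *\<^sub>R f (fst i) - integral (J i) f)) < e / Suc n"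
        using inj by (simp add: p_def sum.reindex split_def)
      have *: "measure lebesgue (J i) \<le> Suc n * norm (measure lborel (J i) *\<^sub>R f (fst i) - integral (J i) f)"
        if "i \<in> C'" for i
      proof -
        obtain x y where i: "i = (x, y)" by (cases i)
        have xy: "a < x" "x < b" "a < y" "y < b"
          "\<bar>y - x\<bar> / Suc n < norm (F y - F x - (y - x) *\<^sub>R f x)"
          using that C(2) C'(1) i by (auto simp: K_def E_def bad_def)
        have "norm (measure lborel (J i) *\<^sub>R f x - integral (J i) f) = norm (F y - F x - (y - x) *\<^sub>R f x)"
        proof (cases "x \<le> y")
          case True
          then show ?thesis using diff[of x y] xy by (simp add: i J_def norm_minus_commute)
        next
          case False
          then have "F x - F y = integral {y..x} f" using diff[of y x] xy by simp
          then have "integral {y..x} f = F x - F y" by simp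
          moreover have J: "J i = {y..x}" using False by (simp add: i J_def min_def max_def)
          moreover have "measure lborel {y..x} = x - y" using False by simp
          moreover have "(x - y) *\<^sub>R f x - (F x - F y) = F y - F x - (y - x) *\<^sub>R f x"
            by (simp add: algebra_simps)
          ultimately show ?thesis by (simp only:)
        qed
        moreover have "measure lebesgue (J i) = \<bar>y - x\<bar>" by (simp add: i J_def min_def max_def)
        ultimately show ?thesis using xy(5) by (simp add: i field_simps del: of_nat_Suc)
      qed
      have "measure lebesgue (\<Union>i\<in>C'. J i) \<le> (\<Sum>i\<in>C'. measure lebesgue (J i))"
        using C' by (intro measure_UNION_le) (auto simp: J_def)
      also have "\<dots> \<le> (\<Sum>i\<in>C'. Suc n * norm (measure lborel (J i) *\<^sub>R f (fst i) - integral (J i) f))"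
        by (intro sum_mono *)
      also have "\<dots> = Suc n * (\<Sum>i\<in>C'. norm (measure lborel (J i) *\<^sub>R f (fst i) - integral (J i) f))"
        by (simp add: sum_distrib_left)
      also have "\<dots> \<le> Suc n * (e / Suc n)"
        using S by (intro mult_left_mono) auto
      finally show ?thesis by simp
    qed
    have Jm: "J i \<in> lmeasurable" for i by (cases i) (auto simp: J_def)
    have U: "(\<Union>i\<in>C. J i) \<in> lmeasurable" "measure lebesgue (\<Union>i\<in>C. J i) \<le> e"
      using fmeasurable_UN_bound[OF C(1) Jm bound] measure_UN_bound[OF C(1) Jm bound] by auto
    show "\<exists>T. E n \<subseteq> T \<and> T \<in> lmeasurable \<and> measure lebesgue T \<le> e"
    proof (intro exI conjI)
      show "E n \<subseteq> (E n - (\<Union>i\<in>C. J i)) \<union> (\<Union>i\<in>C. J i)" by blast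
      show "(E n - (\<Union>i\<in>C. J i)) \<union> (\<Union>i\<in>C. J i) \<in> lmeasurable"
        using C(4) U(1) negligible_imp_measurable by (intro fmeasurable.Un) auto
      have "measure lebesgue ((E n - (\<Union>i\<in>C. J i)) \<union> (\<Union>i\<in>C. J i)) \<le>
          measure lebesgue (E n - (\<Union>i\<in>C. J i)) + measure lebesgue (\<Union>i\<in>C. J i)"
        using C(4) U(1) by (intro measure_Un_le)
          (auto simp: fmeasurableD negligible_imp_measurable)
      then show "measure lebesgue ((E n - (\<Union>i\<in>C. J i)) \<union> (\<Union>i\<in>C. J i)) \<le> e"
        using C(4) U(2) by (simp add: negligible_imp_measure0)
    qed
  qed
  then have "negligible (\<Union>n. E n)" by (intro negligible_countable_Union) auto
  moreover have "{x \<in> {a<..<b}. \<not> (F has_vector_derivative f x) (at x)} \<subseteq> (\<Union>n. E n)"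
  proof (rule subsetI, rule ccontr)
    fix x assume x: "x \<in> {x \<in> {a<..<b}. \<not> (F has_vector_derivative f x) (at x)}" and "x \<notin> (\<Union>n. E n)"
    then have n: "\<exists>d>0. \<forall>y\<in>{a<..<b}. \<bar>y - x\<bar> < d \<longrightarrow> \<not> bad n x y" for n
      by (auto simp: E_def)
    have "(F has_derivative (\<lambda>h. h *\<^sub>R f x)) (at x within {a<..<b})"
      unfolding has_derivative_within_alt
    proof (intro conjI allI impI)
      show "bounded_linear (\<lambda>h. h *\<^sub>R f x)" by (rule bounded_linear_scaleR_left)
      fix e :: real assume "e > 0"
      then obtain n where ne: "inverse (real (Suc n)) < e" using reals_Archimedean by blast
      obtain d where d: "d > 0" "\<forall>y\<in>{a<..<b}. \<bar>y - x\<bar> < d \<longrightarrow> \<not> bad n x y" using n by blast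
      have "norm (F y - F x - (y - x) *\<^sub>R f x) \<le> e * norm (y - x)"
        if "y \<in> {a<..<b}" "norm (y - x) < d" for y
      proof (cases "y = x")
        case False
        then have "norm (F y - F x - (y - x) *\<^sub>R f x) \<le> \<bar>y - x\<bar> / Suc n"
          using d that by (auto simp: bad_def not_less)
        also have "\<dots> = inverse (Suc n) * \<bar>y - x\<bar>" by (simp add: field_simps)
        also have "\<dots> \<le> e * \<bar>y - x\<bar>" using ne by (intro mult_right_mono) auto
        finally show ?thesis by simp
      qed simp
      then show "\<exists>d>0. \<forall>y\<in>{a<..<b}. norm (y - x) < d \<longrightarrow>
          norm (F y - F x - (y - x) *\<^sub>R f x) \<le> e * norm (y - x)"
        using d(1) by blast
    qed
    then have "(F has_vector_derivative f x) (at x)"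
      using x by (simp add: has_vector_derivative_def at_within_open[of x "{a<..<b}"])
    with x show False by simp
  qed
  ultimately show ?thesis unfolding F_def by (rule negligible_subset)
qed

section \<open>Absolutely continuous functions are integrals of their derivatives\<close>

text \<open>The definition of absolute continuity with indexed families of nondegenerate intervals in place
of divisions.\<close>

lemma absolutely_continuous_on_disjoint_familyD:
  assumes ac: "absolutely_continuous_on S f" and e: "e > 0"
  obtains d where "d > 0"
    "\<And>(B :: 'b set) u v. \<lbrakk>finite B; \<And>i. i \<in> B \<Longrightarrow> u i < v i \<and> {u i..v i} \<subseteq> S;
       \<And>i j. \<lbrakk>i \<in> B; j \<in> B; i \<noteq> j\<rbrakk> \<Longrightarrow> {u i<..<v i} \<inter> {u j<..<v j} = {};
       (\<Sum>i\<in>B. v i - u i) < d\<rbrakk> \<Longrightarrow> (\<Sum>i\<in>B. norm (f (v i) - f (u i))) < e"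
proof -
  obtain d where d: "d > 0" and D: "\<And>D. D division_of \<Union>D \<Longrightarrow> \<Union>D \<subseteq> S \<Longrightarrow>
      (\<Sum>K\<in>D. Sup K - Inf K) < d \<Longrightarrow> (\<Sum>K\<in>D. norm (f (Sup K) - f (Inf K))) < e"
    using ac e unfolding absolutely_continuous_on_def by meson
  have "(\<Sum>i\<in>B. norm (f (v i) - f (u i))) < e"
    if B: "finite B" "\<And>i. i \<in> B \<Longrightarrow> u i < v i \<and> {u i..v i} \<subseteq> S"
      and disj: "\<And>i j. \<lbrakk>i \<in> B; j \<in> B; i \<noteq> j\<rbrakk> \<Longrightarrow> {u i<..<v i} \<inter> {u j<..<v j} = {}"
      and sm: "(\<Sum>i\<in>B. v i - u i) < d" for B :: "'b set" and u v
  proof -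
    define D where "D = (\<lambda>i. {u i..v i}) ` B"
    have inj: "inj_on (\<lambda>i. {u i..v i}) B"
    proof (rule inj_onI, rule ccontr)
      fix i j assume ij: "i \<in> B" "j \<in> B" "{u i..v i} = {u j..v j}" "i \<noteq> j"
      then have "u i = u j" "v i = v j" using B(2)[of i] by (auto simp: Icc_eq_Icc)
      then have "{u i<..<v i} = {}" using disj[of i j] ij by auto
      then show False using B(2)[of i] ij by auto
    qed
    have si: "Sup {u i..v i} = v i" "Inf {u i..v i} = u i" if "i \<in> B" for i
      using B(2)[OF that] by auto
    have "D division_of \<Union>D"
    proof (rule division_ofI)
      show "finite D" using B by (simp add: D_def)
      fix K assume "K \<in> D"
      then obtain i where i: "i \<in> B" "K = {u i..v i}" by (auto simp: D_def)
      show "K \<subseteq> \<Union>D" using \<open>K \<in> D\<close> by auto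
      show "K \<noteq> {}" using i B(2)[of i] by auto
      show "\<exists>a b. K = cbox a b" using i by auto
    next
      fix K1 K2 assume "K1 \<in> D" "K2 \<in> D" "K1 \<noteq> K2"
      then obtain i j where "i \<in> B" "j \<in> B" "i \<noteq> j" "K1 = {u i..v i}" "K2 = {u j..v j}"
        by (auto simp: D_def)
      then show "interior K1 \<inter> interior K2 = {}"
        using disj[of i j] by (simp add: interior_atLeastAtMost_real)
    qed auto
    moreover have "\<Union>D \<subseteq> S" using B by (auto simp: D_def)
    moreover have "(\<Sum>K\<in>D. Sup K - Inf K) = (\<Sum>i\<in>B. v i - u i)"
      unfolding D_def sum.reindex[OF inj] by (intro sum.cong) (simp_all add: si)
    moreover have "(\<Sum>K\<in>D. norm (f (Sup K) - f (Inf K))) = (\<Sum>i\<in>B. norm (f (v i) - f (u i)))"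
      unfolding D_def sum.reindex[OF inj] by (intro sum.cong) (simp_all add: si)
    ultimately show ?thesis using D[of D] sm by simp
  qed
  with d that show thesis by blast
qed

lemma division_of_interval_Sup_Inf:
  fixes D :: "real set set"
  assumes "D division_of X" "K \<in> D"
  shows "K = {Inf K..Sup K}" "Inf K \<le> Sup K"
proof -
  obtain a b where "K = {a..b}" "K \<noteq> {}" using division_ofD(3,4)[OF assms] by auto
  then show "K = {Inf K..Sup K}" "Inf K \<le> Sup K" by auto
qed

lemma absolutely_continuous_on_subset:
  assumes "absolutely_continuous_on S f" "T \<subseteq> S"
  shows "absolutely_continuous_on T f"
  using assms unfolding absolutely_continuous_on_def by (meson order_trans)

lemma absolutely_continuous_on_imp_continuous_on:
  fixes f :: "real \<Rightarrow> 'a::real_normed_vector"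
  assumes ac: "absolutely_continuous_on {a..b} f"
  shows "continuous_on {a..b} f"
  unfolding continuous_on_iff
proof (intro ballI allI impI)
  fix x e :: real assume x: "x \<in> {a..b}" and e: "e > 0"
  obtain d where d: "d > 0" and D: "\<And>D. D division_of \<Union>D \<Longrightarrow> \<Union>D \<subseteq> {a..b} \<Longrightarrow>
      (\<Sum>K\<in>D. Sup K - Inf K) < d \<Longrightarrow> (\<Sum>K\<in>D. norm (f (Sup K) - f (Inf K))) < e"
    using ac e unfolding absolutely_continuous_on_def by meson
  have *: "norm (f v - f u) < e" if "u \<le> v" "v - u < d" "u \<in> {a..b}" "v \<in> {a..b}" for u v
    using D[of "{{u..v}}"] that division_of_self[of u v] by (auto simp: subset_iff)
  have "dist (f y) (f x) < e" if "y \<in> {a..b}" "dist y x < d" for y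
    using *[of x y] *[of y x] that x
    by (cases "x \<le> y") (auto simp: dist_norm norm_minus_commute abs_if split: if_splits)
  then show "\<exists>d>0. \<forall>x'\<in>{a..b}. dist x' x < d \<longrightarrow> dist (f x') (f x) < e"
    using d by blast
qed

lemma absolutely_continuous_on_bounded_combine:
  fixes f :: "real \<Rightarrow> 'a::real_normed_vector" and g :: "real \<Rightarrow> 'b::real_normed_vector"
    and h :: "real \<Rightarrow> 'c::real_normed_vector"
  assumes f: "absolutely_continuous_on S f" and g: "absolutely_continuous_on S g"
    and h: "\<And>x y. x \<in> S \<Longrightarrow> y \<in> S \<Longrightarrow>
        norm (h y - h x) \<le> C * (norm (f y - f x) + norm (g y - g x))"
  shows "absolutely_continuous_on S h"
  unfolding absolutely_continuous_on_def
proof (intro allI impI)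
  fix e :: real assume e: "e > 0"
  define C' where "C' = \<bar>C\<bar> + 1"
  have C': "C' > 0" "C \<le> C'" by (auto simp: C'_def)
  then have e': "e / (2 * C') > 0" using e by simp
  obtain d1 where d1: "d1 > 0" and D1: "\<And>D. D division_of \<Union>D \<Longrightarrow> \<Union>D \<subseteq> S \<Longrightarrow>
      (\<Sum>K\<in>D. Sup K - Inf K) < d1 \<Longrightarrow> (\<Sum>K\<in>D. norm (f (Sup K) - f (Inf K))) < e / (2 * C')"
    using f e' unfolding absolutely_continuous_on_def by meson
  obtain d2 where d2: "d2 > 0" and D2: "\<And>D. D division_of \<Union>D \<Longrightarrow> \<Union>D \<subseteq> S \<Longrightarrow>
      (\<Sum>K\<in>D. Sup K - Inf K) < d2 \<Longrightarrow> (\<Sum>K\<in>D. norm (g (Sup K) - g (Inf K))) < e / (2 * C')"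
    using g e' unfolding absolutely_continuous_on_def by meson
  have "(\<Sum>K\<in>D. norm (h (Sup K) - h (Inf K))) < e"
    if D: "D division_of \<Union>D" "\<Union>D \<subseteq> S" "(\<Sum>K\<in>D. Sup K - Inf K) < min d1 d2" for D
  proof -
    have K: "Sup K \<in> S \<and> Inf K \<in> S" if "K \<in> D" for K
    proof -
      have "K = {Inf K..Sup K}" "Inf K \<le> Sup K"
        by (rule division_of_interval_Sup_Inf[OF D(1) that])+
      then have "Sup K \<in> K" "Inf K \<in> K" by (metis atLeastAtMost_iff order_refl)+
      then show ?thesis using D(2) that by blast
    qed
    have "(\<Sum>K\<in>D. norm (h (Sup K) - h (Inf K)))
        \<le> (\<Sum>K\<in>D. C' * (norm (f (Sup K) - f (Inf K)) + norm (g (Sup K) - g (Inf K))))"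
    proof (rule sum_mono)
      fix K assume "K \<in> D"
      then have "norm (h (Sup K) - h (Inf K)) \<le> C * (norm (f (Sup K) - f (Inf K)) + norm (g (Sup K) - g (Inf K)))"
        using K by (intro h) auto
      also have "\<dots> \<le> C' * (norm (f (Sup K) - f (Inf K)) + norm (g (Sup K) - g (Inf K)))"
        using C' by (intro mult_right_mono) auto
      finally show "norm (h (Sup K) - h (Inf K)) \<le> \<dots>" .
    qed
    also have "\<dots> = C' * ((\<Sum>K\<in>D. norm (f (Sup K) - f (Inf K))) + (\<Sum>K\<in>D. norm (g (Sup K) - g (Inf K))))"
      by (simp add: sum_distrib_left sum.distrib distrib_left)
    also have "\<dots> < C' * (e / (2 * C') + e / (2 * C'))"
      using D D1[of D] D2[of D] C' by (intro mult_strict_left_mono add_strict_mono) auto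
    also have "\<dots> = e" using C' by simp
    finally show ?thesis .
  qed
  then show "\<exists>d>0. \<forall>D. D division_of \<Union>D \<and> \<Union>D \<subseteq> S \<and> (\<Sum>K\<in>D. Sup K - Inf K) < d \<longrightarrow>
      (\<Sum>K\<in>D. norm (h (Sup K) - h (Inf K))) < e"
    using d1 d2 by (intro exI[of _ "min d1 d2"]) auto
qed

text \<open>The definition of absolute continuity with each interval of a family refined by a finite
monotone chain of points; such chains compute the variation of $f$ on the interval.\<close>

lemma absolutely_continuous_on_chainsD:
  fixes f :: "real \<Rightarrow> real"
  assumes ac: "absolutely_continuous_on S f" and e: "e > 0"
  obtains d where "d > 0"
    "\<And>(A :: 'b set) u v n t. \<lbrakk>finite A;
       \<And>k. k \<in> A \<Longrightarrow> mono (t k) \<and> range (t k) \<subseteq> {u k..v k} \<and> {u k..v k} \<subseteq> S;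
       \<And>k l. \<lbrakk>k \<in> A; l \<in> A; k \<noteq> l\<rbrakk> \<Longrightarrow> {u k<..<v k} \<inter> {u l<..<v l} = {};
       (\<Sum>k\<in>A. v k - u k) < d\<rbrakk>
       \<Longrightarrow> (\<Sum>k\<in>A. \<Sum>i<n k. \<bar>f (t k (Suc i)) - f (t k i)\<bar>) < e"
proof -
  obtain d where d: "d > 0" and D: "\<And>(B :: ('b \<times> nat) set) u v. \<lbrakk>finite B; \<And>i. i \<in> B \<Longrightarrow> u i < v i \<and> {u i..v i} \<subseteq> S;
       \<And>i j. \<lbrakk>i \<in> B; j \<in> B; i \<noteq> j\<rbrakk> \<Longrightarrow> {u i<..<v i} \<inter> {u j<..<v j} = {};
       (\<Sum>i\<in>B. v i - u i) < d\<rbrakk> \<Longrightarrow> (\<Sum>i\<in>B. norm (f (v i) - f (u i))) < e"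
    by (rule absolutely_continuous_on_disjoint_familyD[OF ac e, where 'b = "'b \<times> nat"]) blast
  have *: "(\<Sum>k\<in>A. \<Sum>i<n k. \<bar>f (t k (Suc i)) - f (t k i)\<bar>) < e"
    if A: "finite A"
      and t: "\<And>k. k \<in> A \<Longrightarrow> mono (t k) \<and> range (t k) \<subseteq> {u k..v k} \<and> {u k..v k} \<subseteq> S"
      and disj: "\<And>k l. \<lbrakk>k \<in> A; l \<in> A; k \<noteq> l\<rbrakk> \<Longrightarrow> {u k<..<v k} \<inter> {u l<..<v l} = {}"
      and sm: "(\<Sum>k\<in>A. v k - u k) < d" for A :: "'b set" and u v n t
  proof -
    \<comment> \<open>Steps of a chain that do not move are dropped, since they give degenerate intervals.\<close>
    define B where "B = (SIGMA k:A. {i. i < n k \<and> t k i < t k (Suc i)})"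
    have fB: "finite B" unfolding B_def using A by (intro finite_SigmaI) auto
    have tm: "t k i \<le> t k (Suc i)" if "k \<in> A" for k i
      using t[OF that] by (auto simp: mono_def)
    have tr: "u k \<le> t k i \<and> t k i \<le> v k" if "k \<in> A" for k i
      using t[OF that] by (auto simp: image_subset_iff)
    have conv: "(\<Sum>k\<in>A. \<Sum>i<n k. g k i) = (\<Sum>(k,i)\<in>B. g k i)"
      if "\<And>k i. k \<in> A \<Longrightarrow> t k (Suc i) = t k i \<Longrightarrow> g k i = 0" for g :: "'b \<Rightarrow> nat \<Rightarrow> real"
    proof -
      have "(\<Sum>k\<in>A. \<Sum>i<n k. g k i) = (\<Sum>(k,i)\<in>(SIGMA k:A. {..<n k}). g k i)"
        using A by (simp add: sum.Sigma)
      also have "\<dots> = (\<Sum>(k,i)\<in>B. g k i)"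
        using A tm that by (intro sum.mono_neutral_right) (auto simp: B_def less_le)
      finally show ?thesis .
    qed
    have "(\<Sum>(k,i)\<in>B. norm (f (t k (Suc i)) - f (t k i))) < e"
    proof -
      have "(\<Sum>p\<in>B. norm (f (t (fst p) (Suc (snd p))) - f (t (fst p) (snd p)))) < e"
      proof (rule D[OF fB])
        fix p assume "p \<in> B"
        then have p: "fst p \<in> A" "t (fst p) (snd p) < t (fst p) (Suc (snd p))" by (auto simp: B_def)
        have "{t (fst p) (snd p)..t (fst p) (Suc (snd p))} \<subseteq> {u (fst p)..v (fst p)}"
          using tr[OF p(1)] by simp
        then show "t (fst p) (snd p) < t (fst p) (Suc (snd p)) \<and> {t (fst p) (snd p)..t (fst p) (Suc (snd p))} \<subseteq> S"
          using t[OF p(1)] p(2) by blast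
      next
        fix p q assume p: "p \<in> B" and q: "q \<in> B" and "p \<noteq> q"
        obtain k i where ki: "p = (k, i)" by (cases p)
        obtain l j where lj: "q = (l, j)" by (cases q)
        have kl: "k \<in> A" "l \<in> A" using p q ki lj by (auto simp: B_def)
        show "{t (fst p) (snd p)<..<t (fst p) (Suc (snd p))} \<inter> {t (fst q) (snd q)<..<t (fst q) (Suc (snd q))} = {}"
        proof (cases "k = l")
          case True
          then have "i < j \<or> j < i" using \<open>p \<noteq> q\<close> ki lj by auto
          then have "t k (Suc i) \<le> t k j \<or> t k (Suc j) \<le> t k i"
            using t[OF kl(1)] by (auto simp: mono_def Suc_le_eq)
          then show ?thesis using True by (auto simp: ki lj)
        next
          case False
          then have "{u k<..<v k} \<inter> {u l<..<v l} = {}" using disj kl by blast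
          moreover have "{t k i<..<t k (Suc i)} \<subseteq> {u k<..<v k}" "{t l j<..<t l (Suc j)} \<subseteq> {u l<..<v l}"
            using tr[OF kl(1)] tr[OF kl(2)] by (simp_all add: greaterThanLessThan_subseteq_greaterThanLessThan)
          ultimately show ?thesis unfolding ki lj by (simp only: fst_conv snd_conv) blast
        qed
      next
        have "(\<Sum>p\<in>B. t (fst p) (Suc (snd p)) - t (fst p) (snd p)) = (\<Sum>k\<in>A. \<Sum>i<n k. t k (Suc i) - t k i)"
          by (subst conv) (auto simp: split_def)
        also have "\<dots> = (\<Sum>k\<in>A. t k (n k) - t k 0)" by (simp add: sum_lessThan_telescope)
        also have "\<dots> \<le> (\<Sum>k\<in>A. v k - u k)" using tr by (intro sum_mono diff_mono) auto
        finally show "(\<Sum>p\<in>B. t (fst p) (Suc (snd p)) - t (fst p) (snd p)) < d" using sm by simp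
      qed
      then show ?thesis by (simp add: split_def)
    qed
    then show ?thesis by (subst conv) auto
  qed
  show thesis by (rule that[OF d], rule *)
qed

text \<open>The increments of an absolutely continuous function of bounded variation are dominated by those of
an absolutely continuous increasing function $V$, its total variation.  The variation on $[x,y]$ is the supremum
of the sums over finite monotone chains in $[x,y]$.  The bound $1$ is a normalization: it is
satisfied on sufficiently short intervals.\<close>

lemma absolutely_continuous_on_variation:
  fixes f :: "real \<Rightarrow> real"
  assumes ac: "absolutely_continuous_on {a..b} f"
    and bd: "\<And>n t. mono t \<Longrightarrow> range t \<subseteq> {a..b} \<Longrightarrow> (\<Sum>i<n. \<bar>f (t (Suc i)) - f (t i)\<bar>) \<le> (1::real)"
  obtains V where "absolutely_continuous_on {a..b} V"
    "\<And>x y. a \<le> x \<Longrightarrow> x \<le> y \<Longrightarrow> y \<le> b \<Longrightarrow> \<bar>f y - f x\<bar> \<le> V y - V x"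
proof -
  define ch where "ch = (\<lambda>x y. {(n::nat, t :: nat \<Rightarrow> real). mono t \<and> (\<forall>i. t i \<in> {x..y})})"
  define vs where "vs = (\<lambda>(n, t). \<Sum>i<n. \<bar>f (t (Suc i)) - f (t i :: real)\<bar>)"
  define tv where "tv x y = (SUP c\<in>ch x y. vs c)" for x y
  have bdd: "bdd_above (vs ` ch x y)" if "a \<le> x" "y \<le> b" for x y
  proof (rule bdd_aboveI2[where M = 1])
    fix c assume "c \<in> ch x y"
    then have c: "mono (snd c)" "\<And>i. snd c i \<in> {x..y}" by (auto simp: ch_def)
    moreover have "\<forall>i. a \<le> snd c i \<and> snd c i \<le> b"
      using that c(2) by (metis atLeastAtMost_iff order_trans)
    ultimately show "vs c \<le> 1"
      using bd[of "snd c" "fst c"] by (simp add: vs_def split_def image_subset_iff)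
  qed
  have ne: "(0, \<lambda>_. x) \<in> ch x y" if "x \<le> y" for x y
    using that by (auto simp: ch_def mono_def)
  have vs_le: "vs c \<le> tv x y" if "c \<in> ch x y" "a \<le> x" "y \<le> b" for c x y
    unfolding tv_def by (rule cSUP_upper[OF that(1) bdd[OF that(2,3)]])
  define V where "V x = tv a x" for x
  have inc: "\<bar>f y - f x\<bar> \<le> V y - V x" if xy: "a \<le> x" "x \<le> y" "y \<le> b" for x y
  proof -
    have "V x \<le> V y - \<bar>f y - f x\<bar>"
      unfolding V_def tv_def[of a x]
    proof (rule cSUP_least)
      show "ch a x \<noteq> {}" using ne[of a x] xy by auto
      fix c assume c: "c \<in> ch a x"
      obtain n t where nt: "c = (n, t)" by (cases c)
      define t' where "t' = (\<lambda>i. if i \<le> n then t i else if i = Suc n then x else y)"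
      have t: "mono t" "a \<le> t i" "t i \<le> x" for i using c by (auto simp: ch_def nt)
      have "mono t'"
        unfolding mono_iff_le_Suc using xy t by (auto simp: t'_def mono_def)
      moreover have "t' i \<in> {a..y}" for i using t(2,3)[of i] xy by (auto simp: t'_def)
      ultimately have "(Suc (Suc n), t') \<in> ch a y" by (simp add: ch_def)
      then have "vs (Suc (Suc n), t') \<le> tv a y" by (rule vs_le) (use xy in auto)
      moreover have "vs (Suc (Suc n), t') = vs (n, t) + \<bar>f x - f (t n)\<bar> + \<bar>f y - f x\<bar>"
        by (simp add: vs_def t'_def)
      ultimately show "vs c \<le> tv a y - \<bar>f y - f x\<bar>" by (simp add: nt)
    qed
    then show ?thesis by simp
  qed
  \<comment> \<open>A chain in \<open>{a..y}\<close> is split at \<open>x\<close> by taking the minimum and the maximum of its points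
    with \<open>x\<close>; no point has to be inserted.\<close>
  have split: "V y \<le> V x + tv x y" if xy: "a \<le> x" "x \<le> y" "y \<le> b" for x y
    unfolding V_def tv_def[of a y]
  proof (rule cSUP_least)
    show "ch a y \<noteq> {}" using ne[of a y] xy by auto
    fix c assume c: "c \<in> ch a y"
    obtain n t where nt: "c = (n, t)" by (cases c)
    have t: "mono t" "\<And>i. a \<le> t i \<and> t i \<le> y" using c by (auto simp: ch_def nt)
    have "(n, \<lambda>i. min (t i) x) \<in> ch a x"
      using t xy by (auto simp: ch_def mono_def min_le_iff_disj)
    moreover have "(n, \<lambda>i. max (t i) x) \<in> ch x y"
      using t xy by (auto simp: ch_def mono_def max_def intro: order_trans)
    moreover have "vs c \<le> vs (n, \<lambda>i. min (t i) x) + vs (n, \<lambda>i. max (t i) x)"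
      unfolding nt vs_def prod.case sum.distrib[symmetric]
      by (intro sum_mono) (auto simp: min_def max_def abs_if)
    ultimately show "vs c \<le> tv a x + tv x y"
      using vs_le[of _ a x] vs_le[of _ x y] xy by (smt (verit))
  qed
  have "absolutely_continuous_on {a..b} V"
    unfolding absolutely_continuous_on_def
  proof (intro allI impI)
    fix e :: real assume e: "e > 0"
    then have e2: "e / 2 > 0" by simp
    obtain d where d: "d > 0" and ch: "\<And>(A :: real set set) u v n t. \<lbrakk>finite A;
       \<And>k. k \<in> A \<Longrightarrow> mono (t k) \<and> range (t k) \<subseteq> {u k..v k} \<and> {u k..v k} \<subseteq> {a..b};
       \<And>k l. \<lbrakk>k \<in> A; l \<in> A; k \<noteq> l\<rbrakk> \<Longrightarrow> {u k<..<v k} \<inter> {u l<..<v l} = {};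
       (\<Sum>k\<in>A. v k - u k) < d\<rbrakk>
       \<Longrightarrow> (\<Sum>k\<in>A. \<Sum>i<n k. \<bar>f (t k (Suc i)) - f (t k i)\<bar>) < e / 2"
      by (rule absolutely_continuous_on_chainsD[OF ac e2, where 'b = "real set"]) blast
    have "(\<Sum>K\<in>D. norm (V (Sup K) - V (Inf K))) < e"
      if D: "D division_of \<Union>D" "\<Union>D \<subseteq> {a..b}" "(\<Sum>K\<in>D. Sup K - Inf K) < d" for D
    proof -
      have fD: "finite D" using D by (simp add: division_of_finite)
      have K: "K = {Inf K..Sup K}" "Inf K \<le> Sup K" if "K \<in> D" for K
        by (rule division_of_interval_Sup_Inf[OF D(1) that])+
      have Kab: "{Inf K..Sup K} \<subseteq> {a..b}" if "K \<in> D" for K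
        using K(1)[OF that] D(2) that by blast
      have ab: "a \<le> Inf K" "Sup K \<le> b" if "K \<in> D" for K
        using Kab[OF that] K(2)[OF that] by auto
      define \<eta> where "\<eta> = e / (2 * (card D + 1))"
      have \<eta>: "\<eta> > 0" using e by (simp add: \<eta>_def)
      have "\<exists>c. c \<in> ch (Inf K) (Sup K) \<and> tv (Inf K) (Sup K) - \<eta> < vs c" if "K \<in> D" for K
      proof -
        have "tv (Inf K) (Sup K) - \<eta> < (SUP c\<in>ch (Inf K) (Sup K). vs c)"
          using \<eta> by (simp add: tv_def)
        then show ?thesis
          using less_cSUP_iff[of "ch (Inf K) (Sup K)" vs "tv (Inf K) (Sup K) - \<eta>"] ne[OF K(2)[OF that]]
            bdd[OF ab[OF that]] by blast
      qed
      then obtain c where c: "\<And>K. K \<in> D \<Longrightarrow> c K \<in> ch (Inf K) (Sup K)"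
        "\<And>K. K \<in> D \<Longrightarrow> tv (Inf K) (Sup K) - \<eta> < vs (c K)" by metis
      have "(\<Sum>K\<in>D. norm (V (Sup K) - V (Inf K))) \<le> (\<Sum>K\<in>D. vs (c K) + \<eta>)"
      proof (rule sum_mono)
        fix K assume "K \<in> D"
        then show "norm (V (Sup K) - V (Inf K)) \<le> vs (c K) + \<eta>"
          using inc[of "Inf K" "Sup K"] split[of "Inf K" "Sup K"] ab[of K] K(2)[of K] c(2)[of K] by simp
      qed
      also have "\<dots> = (\<Sum>K\<in>D. \<Sum>i<fst (c K). \<bar>f (snd (c K) (Suc i)) - f (snd (c K) i)\<bar>) + card D * \<eta>"
        by (simp add: sum.distrib vs_def split_def)
      also have "\<dots> < e / 2 + e / 2"
      proof (rule add_less_le_mono)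
        show "(\<Sum>K\<in>D. \<Sum>i<fst (c K). \<bar>f (snd (c K) (Suc i)) - f (snd (c K) i)\<bar>) < e / 2"
        proof (rule ch[OF fD])
          show "mono (snd (c K)) \<and> range (snd (c K)) \<subseteq> {Inf K..Sup K} \<and> {Inf K..Sup K} \<subseteq> {a..b}"
            if "K \<in> D" for K
            using c(1)[OF that] Kab[OF that] by (auto simp: ch_def split_def image_subset_iff)
          fix K L assume KL: "K \<in> D" "L \<in> D" "K \<noteq> L"
          then have "interior K \<inter> interior L = {}" using division_ofD(5)[OF D(1)] by blast
          then show "{Inf K<..<Sup K} \<inter> {Inf L<..<Sup L} = {}"
            using K(1)[OF KL(1)] K(1)[OF KL(2)] by (metis interior_atLeastAtMost_real)
        qed (use D in auto)
        show "card D * \<eta> \<le> e / 2"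
          using e by (simp add: \<eta>_def field_simps)
      qed
      finally show ?thesis by simp
    qed
    then show "\<exists>d>0. \<forall>D. D division_of \<Union>D \<and> \<Union>D \<subseteq> {a..b} \<and> (\<Sum>K\<in>D. Sup K - Inf K) < d \<longrightarrow>
        (\<Sum>K\<in>D. norm (V (Sup K) - V (Inf K))) < e"
      using d by blast
  qed
  then show thesis using inc that by blast
qed

lemma null_set_outer_intervals:
  assumes "N \<in> null_sets lborel" "N \<subseteq> {a..b::real}" "0 < e"
  obtains D where "countable D"
    "\<And>K. K \<in> D \<Longrightarrow> K \<subseteq> {a..b} \<and> K \<noteq> {} \<and> (\<exists>c d. K = {c..d})"
    "pairwise (\<lambda>A B. interior A \<inter> interior B = {}) D"
    "N \<subseteq> \<Union>D" "\<Union>D \<in> lmeasurable" "measure lebesgue (\<Union>D) \<le> e"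
proof -
  have N: "negligible N"
    using assms(1) by (simp add: negligible_iff_null_sets null_sets_completionI)
  then have "N \<in> lmeasurable" "measure lebesgue N = 0"
    using negligible_imp_measurable negligible_imp_measure0 by auto
  then show thesis
    using measurable_outer_intervals_bounded[of N a b e] assms that by (metis add_0 box_real(2))
qed

text \<open>A null set in $[a,b]$ is covered by countably many nonoverlapping intervals of small total length,
on which $P$ has small total increase; outside $[a,b]$ the function $P$ is constant.\<close>

lemma absolutely_continuous_interval_measure:
  fixes P :: "real \<Rightarrow> real"
  assumes ac: "absolutely_continuous_on {a..b} P" and ab: "a \<le> b"
    and mono: "\<And>x y. x \<le> y \<Longrightarrow> P x \<le> P y"
    and cont: "continuous_on UNIV P"
    and left: "\<And>x. x \<le> a \<Longrightarrow> P x = P a" and right: "\<And>x. b \<le> x \<Longrightarrow> P x = P b"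
  shows "absolutely_continuous lborel (interval_measure P)"
  unfolding absolutely_continuous_def
proof
  let ?M = "interval_measure P"
  have Icc: "emeasure ?M {x..y} = P y - P x" if "x \<le> y" for x y
    by (rule emeasure_interval_measure_Icc[OF that mono cont])
  fix N assume N: "N \<in> null_sets (lborel :: real measure)"
  then have Ns: "N \<in> sets borel" by auto
  have inner: "N \<inter> {a..b} \<in> null_sets ?M"
  proof -
    have N': "N \<inter> {a..b} \<in> null_sets lborel" using N by (simp add: null_set_Int2)
    have "emeasure ?M (N \<inter> {a..b}) \<le> 0 + ennreal e" if e: "e > 0" for e
    proof -
      obtain d where d: "d > 0" and D: "\<And>D. D division_of \<Union>D \<Longrightarrow> \<Union>D \<subseteq> {a..b} \<Longrightarrow>
          (\<Sum>K\<in>D. Sup K - Inf K) < d \<Longrightarrow> (\<Sum>K\<in>D. norm (P (Sup K) - P (Inf K))) < e"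
        using ac e unfolding absolutely_continuous_on_def by meson
      obtain C where C: "countable C"
        "\<And>K. K \<in> C \<Longrightarrow> K \<subseteq> {a..b} \<and> K \<noteq> {} \<and> (\<exists>c d. K = {c..d})"
        "pairwise (\<lambda>A B. interior A \<inter> interior B = {}) C"
        "N \<inter> {a..b} \<subseteq> \<Union>C" "\<Union>C \<in> lmeasurable" "measure lebesgue (\<Union>C) \<le> d / 2"
        using null_set_outer_intervals[OF N', of a b "d / 2"] d by auto
      have Kf: "K \<in> fmeasurable ?M" if K: "K \<in> C" for K
        using C(2)[OF K] Icc by (intro fmeasurableI) auto
      have bnd: "measure ?M (\<Union>K\<in>C'. K) \<le> e" if C': "C' \<subseteq> C" "finite C'" for C'
      proof -
        have div: "C' division_of \<Union>C'"
        proof (rule division_ofI)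
          fix K assume "K \<in> C'"
          then have K: "K \<subseteq> {a..b} \<and> K \<noteq> {} \<and> (\<exists>c d. K = {c..d})" using C(2) C' by blast
          then show "K \<noteq> {}" "\<exists>a b. K = cbox a b" by simp_all
          show "K \<subseteq> \<Union>C'" using \<open>K \<in> C'\<close> by blast
        next
          show "interior K1 \<inter> interior K2 = {}" if "K1 \<in> C'" "K2 \<in> C'" "K1 \<noteq> K2" for K1 K2
            using C(3) C' that unfolding pairwise_def by blast
        qed (use C' in auto)
        have K: "K = {Inf K..Sup K}" "Inf K \<le> Sup K" if "K \<in> C'" for K
          by (rule division_of_interval_Sup_Inf[OF div that])+
        have "Sup K - Inf K = measure lebesgue K" if "K \<in> C'" for K
        proof -
          have "measure lebesgue {Inf K..Sup K} = Sup K - Inf K" using K(2)[OF that] by simp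
          then show ?thesis using K(1)[OF that] by simp
        qed
        then have "(\<Sum>K\<in>C'. Sup K - Inf K) = (\<Sum>K\<in>C'. measure lebesgue K)"
          by (intro sum.cong) auto
        also have "\<dots> = measure lebesgue (\<Union>C')"
          by (rule content_division[OF div])
        also have "\<dots> \<le> measure lebesgue (\<Union>C)"
        proof (rule measure_mono_fmeasurable)
          have "x \<in> sets lebesgue" if "x \<in> C'" for x
          proof -
            obtain c d where "x = {c..d}" using C(2)[of x] C' \<open>x \<in> C'\<close> by blast
            then show ?thesis by simp
          qed
          then show "\<Union>C' \<in> sets lebesgue" using C' by (intro sets.finite_Union) auto
        qed (use C C' in auto)
        also have "\<dots> < d" using C(6) d by simp
        finally have "(\<Sum>K\<in>C'. norm (P (Sup K) - P (Inf K))) < e"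
          using D[OF div] C(2) C' by blast
        moreover have "measure ?M (\<Union>K\<in>C'. K) \<le> (\<Sum>K\<in>C'. measure ?M K)"
          using C' Kf fmeasurableD by (intro measure_UNION_le) blast+
        moreover have "(\<Sum>K\<in>C'. measure ?M K) = (\<Sum>K\<in>C'. norm (P (Sup K) - P (Inf K)))"
        proof (intro sum.cong refl)
          fix K assume "K \<in> C'"
          note K[OF this]
          then have "emeasure ?M K = ennreal (P (Sup K) - P (Inf K))" using Icc by metis
          then show "measure ?M K = norm (P (Sup K) - P (Inf K))"
            using mono[OF \<open>Inf K \<le> Sup K\<close>] by (simp add: measure_def)
        qed
        ultimately show ?thesis by simp
      qed
      have U: "(\<Union>K\<in>C. K) \<in> fmeasurable ?M" "measure ?M (\<Union>K\<in>C. K) \<le> e"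
        using fmeasurable_UN_bound[OF C(1) Kf bnd] measure_UN_bound[OF C(1) Kf bnd] by auto
      have "emeasure ?M (N \<inter> {a..b}) \<le> emeasure ?M (\<Union>K\<in>C. K)"
        using C(4) U(1) by (intro emeasure_mono) (auto dest: fmeasurableD)
      also have "\<dots> = ennreal (measure ?M (\<Union>K\<in>C. K))"
        using U(1) by (simp add: emeasure_eq_measure2)
      also have "\<dots> \<le> ennreal e" using U(2) by (rule ennreal_leI)
      finally show ?thesis by simp
    qed
    then have "emeasure ?M (N \<inter> {a..b}) \<le> 0" by (rule ennreal_le_epsilon)
    then show ?thesis using Ns by (intro null_setsI) auto
  qed
  have "{a - real n..a} \<in> null_sets ?M" "{b..b + real n} \<in> null_sets ?M" for n
    using Icc[of "a - real n" a] Icc[of b "b + real n"] left[of "a - real n"] right[of "b + real n"]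
    by (auto intro!: null_setsI)
  then have "(N \<inter> {a..b}) \<union> ((\<Union>n::nat. {a - real n..a}) \<union> (\<Union>n::nat. {b..b + real n})) \<in> null_sets ?M"
    using inner by (intro null_sets.Un null_sets_UN) auto
  moreover have "N \<subseteq> (N \<inter> {a..b}) \<union> ((\<Union>n::nat. {a - real n..a}) \<union> (\<Union>n::nat. {b..b + real n}))"
  proof
    fix x assume "x \<in> N"
    obtain n :: nat where n: "\<bar>x\<bar> + \<bar>a\<bar> + \<bar>b\<bar> \<le> n" using real_arch_simple by blast
    show "x \<in> (N \<inter> {a..b}) \<union> ((\<Union>n::nat. {a - real n..a}) \<union> (\<Union>n::nat. {b..b + real n}))"
    proof -
      consider "x < a" | "x > b" | "x \<in> {a..b}" by fastforce
      then show ?thesis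
      proof cases
        case 1
        then have "x \<in> {a - real n..a}" using n by auto
        then show ?thesis by blast
      next
        case 2
        then have "x \<in> {b..b + real n}" using n by auto
        then show ?thesis by blast
      next
        case 3
        then show ?thesis using \<open>x \<in> N\<close> by blast
      qed
    qed
  qed
  ultimately show "N \<in> null_sets ?M"
    using null_sets_subset Ns by (metis sets_interval_measure)
qed

text \<open>The density is the Radon--Nikodym derivative of the interval measure of $P$, with $P$ extended
by constants outside $[a,b]$.\<close>

lemma absolutely_continuous_on_mono_density:
  fixes P :: "real \<Rightarrow> real"
  assumes ac: "absolutely_continuous_on {a..b} P" and ab: "a \<le> b"
    and mono: "\<And>x y. a \<le> x \<Longrightarrow> x \<le> y \<Longrightarrow> y \<le> b \<Longrightarrow> P x \<le> P y"
  obtains g where "g absolutely_integrable_on {a..b}"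
    "\<And>x. x \<in> {a..b} \<Longrightarrow> integral {a..x} g = P x - P a"
proof -
  define Q where "Q x = P (max a (min b x))" for x
  have QP: "Q x = P x" if "x \<in> {a..b}" for x using that by (auto simp: Q_def min_def max_def)
  have Qmono: "Q x \<le> Q y" if "x \<le> y" for x y
    unfolding Q_def using that ab by (intro mono) (auto simp: min_def max_def)
  have Qcont: "continuous_on UNIV Q"
    unfolding Q_def
    by (rule continuous_on_compose2[OF absolutely_continuous_on_imp_continuous_on[OF ac]])
       (use ab in \<open>auto intro!: continuous_intros\<close>)
  have "absolutely_continuous_on {a..b} Q"
    by (rule absolutely_continuous_on_bounded_combine[OF ac ac, where C = 1]) (simp add: QP)
  then have "absolutely_continuous lborel (interval_measure Q)"
    using ab Qmono Qcont
    by (rule absolutely_continuous_interval_measure) (use ab in \<open>auto simp: Q_def min_def max_def\<close>)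
  then obtain f where f: "f \<in> borel_measurable lborel" "density lborel f = interval_measure Q"
    using sigma_finite_measure.Radon_Nikodym[OF sigma_finite_lborel, of "interval_measure Q"] by auto
  have [measurable]: "f \<in> borel_measurable borel" using f by simp
  have nn: "(\<integral>\<^sup>+x. f x * indicator {a..y} x \<partial>lborel) = ennreal (P y - P a)" if "y \<in> {a..b}" for y
  proof -
    have "emeasure (density lborel f) {a..y} = ennreal (Q y - Q a)"
      unfolding f(2) using that by (intro emeasure_interval_measure_Icc Qmono Qcont) auto
    then show ?thesis using that ab by (simp add: emeasure_density QP)
  qed
  have fin: "AE x in lborel. f x * indicator {a..b} x \<noteq> \<infinity>"
    using nn[of b] ab by (intro nn_integral_PInf_AE) auto
  define g where "g x = enn2real (f x)" for x
  have gb: "has_bochner_integral lborel (\<lambda>x. indicator {a..y} x *\<^sub>R g x) (P y - P a)" if y: "y \<in> {a..b}" for y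
  proof (rule has_bochner_integral_nn_integral)
    have "(\<integral>\<^sup>+x. ennreal (indicator {a..y} x *\<^sub>R g x) \<partial>lborel) = (\<integral>\<^sup>+x. f x * indicator {a..y} x \<partial>lborel)"
    proof (rule nn_integral_cong_AE)
      show "AE x in lborel. ennreal (indicator {a..y} x *\<^sub>R g x) = f x * indicator {a..y} x"
        using fin
      proof eventually_elim
        case (elim x)
        then show ?case using y by (auto simp: g_def indicator_def less_top split: if_splits)
      qed
    qed
    then show "(\<integral>\<^sup>+x. ennreal (indicator {a..y} x *\<^sub>R g x) \<partial>lborel) = ennreal (P y - P a)"
      using nn[OF y] by simp
    show "0 \<le> P y - P a" using mono[of a y] y by simp
  qed (auto simp: g_def)
  have gI: "set_integrable lborel {a..y} g" "(LINT x:{a..y}|lborel. g x) = P y - P a" if "y \<in> {a..b}" for y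
    using gb[OF that] by (auto simp: set_integrable_def set_lebesgue_integral_def has_bochner_integral_iff)
  show thesis
  proof (rule that[of g])
    show "g absolutely_integrable_on {a..b}"
      using gI(1)[of b] ab unfolding set_integrable_def
      by (subst integrable_completion) (auto simp: g_def)
    show "integral {a..x} g = P x - P a" if "x \<in> {a..b}" for x
      using set_borel_integral_eq_integral(2)[OF gI(1)[OF that]] gI(2)[OF that] by simp
  qed
qed

lemma indefinite_integral_has_vector_derivative:
  fixes f g :: "real \<Rightarrow> 'a::euclidean_space"
  assumes g: "g integrable_on {a..b}"
    and fg: "\<And>x. x \<in> {a..b} \<Longrightarrow> integral {a..x} g = f x - f a"
  shows "negligible {x \<in> {a<..<b}. \<not> (f has_vector_derivative g x) (at x)}"
proof (rule negligible_subset[OF negligible_not_vector_derivative_indefinite_integral[OF g]])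
  have "(f has_vector_derivative g x) (at x)"
    if x: "x \<in> {a<..<b}" and d: "((\<lambda>u. integral {a..u} g) has_vector_derivative g x) (at x)" for x
  proof -
    have "((\<lambda>u. integral {a..u} g + f a) has_vector_derivative g x + 0) (at x)"
      by (intro derivative_intros d)
    then have "((\<lambda>u. integral {a..u} g + f a) has_vector_derivative g x) (at x)" by simp
    then show ?thesis
      by (rule has_vector_derivative_transform_within_open[of _ _ _ "{a<..<b}"])
         (use x fg in \<open>auto simp: fg\<close>)
  qed
  then show "{x \<in> {a<..<b}. \<not> (f has_vector_derivative g x) (at x)}
      \<subseteq> {x \<in> {a<..<b}. \<not> ((\<lambda>u. integral {a..u} g) has_vector_derivative g x) (at x)}"
    by blast
qed

lemma indefinite_integral_vector_derivative:
  fixes f g :: "real \<Rightarrow> 'a::euclidean_space"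
  assumes g: "g absolutely_integrable_on {a..b}"
    and fg: "\<And>x. x \<in> {a..b} \<Longrightarrow> integral {a..x} g = f x - f a"
  shows "(\<lambda>x. vector_derivative f (at x)) absolutely_integrable_on {a..b}"
    "\<And>x. x \<in> {a..b} \<Longrightarrow> integral {a..x} (\<lambda>x. vector_derivative f (at x)) = f x - f a"
proof -
  let ?N = "{x \<in> {a<..<b}. \<not> (f has_vector_derivative g x) (at x)} \<union> {a, b}"
  have N: "negligible ?N"
    using indefinite_integral_has_vector_derivative[OF _ fg] g
    by (intro negligible_Un) (auto simp: absolutely_integrable_on_def)
  have eq: "vector_derivative f (at x) = g x" if "x \<in> {a..b} - ?N" for x
    using that by (auto intro!: vector_derivative_at)
  show "(\<lambda>x. vector_derivative f (at x)) absolutely_integrable_on {a..b}"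
    by (rule absolutely_integrable_spike[OF g N]) (rule eq)
  show "integral {a..x} (\<lambda>x. vector_derivative f (at x)) = f x - f a" if x: "x \<in> {a..b}" for x
    unfolding fg[OF x, symmetric]
    by (rule integral_spike[OF N]) (use x eq in auto)
qed

text \<open>The assertion is additive in the interval, so that it may be proved on intervals so short that
the variation of $f$ is at most $1$.  There $f = V - (V - f)$ is the difference of two increasing
absolutely continuous functions.\<close>

lemma absolutely_continuous_on_integral_derivative:
  fixes f :: "real \<Rightarrow> real"
  assumes ac: "absolutely_continuous_on {a..b} f" and ab: "a \<le> b"
  shows "(\<lambda>x. vector_derivative f (at x)) absolutely_integrable_on {a..b} \<and>
    integral {a..b} (\<lambda>x. vector_derivative f (at x)) = f b - f a"
proof -
  let ?D = "\<lambda>x. vector_derivative f (at x)"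
  define P where "P u v \<longleftrightarrow> ({u..v} \<subseteq> {a..b} \<longrightarrow>
    ?D absolutely_integrable_on {u..v} \<and> integral {u..v} ?D = f v - f u)" for u v
  have "P a b"
  proof (rule Bolzano[OF ab])
    fix x y z assume trans: "P x y" "P y z" "x \<le> y" "y \<le> z"
    show "P x z" unfolding P_def
    proof
      assume "{x..z} \<subseteq> {a..b}"
      then have "?D absolutely_integrable_on {x..y}" "integral {x..y} ?D = f y - f x"
        "?D absolutely_integrable_on {y..z}" "integral {y..z} ?D = f z - f y"
        using trans by (auto simp: P_def)
      moreover from this have I: "?D absolutely_integrable_on {x..z}"
        using absolutely_integrable_on_combine trans by blast
      moreover have "integral {x..y} ?D + integral {y..z} ?D = integral {x..z} ?D"
        using trans I
        by (intro Henstock_Kurzweil_Integration.integral_combine) (auto simp: absolutely_integrable_on_def)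
      ultimately show "?D absolutely_integrable_on {x..z} \<and> integral {x..z} ?D = f z - f x"
        by simp
    qed
  next
    fix x assume "a \<le> x" "x \<le> b"
    obtain d where d: "d > 0" and ch: "\<And>(A :: unit set) u v n t. \<lbrakk>finite A;
       \<And>k. k \<in> A \<Longrightarrow> mono (t k) \<and> range (t k) \<subseteq> {u k..v k} \<and> {u k..v k} \<subseteq> {a..b};
       \<And>k l. \<lbrakk>k \<in> A; l \<in> A; k \<noteq> l\<rbrakk> \<Longrightarrow> {u k<..<v k} \<inter> {u l<..<v l} = {};
       (\<Sum>k\<in>A. v k - u k) < d\<rbrakk>
       \<Longrightarrow> (\<Sum>k\<in>A. \<Sum>i<n k. \<bar>f (t k (Suc i)) - f (t k i)\<bar>) < 1"
      by (rule absolutely_continuous_on_chainsD[OF ac zero_less_one, where 'b = unit]) blast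
    have "?D absolutely_integrable_on {u..v} \<and> integral {u..v} ?D = f v - f u"
      if uv: "u \<le> x" "x \<le> v" "v - u < d" "{u..v} \<subseteq> {a..b}" for u v
    proof -
      have ac': "absolutely_continuous_on {u..v} f"
        using ac uv(4) by (rule absolutely_continuous_on_subset)
      have bd: "(\<Sum>i<n. \<bar>f (t (Suc i)) - f (t i)\<bar>) \<le> (1::real)"
        if "mono t" "range t \<subseteq> {u..v}" for n t
        using ch[of "{()}" "\<lambda>_. t" "\<lambda>_. u" "\<lambda>_. v" "\<lambda>_. n"] uv that by auto
      obtain V where V: "absolutely_continuous_on {u..v} V"
        "\<And>x y. u \<le> x \<Longrightarrow> x \<le> y \<Longrightarrow> y \<le> v \<Longrightarrow> \<bar>f y - f x\<bar> \<le> V y - V x"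
      proof (rule absolutely_continuous_on_variation[OF ac'])
        show "(\<Sum>i<n. \<bar>f (t (Suc i)) - f (t i)\<bar>) \<le> (1::real)"
          if "mono t" "range t \<subseteq> {u..v}" for n t by (rule bd[OF that])
      qed (rule that)
      have uv': "u \<le> v" using uv by simp
      obtain g1 where g1: "g1 absolutely_integrable_on {u..v}"
        "\<And>x. x \<in> {u..v} \<Longrightarrow> integral {u..x} g1 = V x - V u"
      proof (rule absolutely_continuous_on_mono_density[OF V(1) uv'])
        show "V x \<le> V y" if "u \<le> x" "x \<le> y" "y \<le> v" for x y using V(2)[OF that] by simp
      qed blast
      have "absolutely_continuous_on {u..v} (\<lambda>x. V x - f x)"
        by (rule absolutely_continuous_on_bounded_combine[OF V(1) ac', where C = 1]) simp
      then obtain g2 where g2: "g2 absolutely_integrable_on {u..v}"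
        "\<And>x. x \<in> {u..v} \<Longrightarrow> integral {u..x} g2 = (V x - f x) - (V u - f u)"
      proof (rule absolutely_continuous_on_mono_density[OF _ uv'])
        show "V x - f x \<le> V y - f y" if "u \<le> x" "x \<le> y" "y \<le> v" for x y using V(2)[OF that] by simp
      qed blast
      have g: "(\<lambda>x. g1 x - g2 x) absolutely_integrable_on {u..v}"
        by (intro set_integral_diff g1 g2)
      have fg: "integral {u..x} (\<lambda>x. g1 x - g2 x) = f x - f u" if x: "x \<in> {u..v}" for x
      proof -
        have "{u..x} \<subseteq> {u..v}" using x by auto
        then have "g1 integrable_on {u..x}" "g2 integrable_on {u..x}"
          using g1(1) g2(1) by (meson absolutely_integrable_on_def integrable_on_subinterval)+
        then show ?thesis using g1(2)[OF x] g2(2)[OF x] by (simp add: integral_diff)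
      qed
      show ?thesis
        using indefinite_integral_vector_derivative[OF g fg] uv' by auto
    qed
    then show "\<exists>d>0. \<forall>u v. u \<le> x \<and> x \<le> v \<and> v - u < d \<longrightarrow> P u v"
      using d unfolding P_def by blast
  qed
  then show ?thesis by (simp add: P_def)
qed

section \<open>Indefinite integrals on open sets\<close>

text \<open>$f$ is an indefinite integral of $g$ on every compact interval contained in $I$, with $g$ locally
absolutely integrable.  Values of $f$ and $g$ outside $I$ are irrelevant, and $g$ matters only up
to null sets (\<open>primitive_on_cong\<close>).\<close>

definition primitive_on :: "real set \<Rightarrow> (real \<Rightarrow> 'a::euclidean_space) \<Rightarrow> (real \<Rightarrow> 'a) \<Rightarrow> bool" where
  "primitive_on I f g \<longleftrightarrow> (\<forall>c d. c \<le> d \<longrightarrow> {c..d} \<subseteq> I \<longrightarrow>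
     g absolutely_integrable_on {c..d} \<and> integral {c..d} g = f d - f c)"

lemma primitive_onD:
  assumes "primitive_on I f g" "c \<le> d" "{c..d} \<subseteq> I"
  shows "g absolutely_integrable_on {c..d}" "g integrable_on {c..d}" "integral {c..d} g = f d - f c"
  using assms by (auto simp: primitive_on_def absolutely_integrable_on_def)

lemma AE_open_rational_intervals:
  fixes I :: "real set"
  assumes "open I"
    and "\<And>c d. c \<le> d \<Longrightarrow> {c..d} \<subseteq> I \<Longrightarrow> negligible {x \<in> {c<..<d}. \<not> P x}"
  shows "AE x in lebesgue. x \<in> I \<longrightarrow> P x"
proof -
  let ?R = "{(c, d). c \<in> \<rat> \<and> d \<in> \<rat> \<and> c \<le> d \<and> {c..d} \<subseteq> I}"
  have "countable ?R"
    by (rule countable_subset[of _ "\<rat> \<times> \<rat>"]) (auto simp: countable_rat)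
  then have "negligible (\<Union>(c,d)\<in>?R. {x \<in> {c<..<d}. \<not> P x})"
    using assms(2) by (intro negligible_countable_Union) auto
  moreover have "{x. \<not> (x \<in> I \<longrightarrow> P x)} \<subseteq> (\<Union>(c,d)\<in>?R. {x \<in> {c<..<d}. \<not> P x})"
  proof
    fix x assume x: "x \<in> {x. \<not> (x \<in> I \<longrightarrow> P x)}"
    then obtain e where e: "e > 0" "ball x e \<subseteq> I"
      using assms(1) by (auto simp: open_contains_ball)
    obtain c where c: "c \<in> \<rat>" "x - e < c" "c < x" using Rats_dense_in_real[of "x - e" x] e by auto
    obtain d where d: "d \<in> \<rat>" "x < d" "d < x + e" using Rats_dense_in_real[of x "x + e"] e by auto
    have "{c..d} \<subseteq> I" using c d e(2) by (auto simp: dist_real_def subset_iff)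
    then show "x \<in> (\<Union>(c,d)\<in>?R. {x \<in> {c<..<d}. \<not> P x})"
      using c d x by (intro UN_I[of "(c, d)"]) auto
  qed
  ultimately have "negligible {x. \<not> (x \<in> I \<longrightarrow> P x)}" by (rule negligible_subset)
  then show ?thesis
    by (intro AE_I'[where N = "{x. \<not> (x \<in> I \<longrightarrow> P x)}"]) (auto simp: negligible_iff_null_sets)
qed

lemma primitive_on_has_vector_derivative:
  fixes f :: "real \<Rightarrow> 'a::euclidean_space"
  assumes "open I" "primitive_on I f g"
  shows "AE x in lebesgue. x \<in> I \<longrightarrow> (f has_vector_derivative g x) (at x)"
proof (rule AE_open_rational_intervals[OF assms(1)])
  fix c d assume cd: "c \<le> d" "{c..d} \<subseteq> I"
  show "negligible {x \<in> {c<..<d}. \<not> (f has_vector_derivative g x) (at x)}"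
  proof (rule indefinite_integral_has_vector_derivative)
    show "g integrable_on {c..d}" using primitive_onD[OF assms(2) cd] by blast
    show "integral {c..x} g = f x - f c" if "x \<in> {c..d}" for x
      using that cd by (intro primitive_onD(3)[OF assms(2)]) auto
  qed
qed

lemma primitive_on_imp_AC_loc:
  fixes f :: "real \<Rightarrow> 'a::euclidean_space"
  assumes "primitive_on I f g"
  shows "f \<in> AC_loc I"
  unfolding AC_loc_def
proof (intro CollectI allI impI)
  fix a b assume ab: "{a..b} \<subseteq> I"
  show "absolutely_continuous_on {a..b} f"
    unfolding absolutely_continuous_on_def
  proof (intro allI impI)
    fix e :: real assume e: "e > 0"
    have "\<exists>d>0. \<forall>D. D division_of \<Union>D \<and> \<Union>D \<subseteq> {a..b} \<and> (\<Sum>K\<in>D. Sup K - Inf K) < d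
        \<longrightarrow> (\<Sum>K\<in>D. norm (f (Sup K) - f (Inf K))) < e" if "a \<le> b"
    proof -
      define h where "h x = norm (g x)" for x
      have g: "g absolutely_integrable_on {a..b}" using primitive_onD[OF assms that ab] by blast
      then have h: "h integrable_on {a..b}" by (auto simp: absolutely_integrable_on_def h_def[abs_def])
      \<comment> \<open>Truncation at height \<open>n\<close>: the part of \<open>h\<close> above \<open>n\<close> has small integral, and the part
        below contributes at most \<open>n\<close> times the total length.\<close>
      define k where "k n x = min (h x) (real n)" for n x
      have k: "k n integrable_on {a..b}" for n
      proof -
        have "(\<lambda>x. norm (g x)) absolutely_integrable_on {a..b}"
          using absolutely_integrable_norm[OF g] by (simp add: o_def)
        then have "(\<lambda>x. min (norm (g x)) (real n)) absolutely_integrable_on {a..b}"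
          by (intro absolutely_integrable_min_1) auto
        then show ?thesis by (simp add: k_def[abs_def] h_def absolutely_integrable_on_def)
      qed
      have "(\<lambda>n. integral {a..b} (k n)) \<longlonglongrightarrow> integral {a..b} h"
      proof (rule dominated_convergence(2)[OF k h])
        show "norm (k n x) \<le> h x" if "x \<in> {a..b}" for n x by (simp add: k_def h_def)
        show "(\<lambda>n. k n x) \<longlonglongrightarrow> h x" if "x \<in> {a..b}" for x
        proof (rule tendsto_eventually)
          obtain N :: nat where "h x \<le> N" using real_arch_simple by blast
          then show "\<forall>\<^sub>F n in sequentially. k n x = h x"
            by (intro eventually_sequentiallyI[of N]) (auto simp: k_def)
        qed
      qed
      then obtain n where "dist (integral {a..b} (k n)) (integral {a..b} h) < e / 2"
        using e by (metis LIMSEQ_iff_nz half_gt_zero lim_sequentially order_refl)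
      then have n: "integral {a..b} (\<lambda>x. h x - k n x) < e / 2"
        using h k by (simp add: integral_diff dist_real_def abs_if split: if_splits)
      have hk: "(\<lambda>x. h x - k n x) integrable_on {a..b}" using h k by (rule integrable_diff)
      have "(\<Sum>K\<in>D. norm (f (Sup K) - f (Inf K))) < e"
        if D: "D division_of \<Union>D" "\<Union>D \<subseteq> {a..b}" "(\<Sum>K\<in>D. Sup K - Inf K) < e / (2 * (n + 1))" for D
      proof -
        have K: "K = {Inf K..Sup K}" "Inf K \<le> Sup K" if "K \<in> D" for K
          by (rule division_of_interval_Sup_Inf[OF D(1) that])+
        have Kab: "{Inf K..Sup K} \<subseteq> {a..b}" if "K \<in> D" for K
          using K(1)[OF that] D(2) that by blast
        have "norm (f (Sup K) - f (Inf K)) \<le> integral K (\<lambda>x. h x - k n x) + n * (Sup K - Inf K)"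
          if "K \<in> D" for K
        proof -
          have gK: "g absolutely_integrable_on {Inf K..Sup K}"
            "integral {Inf K..Sup K} g = f (Sup K) - f (Inf K)"
            using primitive_onD[OF assms K(2)[OF that] order_trans[OF Kab[OF that] ab]] by auto
          have hK: "h integrable_on {Inf K..Sup K}" "(\<lambda>x. h x - k n x) integrable_on {Inf K..Sup K}"
            using Kab[OF that] h hk integrable_on_subinterval by blast+
          have "norm (f (Sup K) - f (Inf K)) \<le> integral {Inf K..Sup K} h"
            unfolding gK(2)[symmetric] using gK hK
            by (intro integral_norm_bound_integral) (auto simp: h_def absolutely_integrable_on_def)
          also have "\<dots> \<le> integral {Inf K..Sup K} (\<lambda>x. (h x - k n x) + n)"
            using hK by (intro integral_le integrable_add) (auto simp: k_def)
          also have "\<dots> = integral {Inf K..Sup K} (\<lambda>x. h x - k n x) + n * (Sup K - Inf K)"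
            using hK K(2)[OF that] by (subst integral_add) auto
          finally show ?thesis using K(1)[OF that] by simp
        qed
        then have "(\<Sum>K\<in>D. norm (f (Sup K) - f (Inf K))) \<le>
            (\<Sum>K\<in>D. integral K (\<lambda>x. h x - k n x)) + n * (\<Sum>K\<in>D. Sup K - Inf K)"
          by (simp add: sum_distrib_left sum.distrib[symmetric] sum_mono)
        also have "(\<Sum>K\<in>D. integral K (\<lambda>x. h x - k n x)) = integral (\<Union>D) (\<lambda>x. h x - k n x)"
          using D(1) K Kab hk
          by (intro integral_combine_division_bottomup[symmetric]) (metis integrable_on_subinterval)+
        also have "\<dots> \<le> integral {a..b} (\<lambda>x. h x - k n x)"
        proof (rule integral_subset_le[OF D(2) _ hk])
          show "(\<lambda>x. h x - k n x) integrable_on \<Union>D"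
            using D hk by (metis integrable_on_subdivision)
        qed (simp add: k_def)
        also have "n * (\<Sum>K\<in>D. Sup K - Inf K) \<le> n * (e / (2 * (n + 1)))"
          using D(3) by (intro mult_left_mono) auto
        also have "\<dots> \<le> e / 2" using e by (simp add: field_simps)
        finally show ?thesis using n by simp
      qed
      then show ?thesis using e by (intro exI[of _ "e / (2 * (n + 1))"]) auto
    qed
    moreover have "\<exists>d>0. \<forall>D. D division_of \<Union>D \<and> \<Union>D \<subseteq> {a..b} \<and> (\<Sum>K\<in>D. Sup K - Inf K) < d
        \<longrightarrow> (\<Sum>K\<in>D. norm (f (Sup K) - f (Inf K))) < e" if "\<not> a \<le> b"
    proof -
      have "D = {}" if "D division_of \<Union>D" "\<Union>D \<subseteq> {a..b}" for D
        using division_ofD(3)[OF that(1)] that(2) \<open>\<not> a \<le> b\<close> by fastforce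
      then show ?thesis using e by (intro exI[of _ 1]) (metis sum.empty zero_less_one)
    qed
    ultimately show "\<exists>d>0. \<forall>D. D division_of \<Union>D \<and> \<Union>D \<subseteq> {a..b} \<and> (\<Sum>K\<in>D. Sup K - Inf K) < d
        \<longrightarrow> (\<Sum>K\<in>D. norm (f (Sup K) - f (Inf K))) < e" by blast
  qed
qed

lemma AC_loc_imp_primitive_on:
  fixes f :: "real \<Rightarrow> complex"
  assumes "f \<in> AC_loc I"
  shows "primitive_on I f (\<lambda>x. vector_derivative f (at x))"
  unfolding primitive_on_def
proof (intro allI impI)
  fix a b assume ab: "a \<le> (b::real)" "{a..b} \<subseteq> I"
  have ac: "absolutely_continuous_on {a..b} f" using assms ab(2) by (auto simp: AC_loc_def)
  have "absolutely_continuous_on {a..b} (\<lambda>x. Re (f x))"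
    by (rule absolutely_continuous_on_bounded_combine[OF ac ac, where C = "1 / 2"])
       (use abs_Re_le_cmod[of "f y - f x" for x y] in simp)
  moreover have "absolutely_continuous_on {a..b} (\<lambda>x. Im (f x))"
    by (rule absolutely_continuous_on_bounded_combine[OF ac ac, where C = "1 / 2"])
       (use abs_Im_le_cmod[of "f y - f x" for x y] in simp)
  ultimately have AC: "absolutely_continuous_on {a..x} (\<lambda>x. Re (f x))"
      "absolutely_continuous_on {a..x} (\<lambda>x. Im (f x))" if "x \<le> b" for x
    using that by (auto elim!: absolutely_continuous_on_subset)
  define u where "u x = vector_derivative (\<lambda>x. Re (f x)) (at x)" for x
  define v where "v x = vector_derivative (\<lambda>x. Im (f x)) (at x)" for x
  have u: "u absolutely_integrable_on {a..x}" "integral {a..x} u = Re (f x) - Re (f a)"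
    if "x \<in> {a..b}" for x
    using absolutely_continuous_on_integral_derivative[OF AC(1)] that unfolding u_def[abs_def] by auto
  have v: "v absolutely_integrable_on {a..x}" "integral {a..x} v = Im (f x) - Im (f a)"
    if "x \<in> {a..b}" for x
    using absolutely_continuous_on_integral_derivative[OF AC(2)] that unfolding v_def[abs_def] by auto
  define g where "g x = complex_of_real (u x) + \<i> * complex_of_real (v x)" for x
  have U: "(\<lambda>x. complex_of_real (u x)) absolutely_integrable_on {a..x}"
    "(\<lambda>x. \<i> * complex_of_real (v x)) absolutely_integrable_on {a..x}" if "x \<in> {a..b}" for x
    using absolutely_integrable_linear[OF u(1)[OF that] bounded_linear_of_real]
      absolutely_integrable_linear[OF absolutely_integrable_linear[OF v(1)[OF that] bounded_linear_of_real]
        bounded_linear_mult_right[of \<i>]] by (simp_all add: o_def)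
  have g: "g absolutely_integrable_on {a..b}"
    unfolding g_def[abs_def] using U[of b] ab by (intro set_integral_add) auto
  have fg: "integral {a..x} g = f x - f a" if x: "x \<in> {a..b}" for x
  proof -
    have "integral {a..x} g = integral {a..x} (\<lambda>x. complex_of_real (u x)) + integral {a..x} (\<lambda>x. \<i> * complex_of_real (v x))"
      unfolding g_def[abs_def] using U[OF x] by (intro integral_add) (auto simp: absolutely_integrable_on_def)
    also have "\<dots> = complex_of_real (integral {a..x} u) + \<i> * complex_of_real (integral {a..x} v)"
    proof -
      have *: "integral {a..x} (\<lambda>x. complex_of_real (w x)) = complex_of_real (integral {a..x} w)"
        if "w absolutely_integrable_on {a..x}" for w
        using that integral_linear[of w "{a..x}" complex_of_real, OF _ bounded_linear_of_real]
        by (simp add: o_def absolutely_integrable_on_def)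
      show ?thesis using *[OF u(1)[OF x]] *[OF v(1)[OF x]] by simp
    qed
    also have "\<dots> = f x - f a" unfolding u(2)[OF x] v(2)[OF x] by (simp add: complex_eq_iff)
    finally show ?thesis .
  qed
  show "(\<lambda>x. vector_derivative f (at x)) absolutely_integrable_on {a..b} \<and>
      integral {a..b} (\<lambda>x. vector_derivative f (at x)) = f b - f a"
    using indefinite_integral_vector_derivative[OF g fg] ab by auto
qed

lemma AC_loc_continuous_on:
  fixes f :: "real \<Rightarrow> 'a::real_normed_vector"
  assumes "open I" "f \<in> AC_loc I"
  shows "continuous_on I f"
proof (rule continuous_at_imp_continuous_on, rule ballI)
  fix x assume "x \<in> I"
  then obtain e where e: "e > 0" "cball x e \<subseteq> I" using assms(1) open_contains_cball by blast
  then have "{x - e..x + e} \<subseteq> I" by (simp add: cball_eq_atLeastAtMost)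
  then have "continuous_on {x - e..x + e} f"
    using assms(2) by (intro absolutely_continuous_on_imp_continuous_on) (auto simp: AC_loc_def)
  moreover have "x \<in> interior {x - e..x + e}" using e(1) by simp
  ultimately show "isCont f x" by (rule continuous_on_interior)
qed

lemma primitive_on_continuous_on:
  fixes f :: "real \<Rightarrow> 'a::euclidean_space"
  assumes "open I" "primitive_on I f g"
  shows "continuous_on I f"
  using AC_loc_continuous_on[OF assms(1) primitive_on_imp_AC_loc[OF assms(2)]] .

lemma AE_lebesgue_negligible:
  assumes "AE x in lebesgue. P x"
  shows "negligible {x :: 'a::euclidean_space. \<not> P x}"
proof -
  obtain N where "N \<in> null_sets lebesgue" "{x \<in> space lebesgue. \<not> P x} \<subseteq> N"
    using assms by (auto simp: eventually_ae_filter)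
  then show ?thesis by (auto simp: negligible_iff_null_sets[symmetric] intro: negligible_subset)
qed

text \<open>Hence a function in \<open>dom_max\<close> is determined pointwise by its class in $L^2$.\<close>

lemma AE_eq_continuous_imp_eq:
  fixes f g :: "real \<Rightarrow> 'a::t2_space"
  assumes I: "open I" and f: "continuous_on I f" and g: "continuous_on I g"
    and ae: "AE x in lebesgue. x \<in> I \<longrightarrow> f x = g x" and x: "x \<in> I"
  shows "f x = g x"
proof (rule ccontr)
  assume ne: "f x \<noteq> g x"
  then obtain U V where UV: "open U" "open V" "f x \<in> U" "g x \<in> V" "U \<inter> V = {}"
    using hausdorff[OF ne] by metis
  define W where "W = (f -` U \<inter> I) \<inter> (g -` V \<inter> I)"
  have "open (f -` U \<inter> I)" "open (g -` V \<inter> I)"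
    using continuous_on_open_vimage[OF I, THEN iffD1, OF f] continuous_on_open_vimage[OF I, THEN iffD1, OF g]
      UV(1,2) by simp_all
  then have "open W" unfolding W_def by (rule open_Int)
  moreover have "x \<in> W" using UV x by (simp add: W_def)
  moreover have "W \<subseteq> {x. \<not> (x \<in> I \<longrightarrow> f x = g x)}" using UV by (auto simp: W_def)
  moreover have "negligible {x. \<not> (x \<in> I \<longrightarrow> f x = g x)}"
    by (rule AE_lebesgue_negligible[OF ae])
  ultimately show False
    using open_not_negligible negligible_subset by blast
qed

lemma primitive_on_subset: "primitive_on I f g \<Longrightarrow> J \<subseteq> I \<Longrightarrow> primitive_on J f g"
  unfolding primitive_on_def by blast

lemma primitive_on_cong:
  assumes "primitive_on I f g" "\<And>x. x \<in> I \<Longrightarrow> f x = f' x"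
    and "AE x in lebesgue. x \<in> I \<longrightarrow> g x = g' x"
  shows "primitive_on I f' g'"
  unfolding primitive_on_def
proof (intro allI impI)
  fix c d assume cd: "c \<le> (d::real)" "{c..d} \<subseteq> I"
  note P = primitive_onD[OF assms(1) cd]
  have N: "negligible {x. \<not> (x \<in> I \<longrightarrow> g x = g' x)}"
    by (rule AE_lebesgue_negligible[OF assms(3)])
  have *: "g' x = g x" if "x \<in> {c..d} - {x. \<not> (x \<in> I \<longrightarrow> g x = g' x)}" for x
    using that cd by auto
  have "f' c = f c" "f' d = f d" using assms(2)[of c] assms(2)[of d] cd by auto
  then show "g' absolutely_integrable_on {c..d} \<and> integral {c..d} g' = f' d - f' c"
    using absolutely_integrable_spike[OF P(1) N *] integral_spike[OF N *, of "{c..d}"] P(3) by simp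
qed

lemma primitive_on_add:
  assumes "primitive_on I f g" "primitive_on I f' g'"
  shows "primitive_on I (\<lambda>x. f x + f' x) (\<lambda>x. g x + g' x)"
  unfolding primitive_on_def
proof (intro allI impI)
  fix c d assume cd: "c \<le> (d::real)" "{c..d} \<subseteq> I"
  note P = primitive_onD[OF assms(1) cd] and Q = primitive_onD[OF assms(2) cd]
  show "(\<lambda>x. g x + g' x) absolutely_integrable_on {c..d} \<and>
      integral {c..d} (\<lambda>x. g x + g' x) = f d + f' d - (f c + f' c)"
    using set_integral_add(1)[OF P(1) Q(1)] integral_add[OF P(2) Q(2)] P(3) Q(3) by simp
qed

lemma primitive_on_cmult:
  fixes f :: "real \<Rightarrow> complex"
  assumes "primitive_on I f g"
  shows "primitive_on I (\<lambda>x. c * f x) (\<lambda>x. c * g x)"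
  using assms unfolding primitive_on_def by (simp add: right_diff_distrib)

lemma primitive_on_diff:
  fixes f :: "real \<Rightarrow> complex"
  assumes "primitive_on I f g" "primitive_on I f' g'"
  shows "primitive_on I (\<lambda>x. f x - f' x) (\<lambda>x. g x - g' x)"
  using primitive_on_add[OF assms(1) primitive_on_cmult[OF assms(2), of "-1"]] by simp

lemma primitive_on_cnj:
  assumes "primitive_on I f g"
  shows "primitive_on I (\<lambda>x. cnj (f x)) (\<lambda>x. cnj (g x))"
  unfolding primitive_on_def
proof (intro allI impI)
  fix c d assume cd: "c \<le> (d::real)" "{c..d} \<subseteq> I"
  note P = primitive_onD[OF assms cd]
  show "(\<lambda>x. cnj (g x)) absolutely_integrable_on {c..d} \<and>
      integral {c..d} (\<lambda>x. cnj (g x)) = cnj (f d) - cnj (f c)"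
    using absolutely_integrable_linear[OF P(1) bounded_linear_cnj]
      integral_linear[OF P(2) bounded_linear_cnj] P(3) by (simp add: o_def)
qed

lemma primitive_on_const: "primitive_on I (\<lambda>x. c) (\<lambda>x. 0)"
  by (simp add: primitive_on_def)

lemma AC_loc_mult:
  fixes f g :: "real \<Rightarrow> complex"
  assumes "open I" "f \<in> AC_loc I" "g \<in> AC_loc I"
  shows "(\<lambda>x. f x * g x) \<in> AC_loc I"
  unfolding AC_loc_def
proof (intro CollectI allI impI)
  fix c d assume cd: "{c..d} \<subseteq> I"
  have f: "absolutely_continuous_on {c..d} f" and g: "absolutely_continuous_on {c..d} g"
    using assms cd by (auto simp: AC_loc_def)
  obtain A where A: "\<forall>x\<in>{c..d}. cmod (f x) \<le> A"
    using compact_imp_bounded[OF compact_continuous_image[OF absolutely_continuous_on_imp_continuous_on[OF f]]]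
    by (auto simp: bounded_iff)
  obtain B where B: "\<forall>x\<in>{c..d}. cmod (g x) \<le> B"
    using compact_imp_bounded[OF compact_continuous_image[OF absolutely_continuous_on_imp_continuous_on[OF g]]]
    by (auto simp: bounded_iff)
  show "absolutely_continuous_on {c..d} (\<lambda>x. f x * g x)"
  proof (rule absolutely_continuous_on_bounded_combine[OF f g, where C = "\<bar>A\<bar> + \<bar>B\<bar>"])
    fix x y assume xy: "x \<in> {c..d}" "y \<in> {c..d}"
    have "f y * g y - f x * g x = (f y - f x) * g y + f x * (g y - g x)" by (simp add: algebra_simps)
    then have "norm (f y * g y - f x * g x) \<le> norm (f y - f x) * norm (g y) + norm (f x) * norm (g y - g x)"
      by (metis norm_mult norm_triangle_ineq)
    also have "\<dots> \<le> norm (f y - f x) * (\<bar>A\<bar> + \<bar>B\<bar>) + (\<bar>A\<bar> + \<bar>B\<bar>) * norm (g y - g x)"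
      using A[rule_format, OF xy(1)] B[rule_format, OF xy(2)] by (intro add_mono mult_mono) auto
    finally show "norm (f y * g y - f x * g x) \<le> (\<bar>A\<bar> + \<bar>B\<bar>) * (norm (f y - f x) + norm (g y - g x))"
      by (simp add: algebra_simps)
  qed
qed

lemma primitive_on_mult:
  fixes f g :: "real \<Rightarrow> complex"
  assumes I: "open I" and f: "primitive_on I f f'" and g: "primitive_on I g g'"
  shows "primitive_on I (\<lambda>x. f x * g x) (\<lambda>x. f x * g' x + f' x * g x)"
proof (rule primitive_on_cong)
  show "primitive_on I (\<lambda>x. f x * g x) (\<lambda>x. vector_derivative (\<lambda>x. f x * g x) (at x))"
    by (intro AC_loc_imp_primitive_on AC_loc_mult I primitive_on_imp_AC_loc[OF f] primitive_on_imp_AC_loc[OF g])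
  show "AE x in lebesgue. x \<in> I \<longrightarrow>
      vector_derivative (\<lambda>x. f x * g x) (at x) = f x * g' x + f' x * g x"
    using primitive_on_has_vector_derivative[OF I f] primitive_on_has_vector_derivative[OF I g]
    by eventually_elim (auto intro!: vector_derivative_at has_vector_derivative_mult)
qed simp

lemma primitive_on_AE_unique:
  fixes f :: "real \<Rightarrow> complex"
  assumes I: "open I" and f: "primitive_on I f g" and g: "primitive_on I f' g'"
    and eq: "\<And>x. x \<in> I \<Longrightarrow> f x = f' x"
  shows "AE x in lebesgue. x \<in> I \<longrightarrow> g x = g' x"
proof -
  have "primitive_on I f g'" by (rule primitive_on_cong[OF g]) (auto simp: eq)
  from primitive_on_has_vector_derivative[OF I f] primitive_on_has_vector_derivative[OF I this]
  show ?thesis by eventually_elim (auto intro: vector_derivative_unique_at)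
qed

text \<open>A primitive that vanishes at $d$ may be replaced by $0$ to the left of $d$.\<close>

lemma primitive_on_cut_off:
  fixes f g :: "real \<Rightarrow> complex"
  assumes f: "primitive_on I f f'" and d: "d \<in> I" and z: "f d = 0"
  shows "primitive_on I (\<lambda>x. if x \<le> d then 0 else f x) (\<lambda>x. if x \<le> d then 0 else f' x)"
  unfolding primitive_on_def
proof (intro allI impI)
  let ?g = "\<lambda>x. if x \<le> d then 0 else f' x" and ?f = "\<lambda>x. if x \<le> d then 0 else f x"
  fix a b assume ab: "a \<le> (b::real)" "{a..b} \<subseteq> I"
  have right: "?g absolutely_integrable_on {u..v} \<and> integral {u..v} ?g = f v - f u"
    if "d \<le> u" "u \<le> v" "{u..v} \<subseteq> I" for u v
  proof -
    have *: "negligible {d}" "\<And>x. x \<in> {u..v} - {d} \<Longrightarrow> ?g x = f' x" using that by auto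
    show ?thesis
      using absolutely_integrable_spike[OF primitive_onD(1)[OF f that(2,3)] *]
        integral_spike[OF *(1), of "{u..v}" ?g f'] * primitive_onD(3)[OF f that(2,3)] by auto
  qed
  have left: "?g absolutely_integrable_on {u..v} \<and> integral {u..v} ?g = 0" if "v \<le> d" for u v
  proof -
    have *: "\<And>x. x \<in> {u..v} \<Longrightarrow> ?g x = 0" using that by auto
    show ?thesis
      using absolutely_integrable_spike[where f = "\<lambda>x. 0" and T = "{u..v}" and S = "{}" and g = ?g] *
        integral_cong[of "{u..v}" ?g "\<lambda>_. 0"] by auto
  qed
  consider "b \<le> d" | "d \<le> a" | "a \<le> d" "d \<le> b" by linarith
  then show "?g absolutely_integrable_on {a..b} \<and> integral {a..b} ?g = ?f b - ?f a"
  proof cases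
    case 1
    then show ?thesis using left[of b a] ab by auto
  next
    case 2
    then have "?f a = f a" "?f b = f b" using ab z by (cases "a = d"; cases "b = d"; auto)+
    then show ?thesis using right[of a b] ab 2 by simp
  next
    case 3
    then have L: "?g absolutely_integrable_on {a..d}" "integral {a..d} ?g = 0" using left[of d a] by auto
    have R: "?g absolutely_integrable_on {d..b}" "integral {d..b} ?g = f b - f d"
      using right[of d b] 3 ab by (auto simp: subset_iff)
    have A: "?g absolutely_integrable_on {a..b}"
      using absolutely_integrable_on_combine[OF L(1) R(1)] 3 by auto
    moreover have "integral {a..b} ?g = integral {a..d} ?g + integral {d..b} ?g"
      using 3 A by (intro Henstock_Kurzweil_Integration.integral_combine[symmetric])
        (auto simp: absolutely_integrable_on_def)
    moreover have "?f a = 0" using 3 by simp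
    moreover have "?f b = f b" using 3 z by auto
    ultimately show ?thesis using L R z by simp
  qed
qed

section \<open>Square-integrable functions\<close>

lemma L2_D:
  assumes "f \<in> L2 M"
  shows "f \<in> borel_measurable M" "integrable M (\<lambda>x. (cmod (f x))\<^sup>2)"
  using assms by (auto simp: L2_def)

lemma L2_norm_nonneg: "0 \<le> L2_norm M f"
  by (simp add: L2_norm_def)

lemma L2_norm_square: "(L2_norm M f)\<^sup>2 = (LINT x|M. (cmod (f x))\<^sup>2)"
  by (simp add: L2_norm_def)

lemma L2_mult_integrable:
  assumes f: "f \<in> L2 M" and g: "g \<in> L2 M"
  shows "integrable M (\<lambda>x. f x * g x)" "integrable M (\<lambda>x. cmod (f x) * cmod (g x))"
proof -
  have [measurable]: "f \<in> borel_measurable M" "g \<in> borel_measurable M" using f g by (auto simp: L2_def)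
  have I: "integrable M (\<lambda>x. (cmod (f x))\<^sup>2 + (cmod (g x))\<^sup>2)" using f g by (auto simp: L2_def)
  have *: "cmod (f x) * cmod (g x) \<le> (cmod (f x))\<^sup>2 + (cmod (g x))\<^sup>2" for x
  proof -
    have "0 \<le> cmod (f x) * cmod (g x)" by simp
    then show ?thesis using sum_squares_bound[of "cmod (f x)" "cmod (g x)"] by linarith
  qed
  show "integrable M (\<lambda>x. f x * g x)"
    by (rule Bochner_Integration.integrable_bound[OF I]) (use * in \<open>auto simp: norm_mult\<close>)
  show "integrable M (\<lambda>x. cmod (f x) * cmod (g x))"
    by (rule Bochner_Integration.integrable_bound[OF I]) (use * in \<open>auto simp: norm_mult\<close>)
qed

lemma L2_Cauchy_Schwarz:
  assumes f: "f \<in> L2 M" and g: "g \<in> L2 M"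
  shows "(LINT x|M. cmod (f x) * cmod (g x)) \<le> L2_norm M f * L2_norm M g"
proof -
  let ?A = "LINT x|M. (cmod (f x))\<^sup>2" and ?B = "LINT x|M. (cmod (g x))\<^sup>2"
    and ?C = "LINT x|M. cmod (f x) * cmod (g x)"
  have i: "integrable M (\<lambda>x. (cmod (f x))\<^sup>2)" "integrable M (\<lambda>x. (cmod (g x))\<^sup>2)"
    "integrable M (\<lambda>x. cmod (f x) * cmod (g x))"
    using L2_mult_integrable[OF f g] L2_D[OF f] L2_D[OF g] by auto
  have Q: "0 \<le> s\<^sup>2 * ?A - 2 * s * ?C + ?B" for s
  proof -
    have "0 \<le> (LINT x|M. (s * cmod (f x) - cmod (g x))\<^sup>2)" by simp
    also have "\<dots> = (LINT x|M. s\<^sup>2 * (cmod (f x))\<^sup>2 - 2 * s * (cmod (f x) * cmod (g x)) + (cmod (g x))\<^sup>2)"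
      by (simp add: power2_diff power_mult_distrib algebra_simps)
    also have "\<dots> = s\<^sup>2 * ?A - 2 * s * ?C + ?B"
      using i by simp
    finally show ?thesis .
  qed
  have A: "0 \<le> ?A" and B: "0 \<le> ?B" and C: "0 \<le> ?C" by simp_all
  have "?C\<^sup>2 \<le> ?A * ?B"
  proof (cases "?A = 0")
    case True
    have "?C = 0"
    proof (rule ccontr)
      assume "?C \<noteq> 0"
      then have "?C > 0" using C by linarith
      then show False using Q[of "(?B + 1) / (2 * ?C)"] True by (simp add: field_simps)
    qed
    then show ?thesis using True by simp
  next
    case False
    then have "?A > 0" using A by linarith
    then show ?thesis using Q[of "?C / ?A"] by (simp add: field_simps power2_eq_square)
  qed
  then have "sqrt (?C\<^sup>2) \<le> sqrt (?A * ?B)" by (rule real_sqrt_le_mono)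
  then show ?thesis using C by (simp add: L2_norm_def real_sqrt_mult)
qed

lemma L2_add:
  assumes f: "f \<in> L2 M" and g: "g \<in> L2 M"
  shows "(\<lambda>x. f x + g x) \<in> L2 M" "L2_norm M (\<lambda>x. f x + g x) \<le> L2_norm M f + L2_norm M g"
proof -
  have [measurable]: "f \<in> borel_measurable M" "g \<in> borel_measurable M" using f g by (auto simp: L2_def)
  have i: "integrable M (\<lambda>x. (cmod (f x))\<^sup>2)" "integrable M (\<lambda>x. (cmod (g x))\<^sup>2)"
    "integrable M (\<lambda>x. cmod (f x) * cmod (g x))"
    using L2_mult_integrable[OF f g] L2_D[OF f] L2_D[OF g] by auto
  then have I: "integrable M (\<lambda>x. (cmod (f x))\<^sup>2 + 2 * (cmod (f x) * cmod (g x)) + (cmod (g x))\<^sup>2)" by auto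
  have le: "(cmod (f x + g x))\<^sup>2 \<le> (cmod (f x))\<^sup>2 + 2 * (cmod (f x) * cmod (g x)) + (cmod (g x))\<^sup>2" for x
  proof -
    have "(cmod (f x + g x))\<^sup>2 \<le> (cmod (f x) + cmod (g x))\<^sup>2"
      by (intro power_mono norm_triangle_ineq) simp
    then show ?thesis by (simp add: power2_sum algebra_simps)
  qed
  have s: "integrable M (\<lambda>x. (cmod (f x + g x))\<^sup>2)"
    by (rule Bochner_Integration.integrable_bound[OF I]) (use le in \<open>auto simp: abs_of_nonneg\<close>)
  then show "(\<lambda>x. f x + g x) \<in> L2 M" by (simp add: L2_def)
  have "(LINT x|M. (cmod (f x + g x))\<^sup>2) \<le>
      (LINT x|M. (cmod (f x))\<^sup>2 + 2 * (cmod (f x) * cmod (g x)) + (cmod (g x))\<^sup>2)"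
    by (rule integral_mono[OF s I le])
  also have "\<dots> = (L2_norm M f)\<^sup>2 + 2 * (LINT x|M. cmod (f x) * cmod (g x)) + (L2_norm M g)\<^sup>2"
    using i by (simp add: L2_norm_square)
  also have "\<dots> \<le> (L2_norm M f)\<^sup>2 + 2 * (L2_norm M f * L2_norm M g) + (L2_norm M g)\<^sup>2"
    using L2_Cauchy_Schwarz[OF f g] by simp
  also have "\<dots> = (L2_norm M f + L2_norm M g)\<^sup>2" by (simp add: power2_sum)
  finally show "L2_norm M (\<lambda>x. f x + g x) \<le> L2_norm M f + L2_norm M g"
    by (simp add: L2_norm_def[of M "\<lambda>x. f x + g x"] real_le_lsqrt L2_norm_nonneg)
qed

lemma L2_cmult:
  assumes f: "f \<in> L2 M"
  shows "(\<lambda>x. c * f x) \<in> L2 M" "L2_norm M (\<lambda>x. c * f x) = cmod c * L2_norm M f"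
  using f by (auto simp: L2_def L2_norm_def norm_mult power_mult_distrib real_sqrt_mult)

lemma L2_diff:
  assumes f: "f \<in> L2 M" and g: "g \<in> L2 M"
  shows "(\<lambda>x. f x - g x) \<in> L2 M" "L2_norm M (\<lambda>x. f x - g x) \<le> L2_norm M f + L2_norm M g"
  using L2_add[OF f L2_cmult(1)[OF g, of "-1"]] L2_cmult(2)[OF g, of "-1"] by simp_all

lemma L2_norm_zero [simp]: "L2_norm M (\<lambda>x. 0) = 0"
  by (simp add: L2_norm_def)

lemma L2_cnj: "f \<in> L2 M \<Longrightarrow> (\<lambda>x. cnj (f x)) \<in> L2 M"
  by (auto simp: L2_def intro!: measurable_compose[OF _ borel_measurable_continuous_onI[OF continuous_on_cnj[OF continuous_on_id]]])

lemma L2_AE_cong: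
  assumes f: "f \<in> L2 M" and g: "g \<in> borel_measurable M" and eq: "AE x in M. f x = g x"
  shows "g \<in> L2 M"
proof -
  have "integrable M (\<lambda>x. (cmod (f x))\<^sup>2) \<longleftrightarrow> integrable M (\<lambda>x. (cmod (g x))\<^sup>2)"
    using eq f g by (intro integrable_cong_AE) (auto simp: L2_def elim!: eventually_mono)
  then show ?thesis using f g by (simp add: L2_def)
qed

lemma L2_norm_AE_cong:
  assumes "f \<in> borel_measurable M" "g \<in> borel_measurable M" "AE x in M. f x = g x"
  shows "L2_norm M f = L2_norm M g"
  unfolding L2_norm_def using assms by (intro arg_cong[where f = sqrt] integral_cong_AE) auto

lemma L2_norm_zero_AE:
  assumes "f \<in> L2 M" "L2_norm M f = 0"
  shows "AE x in M. f x = 0"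
proof -
  have "(LINT x|M. (cmod (f x))\<^sup>2) = 0" using assms(2) by (simp add: L2_norm_def)
  then have "AE x in M. (cmod (f x))\<^sup>2 = 0"
    using integral_nonneg_eq_0_iff_AE[of M "\<lambda>x. (cmod (f x))\<^sup>2"] assms(1) by (auto simp: L2_def)
  then show ?thesis by eventually_elim simp
qed

lemma L2_mono:
  assumes "g \<in> L2 M" "f \<in> borel_measurable M" "\<And>x. cmod (f x) \<le> cmod (g x)"
  shows "f \<in> L2 M" "L2_norm M f \<le> L2_norm M g"
proof -
  have i: "integrable M (\<lambda>x. (cmod (f x))\<^sup>2)"
    by (rule Bochner_Integration.integrable_bound[OF L2_D(2)[OF assms(1)]])
       (use assms in \<open>auto intro!: power_mono simp: abs_of_nonneg\<close>)
  then show "f \<in> L2 M" using assms by (simp add: L2_def)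
  show "L2_norm M f \<le> L2_norm M g"
    unfolding L2_norm_def using assms
    by (intro real_sqrt_le_mono integral_mono[OF i L2_D(2)[OF assms(1)]] power_mono) auto
qed

section \<open>Sturm--Liouville expressions in integral form\<close>

text \<open>The abbreviations \<open>I\<close>, \<open>p\<close>, \<open>q\<close>, \<open>r\<close> and \<open>M\<close> denote the interval $(a,b)$, the
coefficients, and the measure $r\,dx$ on $(a,b)$; \<open>cp\<close>, \<open>cq\<close>, \<open>cr\<close> are the coefficients as
complex functions.\<close>

locale sl_problem =
  fixes S :: sl_data
  assumes sl: "sturm_liouville S"
begin

abbreviation I where "I \<equiv> sl_int S"
abbreviation p where "p \<equiv> p_coeff S"
abbreviation q where "q \<equiv> q_coeff S"
abbreviation r where "r \<equiv> r_coeff S"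
abbreviation M where "M \<equiv> sl_measure S"
abbreviation cp where "cp x \<equiv> complex_of_real (p_coeff S x)"
abbreviation cq where "cq x \<equiv> complex_of_real (q_coeff S x)"
abbreviation cr where "cr x \<equiv> complex_of_real (r_coeff S x)"

lemma open_I: "open I"
  by (simp add: sl_int_def)

lemma I_lebesgue [measurable]: "I \<in> sets lebesgue"
  by (simp add: sl_int_def)

lemma Icc_subset_I: "x \<in> I \<Longrightarrow> y \<in> I \<Longrightarrow> {x..y} \<subseteq> I"
  unfolding sl_int_def einterval_iff subset_iff
  by (metis atLeastAtMost_iff ereal_less_eq(3) le_less_trans less_le_trans)

lemma I_nonempty: obtains c where "c \<in> I"
  using sl einterval_nonempty[of "lend S" "rend S"] by (auto simp: sturm_liouville_def sl_int_def)

lemma r_pos: "AE x in lebesgue. x \<in> I \<longrightarrow> 0 < r x"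
  and p_pos: "AE x in lebesgue. x \<in> I \<longrightarrow> 0 < p x"
  using sl by (auto simp: sturm_liouville_def)

lemma coeff_absolutely_integrable:
  assumes "{c..d} \<subseteq> I"
  shows "r absolutely_integrable_on {c..d}" "(\<lambda>x. 1 / p x) absolutely_integrable_on {c..d}"
    "q absolutely_integrable_on {c..d}"
  using sl assms by (auto simp: sturm_liouville_def locally_integrable_on_def)

lemma r_measurable [measurable]: "r \<in> borel_measurable (restrict_space lebesgue I)"
  using sl by (auto simp: sturm_liouville_def)

lemma sets_M [measurable_cong]: "sets M = sets (restrict_space lebesgue I)"
  by (simp add: sl_measure_def)

lemma space_M: "space M = I"
  by (simp add: sl_measure_def space_restrict_space)

text \<open>Since $r > 0$ almost everywhere, $r\,dx$ and Lebesgue measure on $(a,b)$ have the same null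
sets.\<close>

lemma AE_M: "(AE x in M. P x) \<longleftrightarrow> (AE x in lebesgue. x \<in> I \<longrightarrow> P x)"
proof -
  have "(AE x in M. P x) \<longleftrightarrow> (AE x in restrict_space lebesgue I. 0 < ennreal (r x) \<longrightarrow> P x)"
    unfolding sl_measure_def by (subst AE_density) auto
  also have "\<dots> \<longleftrightarrow> (AE x in lebesgue. x \<in> I \<longrightarrow> 0 < ennreal (r x) \<longrightarrow> P x)"
    by (subst AE_restrict_space_iff) auto
  also have "\<dots> \<longleftrightarrow> (AE x in lebesgue. x \<in> I \<longrightarrow> P x)"
  proof
    assume "AE x in lebesgue. x \<in> I \<longrightarrow> 0 < ennreal (r x) \<longrightarrow> P x"
    then show "AE x in lebesgue. x \<in> I \<longrightarrow> P x" using r_pos by eventually_elim auto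
  qed (auto elim!: eventually_mono)
  finally show ?thesis .
qed

lemma continuous_measurable_M:
  fixes f :: "real \<Rightarrow> 'a::euclidean_space"
  assumes "continuous_on I f"
  shows "f \<in> borel_measurable M"
  unfolding measurable_cong_sets[OF sets_M refl]
  by (rule continuous_imp_measurable_on_sets_lebesgue[OF assms I_lebesgue])

text \<open>This relies on the completeness of Lebesgue measure.\<close>

lemma measurable_M_AE_cong:
  fixes f g :: "real \<Rightarrow> complex"
  assumes f: "f \<in> borel_measurable M" and eq: "AE x in M. f x = g x"
  shows "g \<in> borel_measurable M"
proof -
  have f': "(\<lambda>x. indicator I x *\<^sub>R f x) \<in> borel_measurable lebesgue"
    using f unfolding measurable_cong_sets[OF sets_M refl]
    by (subst (asm) borel_measurable_restrict_space_iff) auto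
  have N: "negligible {x. \<not> (x \<in> I \<longrightarrow> f x = g x)}"
    using eq unfolding AE_M by (rule AE_lebesgue_negligible)
  have "(\<lambda>x. indicator I x *\<^sub>R g x) \<in> borel_measurable lebesgue"
  proof (rule measurableI)
    fix A :: "complex set" assume "A \<in> sets borel"
    then have "(\<lambda>x. indicator I x *\<^sub>R f x) -` A \<in> sets lebesgue"
      using measurable_sets[OF f', of A] by simp
    moreover have "negligible (((\<lambda>x. indicator I x *\<^sub>R f x) -` A - (\<lambda>x. indicator I x *\<^sub>R g x) -` A) \<union>
        ((\<lambda>x. indicator I x *\<^sub>R g x) -` A - (\<lambda>x. indicator I x *\<^sub>R f x) -` A))"
      by (rule negligible_subset[OF N]) (auto simp: indicator_def split: if_splits)
    ultimately show "(\<lambda>x. indicator I x *\<^sub>R g x) -` A \<inter> space lebesgue \<in> sets lebesgue"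
      using sets_negligible_symdiff by simp
  qed simp
  then show ?thesis
    unfolding measurable_cong_sets[OF sets_M refl]
    by (subst borel_measurable_restrict_space_iff) auto
qed

lemma L2_M_AE_cong:
  assumes "f \<in> L2 M" "AE x in M. f x = g x"
  shows "g \<in> L2 M"
  using L2_AE_cong[OF assms(1) measurable_M_AE_cong[OF _ assms(2)] assms(2)] assms(1) by (auto simp: L2_def)

lemma integrable_M_iff:
  fixes k :: "real \<Rightarrow> 'a::euclidean_space"
  assumes "k \<in> borel_measurable M"
  shows "integrable M k \<longleftrightarrow> set_integrable lebesgue I (\<lambda>x. r x *\<^sub>R k x)"
    "integral\<^sup>L M k = (LINT x:I|lebesgue. r x *\<^sub>R k x)"
proof -
  have k: "k \<in> borel_measurable (restrict_space lebesgue I)"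
    using assms measurable_cong_sets[OF sets_M refl] by blast
  have r: "AE x in restrict_space lebesgue I. 0 \<le> r x"
    using r_pos by (subst AE_restrict_space_iff) (auto elim!: eventually_mono)
  have "integrable M k \<longleftrightarrow> integrable (restrict_space lebesgue I) (\<lambda>x. r x *\<^sub>R k x)"
    unfolding sl_measure_def by (rule integrable_density[OF k r_measurable r])
  also have "\<dots> \<longleftrightarrow> set_integrable lebesgue I (\<lambda>x. r x *\<^sub>R k x)"
    by (simp add: set_integrable_def integrable_restrict_space)
  finally show "integrable M k \<longleftrightarrow> set_integrable lebesgue I (\<lambda>x. r x *\<^sub>R k x)" .
  have "integral\<^sup>L M k = integral\<^sup>L (restrict_space lebesgue I) (\<lambda>x. r x *\<^sub>R k x)"
    unfolding sl_measure_def by (rule integral_density[OF k r_measurable r])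
  also have "\<dots> = (LINT x:I|lebesgue. r x *\<^sub>R k x)"
    by (simp add: set_lebesgue_integral_def integral_restrict_space)
  finally show "integral\<^sup>L M k = (LINT x:I|lebesgue. r x *\<^sub>R k x)" .
qed

lemma Icc_sets_M: "{c..d} \<subseteq> I \<Longrightarrow> {c..d} \<in> sets M"
  by (auto simp: sets_M sets_restrict_space_iff)

lemma set_integral_M:
  fixes k :: "real \<Rightarrow> 'a::euclidean_space"
  assumes k: "set_integrable M {c..d} k" and cd: "{c..d} \<subseteq> I"
  shows "(\<lambda>x. r x *\<^sub>R k x) absolutely_integrable_on {c..d}"
    "integral {c..d} (\<lambda>x. r x *\<^sub>R k x) = (LINT x:{c..d}|M. k x)"
proof -
  have m: "(\<lambda>x. indicator {c..d} x *\<^sub>R k x) \<in> borel_measurable M"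
    using k by (auto simp: set_integrable_def)
  have eq: "indicator I x *\<^sub>R r x *\<^sub>R indicator {c..d} x *\<^sub>R k x = indicator {c..d} x *\<^sub>R r x *\<^sub>R k x" for x
    using cd by (auto simp: indicator_def)
  show ai: "(\<lambda>x. r x *\<^sub>R k x) absolutely_integrable_on {c..d}"
    using integrable_M_iff(1)[OF m] k
    unfolding set_integrable_def eq by simp
  show "integral {c..d} (\<lambda>x. r x *\<^sub>R k x) = (LINT x:{c..d}|M. k x)"
    using integrable_M_iff(2)[OF m] set_lebesgue_integral_eq_integral(2)[OF ai]
    unfolding set_lebesgue_integral_def eq by simp
qed

lemma set_integrable_M_continuous:
  fixes k :: "real \<Rightarrow> 'a::euclidean_space"
  assumes k: "continuous_on I k" and cd: "{c..d} \<subseteq> I"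
  shows "set_integrable M {c..d} k"
proof -
  obtain B where B: "\<forall>x\<in>{c..d}. norm (k x) \<le> B"
    using compact_imp_bounded[OF compact_continuous_image[OF continuous_on_subset[OF k cd]]]
    by (auto simp: bounded_iff)
  have [measurable]: "k \<in> borel_measurable M" by (rule continuous_measurable_M[OF k])
  have [measurable]: "{c..d} \<in> sets M" by (rule Icc_sets_M[OF cd])
  have ind: "(indicator {c..d} :: real \<Rightarrow> real) \<in> borel_measurable M" by measurable
  have eq: "indicator I x *\<^sub>R r x *\<^sub>R indicator {c..d} x = indicator {c..d} x *\<^sub>R r x" for x
    using cd by (auto simp: indicator_def)
  have "integrable M (indicator {c..d} :: real \<Rightarrow> real)"
    using integrable_M_iff(1)[OF ind] coeff_absolutely_integrable(1)[OF cd]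
    unfolding set_integrable_def real_scaleR_def eq[unfolded real_scaleR_def] by simp
  then have "integrable M (\<lambda>x. indicator {c..d} x * B)" by simp
  then show ?thesis unfolding set_integrable_def
  proof (rule Bochner_Integration.integrable_bound)
    show "AE x in M. norm (indicator {c..d} x *\<^sub>R k x) \<le> norm (indicator {c..d} x * B)"
      using B by (auto simp: indicator_def intro!: AE_I2 order_trans[OF _ abs_ge_self])
  qed measurable
qed

text \<open>The integral form of $f^{[1]} = f_1$ and $\tau f = h$ almost everywhere, for $f, f_1$ locally
absolutely continuous.  It is closed under linear operations, conjugation, limits and cutting off,
and avoids the choice made in \<open>quasi_deriv\<close>; see \<open>sl_pair_quasi_deriv\<close>,
\<open>sl_pair_tau\<close> and \<open>sl_regular_pair\<close> for the equivalence.\<close>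

definition sl_pair :: "(real \<Rightarrow> complex) \<Rightarrow> (real \<Rightarrow> complex) \<Rightarrow> (real \<Rightarrow> complex) \<Rightarrow> bool" where
  "sl_pair f f1 h \<longleftrightarrow> primitive_on I f (\<lambda>x. f1 x / cp x) \<and>
     primitive_on I f1 (\<lambda>x. cq x * f x - cr x * h x)"

lemma sl_pair_continuous:
  assumes "sl_pair f f1 h"
  shows "continuous_on I f" "continuous_on I f1"
  using assms primitive_on_continuous_on[OF open_I] by (auto simp: sl_pair_def)

lemma sl_pair_is_quasi_deriv:
  assumes "sl_pair f f1 h"
  shows "is_quasi_deriv S f f1"
  unfolding is_quasi_deriv_def
proof
  show "f1 \<in> AC_loc I" using assms primitive_on_imp_AC_loc by (auto simp: sl_pair_def)
  have "AE x in lebesgue. x \<in> I \<longrightarrow> (f has_vector_derivative f1 x / cp x) (at x)"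
    using primitive_on_has_vector_derivative[OF open_I] assms by (auto simp: sl_pair_def)
  then show "AE x in lebesgue. x \<in> I \<longrightarrow> f1 x = complex_of_real (p x) * vector_derivative f (at x)"
    using p_pos by eventually_elim (auto simp: vector_derivative_at)
qed

lemma is_quasi_deriv_unique:
  assumes "is_quasi_deriv S f f1" "is_quasi_deriv S g g1" "\<And>x. x \<in> I \<Longrightarrow> f x = g x" "x \<in> I"
  shows "f1 x = g1 x"
proof (rule AE_eq_continuous_imp_eq[OF open_I _ _ _ assms(4)])
  show "continuous_on I f1" "continuous_on I g1"
    using assms AC_loc_continuous_on[OF open_I] by (auto simp: is_quasi_deriv_def)
  have vd: "vector_derivative f (at x) = vector_derivative g (at x)" if "x \<in> I" for x
    using assms(3) that open_I
    by (intro vector_derivative_cong_eq) (auto simp: eventually_nhds intro!: exI[of _ I])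
  show "AE x in lebesgue. x \<in> I \<longrightarrow> f1 x = g1 x"
    using conjunct2[OF assms(1)[unfolded is_quasi_deriv_def]] conjunct2[OF assms(2)[unfolded is_quasi_deriv_def]]
    by eventually_elim (simp add: vd)
qed

lemma is_quasi_deriv_quasi_deriv:
  assumes "f \<in> sl_regular S"
  shows "is_quasi_deriv S f (quasi_deriv S f)"
  using assms someI_ex[of "is_quasi_deriv S f"] unfolding sl_regular_def quasi_deriv_def by blast

lemma sl_pair_regular:
  assumes "sl_pair f f1 h"
  shows "f \<in> sl_regular S"
  using sl_pair_is_quasi_deriv[OF assms] assms primitive_on_imp_AC_loc
  by (auto simp: sl_regular_def sl_pair_def)

lemma sl_pair_quasi_deriv:
  assumes "sl_pair f f1 h" "x \<in> I"
  shows "quasi_deriv S f x = f1 x"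
  using is_quasi_deriv_unique[OF is_quasi_deriv_quasi_deriv[OF sl_pair_regular[OF assms(1)]]
      sl_pair_is_quasi_deriv[OF assms(1)] _ assms(2)] by simp

lemma sl_pair_tau:
  assumes "sl_pair f f1 h"
  shows "AE x in M. tau S f x = h x"
  unfolding AE_M
proof -
  have "primitive_on I (quasi_deriv S f) (\<lambda>x. cq x * f x - cr x * h x)"
    by (rule primitive_on_cong[of _ f1]) (use assms in \<open>auto simp: sl_pair_def sl_pair_quasi_deriv\<close>)
  from primitive_on_has_vector_derivative[OF open_I this] r_pos
  show "AE x in lebesgue. x \<in> I \<longrightarrow> tau S f x = h x"
    by eventually_elim (auto simp: tau_def vector_derivative_at)
qed

lemma sl_regular_pair:
  assumes "f \<in> sl_regular S"
  shows "sl_pair f (quasi_deriv S f) (tau S f)"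
  unfolding sl_pair_def
proof
  have qd: "is_quasi_deriv S f (quasi_deriv S f)" by (rule is_quasi_deriv_quasi_deriv[OF assms])
  have "primitive_on I f (\<lambda>x. vector_derivative f (at x))"
    using assms by (intro AC_loc_imp_primitive_on) (auto simp: sl_regular_def)
  then show "primitive_on I f (\<lambda>x. quasi_deriv S f x / cp x)"
  proof (rule primitive_on_cong)
    have "AE x in lebesgue. x \<in> I \<longrightarrow> quasi_deriv S f x = complex_of_real (p x) * vector_derivative f (at x)"
      using qd by (simp add: is_quasi_deriv_def)
    then show "AE x in lebesgue. x \<in> I \<longrightarrow> vector_derivative f (at x) = quasi_deriv S f x / cp x"
      using p_pos by eventually_elim auto
  qed simp
  have "primitive_on I (quasi_deriv S f) (\<lambda>x. vector_derivative (quasi_deriv S f) (at x))"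
    using qd by (intro AC_loc_imp_primitive_on) (auto simp: is_quasi_deriv_def)
  then show "primitive_on I (quasi_deriv S f) (\<lambda>x. cq x * f x - cr x * tau S f x)"
    by (rule primitive_on_cong) (use r_pos in \<open>auto elim!: eventually_mono simp: tau_def\<close>)
qed

lemma sl_pair_cong:
  assumes "sl_pair f f1 h" "\<And>x. x \<in> I \<Longrightarrow> f x = g x" "\<And>x. x \<in> I \<Longrightarrow> f1 x = g1 x"
    "AE x in M. h x = k x"
  shows "sl_pair g g1 k"
  unfolding sl_pair_def
proof
  show "primitive_on I g (\<lambda>x. g1 x / cp x)"
    by (rule primitive_on_cong[of _ f "\<lambda>x. f1 x / cp x"]) (use assms in \<open>auto simp: sl_pair_def\<close>)
  show "primitive_on I g1 (\<lambda>x. cq x * g x - cr x * k x)"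
    by (rule primitive_on_cong[of _ f1 "\<lambda>x. cq x * f x - cr x * h x"])
       (use assms in \<open>auto simp: sl_pair_def AE_M elim!: eventually_mono\<close>)
qed

lemma sl_pair_add:
  assumes "sl_pair f f1 h" "sl_pair g g1 k"
  shows "sl_pair (\<lambda>x. f x + g x) (\<lambda>x. f1 x + g1 x) (\<lambda>x. h x + k x)"
  using assms primitive_on_add[of I f "\<lambda>x. f1 x / cp x" g "\<lambda>x. g1 x / cp x"]
    primitive_on_add[of I f1 "\<lambda>x. cq x * f x - cr x * h x" g1 "\<lambda>x. cq x * g x - cr x * k x"]
  by (simp add: sl_pair_def add_divide_distrib algebra_simps)

lemma sl_pair_cmult:
  assumes "sl_pair f f1 h"
  shows "sl_pair (\<lambda>x. c * f x) (\<lambda>x. c * f1 x) (\<lambda>x. c * h x)"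
  using assms primitive_on_cmult[of I f "\<lambda>x. f1 x / cp x" c]
    primitive_on_cmult[of I f1 "\<lambda>x. cq x * f x - cr x * h x" c]
  by (simp add: sl_pair_def algebra_simps)

lemma sl_pair_cnj:
  assumes "sl_pair f f1 h"
  shows "sl_pair (\<lambda>x. cnj (f x)) (\<lambda>x. cnj (f1 x)) (\<lambda>x. cnj (h x))"
  using assms primitive_on_cnj[of I f "\<lambda>x. f1 x / cp x"]
    primitive_on_cnj[of I f1 "\<lambda>x. cq x * f x - cr x * h x"]
  by (simp add: sl_pair_def)

text \<open>Cutting off at a point where $f$ and $f^{[1]}$ vanish preserves regularity.\<close>

lemma sl_pair_cut_off_left:
  assumes "sl_pair f f1 h" "d \<in> I" "f d = 0" "f1 d = 0"
  shows "sl_pair (\<lambda>x. if x \<le> d then 0 else f x) (\<lambda>x. if x \<le> d then 0 else f1 x)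
    (\<lambda>x. if x \<le> d then 0 else h x)"
  unfolding sl_pair_def
proof
  show "primitive_on I (\<lambda>x. if x \<le> d then 0 else f x) (\<lambda>x. (if x \<le> d then 0 else f1 x) / cp x)"
    by (rule primitive_on_cong[OF primitive_on_cut_off[of I f "\<lambda>x. f1 x / cp x" d]])
       (use assms in \<open>auto simp: sl_pair_def\<close>)
  show "primitive_on I (\<lambda>x. if x \<le> d then 0 else f1 x)
      (\<lambda>x. cq x * (if x \<le> d then 0 else f x) - cr x * (if x \<le> d then 0 else h x))"
    by (rule primitive_on_cong[OF primitive_on_cut_off[of I f1 "\<lambda>x. cq x * f x - cr x * h x" d]])
       (use assms in \<open>auto simp: sl_pair_def\<close>)
qed

lemma sl_pair_dom_max:
  assumes "sl_pair f f1 h" "f \<in> L2 M" "h \<in> L2 M"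
  shows "f \<in> dom_max S"
proof -
  have "AE x in M. h x = tau S f x" using sl_pair_tau[OF assms(1)] by eventually_elim simp
  then have "tau S f \<in> L2 M" by (rule L2_M_AE_cong[OF assms(3)])
  then show ?thesis using assms sl_pair_regular[OF assms(1)] by (simp add: dom_max_def)
qed

lemma dom_max_D:
  assumes "f \<in> dom_max S"
  shows "sl_pair f (quasi_deriv S f) (tau S f)" "f \<in> L2 M" "tau S f \<in> L2 M" "continuous_on I f"
  using assms sl_regular_pair sl_pair_continuous by (auto simp: dom_max_def)

lemma dom_max_add:
  assumes f: "f \<in> dom_max S" and g: "g \<in> dom_max S"
  shows "(\<lambda>x. f x + g x) \<in> dom_max S"
    "x \<in> I \<Longrightarrow> quasi_deriv S (\<lambda>x. f x + g x) x = quasi_deriv S f x + quasi_deriv S g x"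
    "AE x in M. tau S (\<lambda>x. f x + g x) x = tau S f x + tau S g x"
proof -
  note * = sl_pair_add[OF dom_max_D(1)[OF f] dom_max_D(1)[OF g]]
  show "(\<lambda>x. f x + g x) \<in> dom_max S"
    "x \<in> I \<Longrightarrow> quasi_deriv S (\<lambda>x. f x + g x) x = quasi_deriv S f x + quasi_deriv S g x"
    "AE x in M. tau S (\<lambda>x. f x + g x) x = tau S f x + tau S g x"
    using sl_pair_dom_max[OF * L2_add(1) L2_add(1)] dom_max_D[OF f] dom_max_D[OF g]
      sl_pair_quasi_deriv[OF *] sl_pair_tau[OF *] by auto
qed

lemma dom_max_cmult:
  assumes f: "f \<in> dom_max S"
  shows "(\<lambda>x. c * f x) \<in> dom_max S"
    "x \<in> I \<Longrightarrow> quasi_deriv S (\<lambda>x. c * f x) x = c * quasi_deriv S f x"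
    "AE x in M. tau S (\<lambda>x. c * f x) x = c * tau S f x"
proof -
  note * = sl_pair_cmult[OF dom_max_D(1)[OF f], of c]
  show "(\<lambda>x. c * f x) \<in> dom_max S"
    "x \<in> I \<Longrightarrow> quasi_deriv S (\<lambda>x. c * f x) x = c * quasi_deriv S f x"
    "AE x in M. tau S (\<lambda>x. c * f x) x = c * tau S f x"
    using sl_pair_dom_max[OF * L2_cmult(1) L2_cmult(1)] dom_max_D[OF f]
      sl_pair_quasi_deriv[OF *] sl_pair_tau[OF *] by auto
qed

lemma dom_max_diff:
  assumes f: "f \<in> dom_max S" and g: "g \<in> dom_max S"
  shows "(\<lambda>x. f x - g x) \<in> dom_max S"
    "x \<in> I \<Longrightarrow> quasi_deriv S (\<lambda>x. f x - g x) x = quasi_deriv S f x - quasi_deriv S g x"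
    "AE x in M. tau S (\<lambda>x. f x - g x) x = tau S f x - tau S g x"
proof -
  have *: "sl_pair (\<lambda>x. f x - g x) (\<lambda>x. quasi_deriv S f x - quasi_deriv S g x) (\<lambda>x. tau S f x - tau S g x)"
    using sl_pair_add[OF dom_max_D(1)[OF f] sl_pair_cmult[OF dom_max_D(1)[OF g], of "-1"]] by simp
  then show "(\<lambda>x. f x - g x) \<in> dom_max S"
    "x \<in> I \<Longrightarrow> quasi_deriv S (\<lambda>x. f x - g x) x = quasi_deriv S f x - quasi_deriv S g x"
    "AE x in M. tau S (\<lambda>x. f x - g x) x = tau S f x - tau S g x"
    using sl_pair_dom_max[OF * L2_diff(1) L2_diff(1)] dom_max_D[OF f] dom_max_D[OF g]
      sl_pair_quasi_deriv[OF *] sl_pair_tau[OF *] by auto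
qed

lemma dom_max_cnj:
  assumes f: "f \<in> dom_max S"
  shows "(\<lambda>x. cnj (f x)) \<in> dom_max S"
    "x \<in> I \<Longrightarrow> quasi_deriv S (\<lambda>x. cnj (f x)) x = cnj (quasi_deriv S f x)"
    "AE x in M. tau S (\<lambda>x. cnj (f x)) x = cnj (tau S f x)"
proof -
  note * = sl_pair_cnj[OF dom_max_D(1)[OF f]]
  show "(\<lambda>x. cnj (f x)) \<in> dom_max S"
    "x \<in> I \<Longrightarrow> quasi_deriv S (\<lambda>x. cnj (f x)) x = cnj (quasi_deriv S f x)"
    "AE x in M. tau S (\<lambda>x. cnj (f x)) x = cnj (tau S f x)"
    using sl_pair_dom_max[OF * L2_cnj L2_cnj] dom_max_D[OF f]
      sl_pair_quasi_deriv[OF *] sl_pair_tau[OF *] by auto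
qed

lemma dom_max_eq:
  assumes f: "f \<in> dom_max S" and g: "g \<in> dom_max S" and eq: "AE x in M. f x = g x" and x: "x \<in> I"
  shows "f x = g x" "quasi_deriv S f x = quasi_deriv S g x"
proof -
  have fg: "f x = g x" if "x \<in> I" for x
    using AE_eq_continuous_imp_eq[OF open_I dom_max_D(4)[OF f] dom_max_D(4)[OF g] _ that] eq
    by (simp add: AE_M)
  then show "f x = g x" "quasi_deriv S f x = quasi_deriv S g x"
    using sl_pair_quasi_deriv[OF sl_pair_cong[OF dom_max_D(1)[OF g], of f "quasi_deriv S g" "tau S g"] x]
      fg[OF x] by auto
qed

text \<open>The Lagrange identity in integral form; the terms with $q$ and $1/p$ cancel.\<close>

lemma wronskian_primitive:
  assumes "sl_pair f f1 h" "sl_pair g g1 k"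
  shows "primitive_on I (\<lambda>x. f x * g1 x - f1 x * g x) (\<lambda>x. r x *\<^sub>R (h x * g x - f x * k x))"
proof -
  have "primitive_on I (\<lambda>x. f x * g1 x - f1 x * g x)
    (\<lambda>x. (f x * (cq x * g x - cr x * k x) + f1 x / cp x * g1 x)
       - (f1 x * (g1 x / cp x) + (cq x * f x - cr x * h x) * g x))"
    using assms by (intro primitive_on_diff primitive_on_mult open_I) (auto simp: sl_pair_def)
  then show ?thesis
    by (rule primitive_on_cong) (auto simp: scaleR_conv_of_real algebra_simps)
qed

end

section \<open>The Lagrange identity and generalized boundary values\<close>

context sl_problem
begin

text \<open>The two endpoints of $(a,b)$, which may be infinite.\<close>

definition is_end :: "ereal \<Rightarrow> bool" where
  "is_end e \<longleftrightarrow> e = lend S \<or> e = rend S"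

lemma end_sequence:
  assumes "is_end e"
  obtains X where "\<And>n. X n \<in> I" "(\<lambda>n. ereal (X n)) \<longlonglongrightarrow> e"
proof -
  have "lend S < rend S" using sl by (simp add: sturm_liouville_def)
  then obtain u l :: "nat \<Rightarrow> real" where ul: "\<And>i. l i < u i" "\<And>i. lend S < ereal (l i)" "\<And>i. ereal (u i) < rend S"
     "(\<lambda>i. ereal (l i)) \<longlonglongrightarrow> lend S" "(\<lambda>i. ereal (u i)) \<longlonglongrightarrow> rend S"
    by (rule einterval_Icc_approximation) blast
  have "ereal (l i) < ereal (u i)" for i using ul(1) by simp
  then have "l i \<in> I" "u i \<in> I" for i
    using ul(2,3)[of i] less_trans unfolding sl_int_def einterval_iff by blast+
  then show thesis using that[of l] that[of u] ul assms by (auto simp: is_end_def)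
qed

lemma at_end_nontrivial:
  assumes "is_end e"
  shows "at e within {lend S<..<rend S} \<noteq> bot"
proof -
  obtain X where X: "\<And>n. X n \<in> I" "(\<lambda>n. ereal (X n)) \<longlonglongrightarrow> e" by (rule end_sequence[OF assms]) (rule that)
  have "\<forall>n. ereal (X n) \<in> {lend S<..<rend S} - {e}"
  proof
    fix n
    have "lend S < ereal (X n)" "ereal (X n) < rend S" using X(1)[of n] by (simp_all add: sl_int_def einterval_iff)
    then show "ereal (X n) \<in> {lend S<..<rend S} - {e}" using assms by (auto simp: is_end_def)
  qed
  then have "e \<in> closure ({lend S<..<rend S} - {e})"
    using X(2) unfolding closure_sequential by (intro exI[of _ "\<lambda>n. ereal (X n)"]) simp
  then show ?thesis by (simp add: at_within_eq_bot_iff)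
qed

text \<open>Sequences of real points in $(a,b)$ suffice for limits at an endpoint.\<close>

lemma tendsto_at_endI:
  assumes "is_end e"
    and "\<And>X. (\<And>n. X n \<in> I) \<Longrightarrow> (\<lambda>n. ereal (X n)) \<longlonglongrightarrow> e \<Longrightarrow> (\<lambda>n. f (X n)) \<longlonglongrightarrow> L"
  shows "((\<lambda>x. f (real_of_ereal x)) \<longlongrightarrow> L) (at e within {lend S<..<rend S})"
  unfolding tendsto_at_iff_sequentially
proof (intro allI impI)
  fix Y assume Y: "\<forall>n. Y n \<in> {lend S<..<rend S} - {e}" "Y \<longlonglongrightarrow> e"
  have eq: "ereal (real_of_ereal (Y n)) = Y n" for n
    using Y(1)[rule_format, of n] by (cases "Y n") auto
  have "(\<lambda>n. f (real_of_ereal (Y n))) \<longlonglongrightarrow> L"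
  proof (rule assms(2))
    show "real_of_ereal (Y n) \<in> I" for n
      using Y(1)[rule_format, of n] by (simp add: sl_int_def einterval_iff eq)
    show "(\<lambda>n. ereal (real_of_ereal (Y n))) \<longlonglongrightarrow> e" using Y(2) by (simp add: eq)
  qed
  then show "((\<lambda>x. f (real_of_ereal x)) \<circ> Y) \<longlonglongrightarrow> L" by (simp add: o_def)
qed

text \<open>The integrand $(\tau f) g - f (\tau g)$ of the Lagrange identity; it is not conjugated.\<close>

definition lagr :: "(real \<Rightarrow> complex) \<Rightarrow> (real \<Rightarrow> complex) \<Rightarrow> real \<Rightarrow> complex" where
  "lagr f g x = tau S f x * g x - f x * tau S g x"

lemma lagr_integrable:
  assumes "f \<in> dom_max S" "g \<in> dom_max S"
  shows "integrable M (lagr f g)"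
  unfolding lagr_def[abs_def]
  using dom_max_D(2,3)[OF assms(1)] dom_max_D(2,3)[OF assms(2)]
  by (intro Bochner_Integration.integrable_diff L2_mult_integrable(1))

text \<open>The Lagrange identity on a compact interval.\<close>

lemma wronskian_diff:
  assumes f: "f \<in> dom_max S" and g: "g \<in> dom_max S" and cd: "c \<in> I" "d \<in> I" "c \<le> d"
  shows "wronskian S f g d - wronskian S f g c = (LINT x:{c..d}|M. lagr f g x)"
proof -
  have sub: "{c..d} \<subseteq> I" by (rule Icc_subset_I[OF cd(1,2)])
  have "set_integrable M {c..d} (lagr f g)"
    using integrable_mult_indicator[OF Icc_sets_M[OF sub] lagr_integrable[OF f g]]
    by (simp add: set_integrable_def)
  from set_integral_M(2)[OF this sub]
    primitive_onD(3)[OF wronskian_primitive[OF dom_max_D(1)[OF f] dom_max_D(1)[OF g]] cd(3) sub]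
  show ?thesis by (simp add: wronskian_def lagr_def)
qed

lemma point_null_M: "AE y in M. y \<noteq> c"
  unfolding AE_M
  by (rule AE_I'[where N = "{c}"]) (auto simp: negligible_iff_null_sets[symmetric])

text \<open>The integral of \<open>lagr f g\<close> with respect to $r\,dx$ over the part of $(a,b)$ up to $x$.  It
differs from $W(f,g)$ by a constant and has limits at both ends.\<close>

definition cumul :: "(real \<Rightarrow> complex) \<Rightarrow> (real \<Rightarrow> complex) \<Rightarrow> real \<Rightarrow> complex" where
  "cumul f g x = (LINT y|M. indicator {..x} y *\<^sub>R lagr f g y)"

lemma atMost_measurable_M: "(indicator {..x} :: real \<Rightarrow> real) \<in> borel_measurable M"
proof -
  have "{..x} \<inter> I \<in> sets M" by (auto simp: sets_M sets_restrict_space_iff)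
  then show ?thesis by (simp add: borel_measurable_indicator_iff space_M)
qed

lemma integral_atMost_diff:
  fixes k :: "real \<Rightarrow> complex"
  assumes k: "integrable M k" and cd: "c \<in> I" "d \<in> I" "c \<le> d"
  shows "(LINT y|M. indicator {..d} y *\<^sub>R k y) - (LINT y|M. indicator {..c} y *\<^sub>R k y) = (LINT x:{c..d}|M. k x)"
proof -
  have i: "integrable M (\<lambda>y. indicator {..x} y *\<^sub>R k y)" for x
    by (rule Bochner_Integration.integrable_bound[OF k])
       (use borel_measurable_scaleR[OF atMost_measurable_M borel_measurable_integrable[OF k]]
         in \<open>auto simp: indicator_def\<close>)
  have "(LINT y|M. indicator {..d} y *\<^sub>R k y) - (LINT y|M. indicator {..c} y *\<^sub>R k y) =
      (LINT y|M. indicator {..d} y *\<^sub>R k y - indicator {..c} y *\<^sub>R k y)"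
    by (rule Bochner_Integration.integral_diff[symmetric]) (rule i)+
  also have "\<dots> = (LINT x:{c..d}|M. k x)"
    unfolding set_lebesgue_integral_def
  proof (rule integral_cong_AE)
    show "(\<lambda>y. indicator {..d} y *\<^sub>R k y - indicator {..c} y *\<^sub>R k y) \<in> borel_measurable M"
      using i by (intro borel_measurable_diff) auto
    show "(\<lambda>y. indicator {c..d} y *\<^sub>R k y) \<in> borel_measurable M"
      using k Icc_sets_M[OF Icc_subset_I[OF cd(1,2)]]
      by (intro borel_measurable_scaleR borel_measurable_indicator) auto
    show "AE y in M. indicator {..d} y *\<^sub>R k y - indicator {..c} y *\<^sub>R k y = indicator {c..d} y *\<^sub>R k y"
      using point_null_M[of c] by eventually_elim (use cd in \<open>auto simp: indicator_def\<close>)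
  qed
  finally show ?thesis .
qed

lemma wronskian_cumul:
  assumes f: "f \<in> dom_max S" and g: "g \<in> dom_max S" and cd: "c \<in> I" "d \<in> I"
  shows "wronskian S f g d - wronskian S f g c = cumul f g d - cumul f g c"
proof -
  have *: "wronskian S f g d - wronskian S f g c = cumul f g d - cumul f g c"
    if cd: "c \<in> I" "d \<in> I" "c \<le> d" for c d
    using integral_atMost_diff[OF lagr_integrable[OF f g] cd] wronskian_diff[OF f g cd] by (simp add: cumul_def)
  show ?thesis
  proof (cases "c \<le> d")
    case True then show ?thesis using * cd by blast
  next
    case False
    then have "wronskian S f g c - wronskian S f g d = cumul f g c - cumul f g d" using *[of d c] cd by simp
    then show ?thesis by (metis minus_diff_eq)
  qed
qed

lemma cumul_tendsto:
  assumes f: "f \<in> dom_max S" and g: "g \<in> dom_max S"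
    and X: "\<And>n. X n \<in> I"
  shows "(\<lambda>n. ereal (X n)) \<longlonglongrightarrow> rend S \<Longrightarrow> (\<lambda>n. cumul f g (X n)) \<longlonglongrightarrow> (LINT y|M. lagr f g y)"
    and "(\<lambda>n. ereal (X n)) \<longlonglongrightarrow> lend S \<Longrightarrow> (\<lambda>n. cumul f g (X n)) \<longlonglongrightarrow> 0"
proof -
  have mf: "lagr f g \<in> borel_measurable M" using lagr_integrable[OF f g] by auto
  have mi: "(\<lambda>y. indicator {..X n} y *\<^sub>R lagr f g y) \<in> borel_measurable M" for n
    by (rule borel_measurable_scaleR[OF atMost_measurable_M mf])
  have bd: "AE y in M. norm (indicator {..X n} y *\<^sub>R lagr f g y) \<le> norm (lagr f g y)" for n
    by (auto simp: indicator_def)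
  {
    assume R: "(\<lambda>n. ereal (X n)) \<longlonglongrightarrow> rend S"
    have "AE y in M. (\<lambda>n. indicator {..X n} y *\<^sub>R lagr f g y) \<longlonglongrightarrow> lagr f g y"
    proof (rule AE_I2)
      fix y assume "y \<in> space M"
      then have "ereal y < rend S" by (simp add: space_M sl_int_def einterval_iff)
      then have "\<forall>\<^sub>F n in sequentially. ereal y < ereal (X n)" using R order_tendstoD(1) by blast
      then show "(\<lambda>n. indicator {..X n} y *\<^sub>R lagr f g y) \<longlonglongrightarrow> lagr f g y"
        by (intro tendsto_eventually) (auto elim!: eventually_mono)
    qed
    then show "(\<lambda>n. cumul f g (X n)) \<longlonglongrightarrow> (LINT y|M. lagr f g y)"
      unfolding cumul_def
      by (intro integral_dominated_convergence[OF mf mi integrable_norm[OF lagr_integrable[OF f g]] _ bd])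
  next
    assume R: "(\<lambda>n. ereal (X n)) \<longlonglongrightarrow> lend S"
    have "AE y in M. (\<lambda>n. indicator {..X n} y *\<^sub>R lagr f g y) \<longlonglongrightarrow> 0"
    proof (rule AE_I2)
      fix y assume "y \<in> space M"
      then have "lend S < ereal y" by (simp add: space_M sl_int_def einterval_iff)
      then have "\<forall>\<^sub>F n in sequentially. ereal (X n) < ereal y" using R order_tendstoD(2) by blast
      then show "(\<lambda>n. indicator {..X n} y *\<^sub>R lagr f g y) \<longlonglongrightarrow> 0"
        by (intro tendsto_eventually) (auto elim!: eventually_mono)
    qed
    then have "(\<lambda>n. cumul f g (X n)) \<longlonglongrightarrow> (LINT y|M. 0)"
      unfolding cumul_def
      by (intro integral_dominated_convergence[OF _ mi integrable_norm[OF lagr_integrable[OF f g]] _ bd]) auto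
    then show "(\<lambda>n. cumul f g (X n)) \<longlonglongrightarrow> 0" by simp
  }
qed

lemma wronskian_end_eq:
  assumes f: "f \<in> dom_max S" and g: "g \<in> dom_max S" and c: "c \<in> I"
  shows "wronskian_end S f g (rend S) = wronskian S f g c - cumul f g c + (LINT y|M. lagr f g y)"
    and "wronskian_end S f g (lend S) = wronskian S f g c - cumul f g c"
    and "is_end e \<Longrightarrow> (\<And>n. X n \<in> I) \<Longrightarrow> (\<lambda>n. ereal (X n)) \<longlonglongrightarrow> e \<Longrightarrow>
      (\<lambda>n. wronskian S f g (X n)) \<longlonglongrightarrow> wronskian_end S f g e"
proof -
  have W: "wronskian S f g x = wronskian S f g c - cumul f g c + cumul f g x" if "x \<in> I" for x
    using wronskian_cumul[OF f g c that] by (simp add: algebra_simps)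
  have R: "(\<lambda>n. wronskian S f g (X n)) \<longlonglongrightarrow> wronskian S f g c - cumul f g c + (LINT y|M. lagr f g y)"
    if "\<And>n. X n \<in> I" "(\<lambda>n. ereal (X n)) \<longlonglongrightarrow> rend S" for X
    unfolding W[OF that(1)] by (intro tendsto_intros cumul_tendsto[OF f g] that)
  have L: "(\<lambda>n. wronskian S f g (X n)) \<longlonglongrightarrow> wronskian S f g c - cumul f g c + 0"
    if "\<And>n. X n \<in> I" "(\<lambda>n. ereal (X n)) \<longlonglongrightarrow> lend S" for X
    unfolding W[OF that(1)] by (intro tendsto_intros cumul_tendsto[OF f g] that)
  have ends: "is_end (rend S)" "is_end (lend S)" by (simp_all add: is_end_def)
  show 1: "wronskian_end S f g (rend S) = wronskian S f g c - cumul f g c + (LINT y|M. lagr f g y)"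
    unfolding wronskian_end_def
    by (intro tendsto_Lim at_end_nontrivial ends tendsto_at_endI R)
  have "wronskian_end S f g (lend S) = wronskian S f g c - cumul f g c + 0"
    unfolding wronskian_end_def
    by (intro tendsto_Lim at_end_nontrivial ends tendsto_at_endI L)
  then show 2: "wronskian_end S f g (lend S) = wronskian S f g c - cumul f g c" by simp
  show "(\<lambda>n. wronskian S f g (X n)) \<longlonglongrightarrow> wronskian_end S f g e"
    if "is_end e" "\<And>n. X n \<in> I" "(\<lambda>n. ereal (X n)) \<longlonglongrightarrow> e"
    using that R[of X] L[of X] unfolding is_end_def by (auto simp: 1 2)
qed

lemma wronskian_end_tendsto:
  assumes "f \<in> dom_max S" "g \<in> dom_max S" "is_end e" "\<And>n. X n \<in> I" "(\<lambda>n. ereal (X n)) \<longlonglongrightarrow> e"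
  shows "(\<lambda>n. wronskian S f g (X n)) \<longlonglongrightarrow> wronskian_end S f g e"
  using wronskian_end_eq(3)[OF assms(1,2) assms(4)[of 0] assms(3-5)] .

text \<open>Green's formula on $(a,b)$.\<close>

lemma green:
  assumes f: "f \<in> dom_max S" and g: "g \<in> dom_max S"
  shows "(LINT y|M. lagr f g y) = wronskian_end S f g (rend S) - wronskian_end S f g (lend S)"
proof -
  obtain c where "c \<in> I" by (rule I_nonempty)
  then show ?thesis using wronskian_end_eq(1,2)[OF f g, of c] by simp
qed

lemma wronskian_end_eqI:
  assumes e: "is_end e" and f: "f \<in> dom_max S" and g: "g \<in> dom_max S"
    and lim: "\<And>X. (\<And>n. X n \<in> I) \<Longrightarrow> (\<lambda>n. ereal (X n)) \<longlonglongrightarrow> e \<Longrightarrow> (\<lambda>n. wronskian S f g (X n)) \<longlonglongrightarrow> L"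
  shows "wronskian_end S f g e = L"
proof -
  obtain X where X: "\<And>n. X n \<in> I" "(\<lambda>n. ereal (X n)) \<longlonglongrightarrow> e" by (rule end_sequence[OF e]) (rule that)
  show ?thesis using LIMSEQ_unique[OF wronskian_end_tendsto[OF f g e X] lim[OF X]] by simp
qed

lemma wronskian_end_add:
  assumes e: "is_end e" and f: "f \<in> dom_max S" and g: "g \<in> dom_max S" and h: "h \<in> dom_max S"
  shows "wronskian_end S f (\<lambda>x. g x + h x) e = wronskian_end S f g e + wronskian_end S f h e"
proof (rule wronskian_end_eqI[OF e f dom_max_add(1)[OF g h]])
  fix X assume X: "\<And>n. X n \<in> I" "(\<lambda>n. ereal (X n)) \<longlonglongrightarrow> e"
  have "wronskian S f (\<lambda>x. g x + h x) (X n) = wronskian S f g (X n) + wronskian S f h (X n)" for n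
    using dom_max_add(2)[OF g h X(1)] by (simp add: wronskian_def algebra_simps)
  then show "(\<lambda>n. wronskian S f (\<lambda>x. g x + h x) (X n)) \<longlonglongrightarrow> wronskian_end S f g e + wronskian_end S f h e"
    using tendsto_add[OF wronskian_end_tendsto[OF f g e X] wronskian_end_tendsto[OF f h e X]] by simp
qed

lemma wronskian_end_cmult:
  assumes e: "is_end e" and f: "f \<in> dom_max S" and g: "g \<in> dom_max S"
  shows "wronskian_end S f (\<lambda>x. c * g x) e = c * wronskian_end S f g e"
proof (rule wronskian_end_eqI[OF e f dom_max_cmult(1)[OF g]])
  fix X assume X: "\<And>n. X n \<in> I" "(\<lambda>n. ereal (X n)) \<longlonglongrightarrow> e"
  have "wronskian S f (\<lambda>x. c * g x) (X n) = c * wronskian S f g (X n)" for n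
    using dom_max_cmult(2)[OF g X(1)] by (simp add: wronskian_def algebra_simps)
  then show "(\<lambda>n. wronskian S f (\<lambda>x. c * g x) (X n)) \<longlonglongrightarrow> c * wronskian_end S f g e"
    using tendsto_mult[OF tendsto_const wronskian_end_tendsto[OF f g e X]] by simp
qed

lemma wronskian_end_cong:
  assumes e: "is_end e" and f: "f \<in> dom_max S" and g: "g \<in> dom_max S" and h: "h \<in> dom_max S"
    and eq: "AE x in M. g x = h x"
  shows "wronskian_end S f g e = wronskian_end S f h e"
proof (rule wronskian_end_eqI[OF e f g])
  fix X assume X: "\<And>n. X n \<in> I" "(\<lambda>n. ereal (X n)) \<longlonglongrightarrow> e"
  have "wronskian S f g (X n) = wronskian S f h (X n)" for n
    using dom_max_eq[OF g h eq X(1)] by (simp add: wronskian_def)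
  then show "(\<lambda>n. wronskian S f g (X n)) \<longlonglongrightarrow> wronskian_end S f h e"
    using wronskian_end_tendsto[OF f h e X] by simp
qed

lemma wronskian_end_cnj:
  assumes e: "is_end e" and f: "f \<in> dom_max S" and g: "g \<in> dom_max S"
    and real: "\<And>x. x \<in> I \<Longrightarrow> f x \<in> \<real>"
  shows "wronskian_end S f (\<lambda>x. cnj (g x)) e = cnj (wronskian_end S f g e)"
proof (rule wronskian_end_eqI[OF e f dom_max_cnj(1)[OF g]])
  fix X assume X: "\<And>n. X n \<in> I" "(\<lambda>n. ereal (X n)) \<longlonglongrightarrow> e"
  have "AE x in M. f x = cnj (f x)" unfolding AE_M using real by (auto simp: Reals_cnj_iff)
  then have "quasi_deriv S f x = cnj (quasi_deriv S f x)" if "x \<in> I" for x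
    using dom_max_eq(2)[OF f dom_max_cnj(1)[OF f] _ that] dom_max_cnj(2)[OF f that] by simp
  then have "wronskian S f (\<lambda>x. cnj (g x)) (X n) = cnj (wronskian S f g (X n))" for n
    using dom_max_cnj(2)[OF g X(1)] real[OF X(1)] X(1) by (simp add: wronskian_def Reals_cnj_iff)
  then show "(\<lambda>n. wronskian S f (\<lambda>x. cnj (g x)) (X n)) \<longlonglongrightarrow> cnj (wronskian_end S f g e)"
    using tendsto_cnj[OF wronskian_end_tendsto[OF f g e X]] by simp
qed

text \<open>The Pluecker relation among the four vectors of values and quasi-derivatives at a point, in the
limit.\<close>

lemma wronskian_end_pluecker:
  assumes e: "is_end e" and f: "f \<in> dom_max S" and g: "g \<in> dom_max S"
    and v: "v1 \<in> dom_max S" "v2 \<in> dom_max S"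
  shows "wronskian_end S v1 v2 e * wronskian_end S f g e =
    wronskian_end S v1 f e * wronskian_end S v2 g e - wronskian_end S v1 g e * wronskian_end S v2 f e"
proof -
  obtain X where X: "\<And>n. X n \<in> I" "(\<lambda>n. ereal (X n)) \<longlonglongrightarrow> e" by (rule end_sequence[OF e]) (rule that)
  note lim = wronskian_end_tendsto[OF _ _ e X]
  have "wronskian S v1 v2 x * wronskian S f g x =
    wronskian S v1 f x * wronskian S v2 g x - wronskian S v1 g x * wronskian S v2 f x" for x
    by (simp add: wronskian_def algebra_simps)
  then have "(\<lambda>n. wronskian S v1 v2 (X n) * wronskian S f g (X n)) \<longlonglongrightarrow>
    wronskian_end S v1 f e * wronskian_end S v2 g e - wronskian_end S v1 g e * wronskian_end S v2 f e"
    using f g v by (simp add: tendsto_intros lim)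
  moreover have "(\<lambda>n. wronskian S v1 v2 (X n) * wronskian S f g (X n)) \<longlonglongrightarrow>
      wronskian_end S v1 v2 e * wronskian_end S f g e"
    using f g v by (intro tendsto_intros lim)
  ultimately show ?thesis using LIMSEQ_unique by blast
qed

end

text \<open>A Sturm--Liouville expression with the boundary pair that fixes the generalized boundary values;
\<open>bv0 g d\<close> and \<open>bv1 g d\<close> are $\widetilde g(d)$ and $\widetilde g^{\,\prime}(d)$.\<close>

locale sl_boundary = sl_problem +
  fixes v1 v2 :: "real \<Rightarrow> complex"
  assumes bp: "boundary_pair S v1 v2"
begin

lemma v_dom [simp]: "v1 \<in> dom_max S" "v2 \<in> dom_max S"
  using bp by (auto simp: boundary_pair_def)

lemma v_real: "x \<in> I \<Longrightarrow> v1 x \<in> \<real>" "x \<in> I \<Longrightarrow> v2 x \<in> \<real>"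
  using bp by (auto simp: boundary_pair_def)

lemma wronskian_end_v: "is_end e \<Longrightarrow> wronskian_end S v1 v2 e = 1"
  using bp by (auto simp: boundary_pair_def is_end_def)

lemma is_end [simp]: "is_end (lend S)" "is_end (rend S)"
  by (simp_all add: is_end_def)

abbreviation bv0 where "bv0 \<equiv> bv S v1 v2"
abbreviation bv1 where "bv1 \<equiv> bv' S v1 v2"

lemma bv_add:
  assumes "is_end e" "f \<in> dom_max S" "g \<in> dom_max S"
  shows "bv0 (\<lambda>x. f x + g x) e = bv0 f e + bv0 g e" "bv1 (\<lambda>x. f x + g x) e = bv1 f e + bv1 g e"
  using assms by (simp_all add: bv_def bv'_def wronskian_end_add)

lemma bv_cmult:
  assumes "is_end e" "f \<in> dom_max S"
  shows "bv0 (\<lambda>x. c * f x) e = c * bv0 f e" "bv1 (\<lambda>x. c * f x) e = c * bv1 f e"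
  using assms by (simp_all add: bv_def bv'_def wronskian_end_cmult)

lemma bv_diff:
  assumes "is_end e" "f \<in> dom_max S" "g \<in> dom_max S"
  shows "bv0 (\<lambda>x. f x - g x) e = bv0 f e - bv0 g e" "bv1 (\<lambda>x. f x - g x) e = bv1 f e - bv1 g e"
  using bv_add[OF assms(1,2) dom_max_cmult(1)[OF assms(3), of "-1"]] bv_cmult[OF assms(1,3), of "-1"]
  by simp_all

lemma bv_cong:
  assumes "is_end e" "f \<in> dom_max S" "g \<in> dom_max S" "AE x in M. f x = g x"
  shows "bv0 f e = bv0 g e" "bv1 f e = bv1 g e"
  using assms wronskian_end_cong[OF assms(1) _ assms(2-4)] by (simp_all add: bv_def bv'_def)

text \<open>Here the boundary pair has to be real-valued.\<close>

lemma bv_cnj: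
  assumes "is_end e" "f \<in> dom_max S"
  shows "bv0 (\<lambda>x. cnj (f x)) e = cnj (bv0 f e)" "bv1 (\<lambda>x. cnj (f x)) e = cnj (bv1 f e)"
  using assms v_real by (simp_all add: bv_def bv'_def wronskian_end_cnj)

lemma wronskian_end_bv:
  assumes "is_end e" "f \<in> dom_max S" "g \<in> dom_max S"
  shows "wronskian_end S f g e = bv0 f e * bv1 g e - bv1 f e * bv0 g e"
  using wronskian_end_pluecker[OF assms v_dom] wronskian_end_v[OF assms(1)] by (simp add: bv_def bv'_def)

end

section \<open>Interior estimates by the graph norm\<close>

context sl_problem
begin

lemma integral_pos_AE:
  fixes k :: "real \<Rightarrow> real"
  assumes k: "k absolutely_integrable_on {c..d}" and cd: "c < d" "{c..d} \<subseteq> I"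
    and pos: "AE x in lebesgue. x \<in> I \<longrightarrow> 0 < k x"
  shows "0 < integral {c..d} k"
proof -
  have eq: "integral {c..d} k = (LINT x|lebesgue. indicator {c..d} x *\<^sub>R k x)"
    using set_lebesgue_integral_eq_integral(2)[OF k] by (simp add: set_lebesgue_integral_def)
  have nn: "AE x in lebesgue. 0 \<le> indicator {c..d} x *\<^sub>R k x"
    using pos by eventually_elim (use cd in \<open>auto simp: indicator_def\<close>)
  have i: "integrable lebesgue (\<lambda>x. indicator {c..d} x *\<^sub>R k x)"
    using k by (simp add: set_integrable_def)
  have "(LINT x|lebesgue. indicator {c..d} x *\<^sub>R k x) \<noteq> 0"
  proof
    assume "(LINT x|lebesgue. indicator {c..d} x *\<^sub>R k x) = 0"
    then have "AE x in lebesgue. indicator {c..d} x *\<^sub>R k x = 0"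
      using integral_nonneg_eq_0_iff_AE[OF i nn] by simp
    then have "AE x in lebesgue. x \<notin> {c..d}"
      using pos by eventually_elim (use cd in \<open>auto simp: indicator_def split: if_splits\<close>)
    then have "negligible {x. \<not> (x \<notin> {c..d})}" by (rule AE_lebesgue_negligible)
    moreover have "{x. \<not> (x \<notin> {c..d})} = cbox c d" by auto
    ultimately show False using negligible_interval(1)[of c d] cd by simp
  qed
  moreover have "0 \<le> (LINT x|lebesgue. indicator {c..d} x *\<^sub>R k x)" by (rule integral_nonneg_AE[OF nn])
  ultimately show ?thesis unfolding eq by simp
qed

lemma L2_indicator:
  assumes "{c..d} \<subseteq> I"
  shows "(\<lambda>x. indicator {c..d} x) \<in> L2 M"
proof -
  have "(\<lambda>x. indicator {c..d} x * 1 :: complex) \<in> borel_measurable M"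
    using Icc_sets_M[OF assms] by simp
  moreover have "(cmod (indicator {c..d} x))\<^sup>2 = indicator {c..d} x *\<^sub>R (1::real)" for x
    by (auto simp: indicator_def)
  moreover have "integrable M (\<lambda>x. indicator {c..d} x *\<^sub>R (1::real))"
    using set_integrable_M_continuous[of "\<lambda>x. 1::real" c d] assms by (simp add: set_integrable_def)
  ultimately show ?thesis by (simp add: L2_def)
qed

lemma L2_locally_integrable:
  assumes h: "h \<in> L2 M" and cd: "{c..d} \<subseteq> I"
  shows "(\<lambda>x. cr x * h x) absolutely_integrable_on {c..d}"
    "integral {c..d} (\<lambda>x. cmod (cr x * h x)) \<le> L2_norm M (\<lambda>x. indicator {c..d} x) * L2_norm M h"
proof -
  have "integrable M (\<lambda>x. indicator {c..d} x * h x)"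
    by (rule L2_mult_integrable(1)[OF L2_indicator[OF cd] h])
  then have s: "set_integrable M {c..d} h"
    by (simp add: set_integrable_def scaleR_conv_of_real of_real_indicator)
  from set_integral_M(1)[OF this cd] show "(\<lambda>x. cr x * h x) absolutely_integrable_on {c..d}"
    by (simp add: scaleR_conv_of_real)
  have sn: "set_integrable M {c..d} (\<lambda>x. cmod (h x))"
    using set_integrable_norm[OF s] by simp
  have "integral {c..d} (\<lambda>x. cmod (cr x * h x)) = integral {c..d} (\<lambda>x. r x *\<^sub>R cmod (h x))"
  proof (rule integral_spike[OF AE_lebesgue_negligible[OF r_pos]])
    fix x assume "x \<in> {c..d} - {x. \<not> (x \<in> I \<longrightarrow> 0 < r x)}"
    then show "r x *\<^sub>R cmod (h x) = cmod (cr x * h x)" using cd by (auto simp: norm_mult)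
  qed
  also have "\<dots> = (LINT x:{c..d}|M. cmod (h x))"
    by (rule set_integral_M(2)[OF sn cd])
  also have "\<dots> = (LINT x|M. cmod (indicator {c..d} x) * cmod (h x))"
    unfolding set_lebesgue_integral_def by (intro Bochner_Integration.integral_cong) (auto simp: indicator_def)
  also have "\<dots> \<le> L2_norm M (\<lambda>x. indicator {c..d} x) * L2_norm M h"
    by (rule L2_Cauchy_Schwarz[OF L2_indicator[OF cd] h])
  finally show "integral {c..d} (\<lambda>x. cmod (cr x * h x)) \<le> L2_norm M (\<lambda>x. indicator {c..d} x) * L2_norm M h" .
qed

text \<open>The minimum of $\vert f\vert$ on $[s,t]$ is at most its quadratic mean with respect to $r\,dx$.\<close>

lemma L2_point_bound:
  assumes st: "s < t" "{s..t} \<subseteq> I" and f: "continuous_on I f" "f \<in> L2 M"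
  obtains x where "x \<in> {s..t}" "cmod (f x) \<le> L2_norm M f / sqrt (integral {s..t} r)"
proof -
  let ?m = "integral {s..t} r"
  have m: "0 < ?m" by (rule integral_pos_AE[OF coeff_absolutely_integrable(1)[OF st(2)] st r_pos])
  have cont: "continuous_on {s..t} (\<lambda>x. cmod (f x))"
    using f(1) st by (intro continuous_intros) (auto intro: continuous_on_subset)
  obtain x where x: "x \<in> {s..t}" "\<And>y. y \<in> {s..t} \<Longrightarrow> cmod (f x) \<le> cmod (f y)"
    using continuous_attains_inf[OF _ _ cont] st by auto
  have int: "integrable M (\<lambda>y. (cmod (f y))\<^sup>2)" using f by (simp add: L2_def)
  have s: "set_integrable M {s..t} (\<lambda>y. (cmod (f y))\<^sup>2)"
    unfolding set_integrable_def by (rule integrable_mult_indicator[OF Icc_sets_M[OF st(2)] int])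
  have s1: "set_integrable M {s..t} (\<lambda>y. (cmod (f x))\<^sup>2)"
    using set_integrable_M_continuous[OF _ st(2), of "\<lambda>y. (cmod (f x))\<^sup>2"] by simp
  have "(cmod (f x))\<^sup>2 * ?m = integral {s..t} (\<lambda>y. r y *\<^sub>R (cmod (f x))\<^sup>2)"
    by (simp add: mult.commute)
  also have "\<dots> = (LINT y:{s..t}|M. (cmod (f x))\<^sup>2)" by (rule set_integral_M(2)[OF s1 st(2)])
  also have "\<dots> \<le> (LINT y:{s..t}|M. (cmod (f y))\<^sup>2)"
    using x by (intro set_integral_mono s s1 power_mono) auto
  also have "\<dots> \<le> (LINT y|M. (cmod (f y))\<^sup>2)"
    unfolding set_lebesgue_integral_def using s int
    by (intro integral_mono) (auto simp: set_integrable_def indicator_def)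
  finally have "(cmod (f x))\<^sup>2 \<le> (L2_norm M f)\<^sup>2 / ?m" using m by (simp add: L2_norm_square field_simps)
  then have "sqrt ((cmod (f x))\<^sup>2) \<le> sqrt ((L2_norm M f)\<^sup>2 / ?m)" by (rule real_sqrt_le_mono)
  then have "cmod (f x) \<le> L2_norm M f / sqrt ?m" by (simp add: real_sqrt_divide L2_norm_nonneg)
  with x(1) that show thesis by blast
qed

text \<open>The absorption step of the next estimate.  Here $P$ and $Q$ are the integrals of $1/p$ and
$\vert q\vert$, $m$ and $m_1$ the maxima of $\vert f\vert$ and $\vert f^{[1]}\vert$, $N$ the
integral of $\vert rh\vert$, and $A$, $B$ bounds for $\vert f\vert$ at two points.  The bound
$PQ \le 1/4$ allows $mQP$ to be absorbed into the left-hand side.\<close>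

lemma interval_estimate_aux:
  fixes A B P Q N m m1 :: real
  assumes P: "P > 0" and Q: "Q \<ge> 0" and PQ: "P * Q \<le> 1 / 4" and nn: "A \<ge> 0" "m1 \<ge> 0"
    and m: "m \<le> A + m1 * P" and m1: "m1 * (P / 2) \<le> A + B + (m * Q + N) * P"
  shows "m1 \<le> (4 / P) * (A + B + A / 4 + N * P)" "m \<le> A + 4 * (A + B + A / 4 + N * P)"
proof -
  have QP: "0 \<le> Q * P" using P Q by simp
  have "m * Q * P \<le> (A + m1 * P) * (Q * P)"
    using mult_right_mono[OF m QP] by (simp add: mult.assoc)
  also have "\<dots> \<le> (A + m1 * P) * (1 / 4)"
    using PQ nn P by (intro mult_left_mono) (auto simp: mult.commute)
  finally have "m1 * P / 4 \<le> A + B + A / 4 + N * P"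
    using m1 by (simp add: algebra_simps)
  then have 1: "m1 * P \<le> 4 * (A + B + A / 4 + N * P)" by simp
  then show "m1 \<le> (4 / P) * (A + B + A / 4 + N * P)" using P by (simp add: field_simps)
  show "m \<le> A + 4 * (A + B + A / 4 + N * P)" using m 1 by linarith
qed

text \<open>$\vert f\vert$ and $\vert f^{[1]}\vert$ are bounded on $[c,d]$ by a constant multiple of the graph
norm of $f$, uniformly in $f$.\<close>

definition bounded_by_graph_norm :: "real \<Rightarrow> real \<Rightarrow> bool" where
  "bounded_by_graph_norm c d \<longleftrightarrow> (\<exists>C\<ge>0. \<forall>f f1 h. sl_pair f f1 h \<longrightarrow> f \<in> L2 M \<longrightarrow> h \<in> L2 M \<longrightarrow>
     (\<forall>x\<in>{c..d}. cmod (f x) \<le> C * (L2_norm M f + L2_norm M h) \<and>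
                 cmod (f1 x) \<le> C * (L2_norm M f + L2_norm M h)))"

text \<open>On an interval where the integrals of $1/p$ and $\vert q\vert$ have product at most $1/4$: near
both ends there are points $y$, $z$ where $\vert f\vert$ is bounded by a multiple of the norm of $f$, while
$f^{[1]}$ oscillates by at most $mQ + N$.  Therefore $f(z) - f(y)$, the integral of
$f^{[1]}/p$ from $y$ to $z$, controls the maximum of $\vert f^{[1]}\vert$.\<close>

lemma short_interval_estimate:
  assumes cd: "c < d" "{c..d} \<subseteq> I"
    and PQ: "integral {c..d} (\<lambda>x. 1 / p x) * integral {c..d} (\<lambda>x. \<bar>q x\<bar>) \<le> 1 / 4"
  shows "bounded_by_graph_norm c d"
proof -
  let ?k = "\<lambda>x. 1 / p x"
  define P where "P = integral {c..d} ?k"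
  define Q where "Q = integral {c..d} (\<lambda>x. \<bar>q x\<bar>)"
  have k: "?k absolutely_integrable_on {c..d}" and qi: "q absolutely_integrable_on {c..d}"
    using coeff_absolutely_integrable[OF cd(2)] by auto
  have kI: "?k integrable_on {s..t}" if "{s..t} \<subseteq> {c..d}" for s t
    using k that by (meson absolutely_integrable_on_def integrable_on_subinterval)
  have pk: "AE x in lebesgue. x \<in> I \<longrightarrow> 0 < 1 / p x" using p_pos by eventually_elim simp
  have P: "P > 0" unfolding P_def by (rule integral_pos_AE[OF k cd pk])
  have Q: "Q \<ge> 0" unfolding Q_def using qi
    by (intro integral_nonneg) (auto simp: absolutely_integrable_on_def)
  let ?F = "\<lambda>t. integral {c..t} ?k"
  have cont: "continuous_on {c..d} ?F" by (rule indefinite_integral_continuous_1[OF kI]) simp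
  \<comment> \<open>The points \<open>c'\<close> and \<open>d'\<close> cut off a quarter of the integral of \<open>1 / p\<close> at each end, so
    that at least half of it lies between \<open>y\<close> and \<open>z\<close>.\<close>
  obtain c' where c': "c \<le> c'" "c' \<le> d" "?F c' = P / 4"
    using IVT'[of ?F c "P / 4" d] cont cd P by (auto simp: P_def)
  obtain d' where d': "c' \<le> d'" "d' \<le> d" "?F d' = 3 * P / 4"
    using IVT'[of ?F c' "3 * P / 4" d] continuous_on_subset[OF cont, of "{c'..d}"] c' P by (auto simp: P_def)
  have ne: "c < c'" "c' < d'" "d' < d"
    using c' d' P by (auto simp: less_le P_def)
  have mid: "integral {c'..d'} ?k = P / 2"
    using Henstock_Kurzweil_Integration.integral_combine[OF c'(1) d'(1) kI] c' d' by simp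
  have sub: "{c..c'} \<subseteq> I" "{d'..d} \<subseteq> I" using cd ne by (auto simp: subset_iff)
  define a where "a = 1 / sqrt (integral {c..c'} r)"
  define b where "b = 1 / sqrt (integral {d'..d} r)"
  define K where "K = L2_norm M (\<lambda>x. indicator {c..d} x)"
  have mpos: "0 < integral {c..c'} r" "0 < integral {d'..d} r"
    using integral_pos_AE[OF coeff_absolutely_integrable(1)] sub ne r_pos by auto
  have ab: "0 \<le> a" "0 \<le> b" using mpos by (simp_all add: a_def b_def)
  have K: "K \<ge> 0" by (simp add: K_def L2_norm_nonneg)
  define C where "C = max ((4 / P) * (a + b + a / 4 + K * P)) (a + 4 * (a + b + a / 4 + K * P))"
  have C0: "C \<ge> 0" using ab K P by (simp add: C_def le_max_iff_disj)
  have "cmod (f x) \<le> C * (L2_norm M f + L2_norm M h) \<and> cmod (f1 x) \<le> C * (L2_norm M f + L2_norm M h)"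
    if pair: "sl_pair f f1 h" and f: "f \<in> L2 M" and h: "h \<in> L2 M" and x: "x \<in> {c..d}" for f f1 h x
  proof -
    define G where "G = L2_norm M f + L2_norm M h"
    have G: "L2_norm M f \<le> G" "L2_norm M h \<le> G" "0 \<le> G" by (simp_all add: G_def L2_norm_nonneg)
    have fc: "continuous_on I f" "continuous_on I f1" using sl_pair_continuous[OF pair] .
    obtain y where y: "y \<in> {c..c'}" "cmod (f y) \<le> a * L2_norm M f"
      by (rule L2_point_bound[OF ne(1) sub(1) fc(1) f]) (simp add: a_def)
    obtain z where z: "z \<in> {d'..d}" "cmod (f z) \<le> b * L2_norm M f"
      by (rule L2_point_bound[OF ne(3) sub(2) fc(1) f]) (simp add: b_def)
    have yb: "cmod (f y) \<le> a * G" and zb: "cmod (f z) \<le> b * G"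
      using y z mult_left_mono[OF G(1) ab(1)] mult_left_mono[OF G(1) ab(2)] by linarith+
    have yz: "y \<in> {c..d}" "z \<in> {c..d}" "y \<le> z" using y z ne by auto
    have cc: "continuous_on {c..d} (\<lambda>x. cmod (f x))" "continuous_on {c..d} (\<lambda>x. cmod (f1 x))"
      using fc cd by (auto intro!: continuous_intros intro: continuous_on_subset)
    obtain u where u: "u \<in> {c..d}" "\<And>x. x \<in> {c..d} \<Longrightarrow> cmod (f x) \<le> cmod (f u)"
      using continuous_attains_sup[OF _ _ cc(1)] cd by auto
    obtain w where w: "w \<in> {c..d}" "\<And>x. x \<in> {c..d} \<Longrightarrow> cmod (f1 x) \<le> cmod (f1 w)"
      using continuous_attains_sup[OF _ _ cc(2)] cd by auto
    define m where "m = cmod (f u)"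
    define m1 where "m1 = cmod (f1 w)"
    have hr: "(\<lambda>x. cr x * h x) absolutely_integrable_on {c..d}"
      using L2_locally_integrable(1)[OF h cd(2)] .
    define N where "N = integral {c..d} (\<lambda>x. cmod (cr x * h x))"
    have N: "N \<le> K * G"
      using L2_locally_integrable(2)[OF h cd(2)] mult_left_mono[OF G(2) K] by (simp add: N_def K_def)
    have pr: "primitive_on I f (\<lambda>x. f1 x / cp x)" "primitive_on I f1 (\<lambda>x. cq x * f x - cr x * h x)"
      using pair by (auto simp: sl_pair_def)
    have f_diff: "cmod (f t - f s - l * complex_of_real (integral {s..t} ?k)) \<le> B * integral {s..t} ?k"
      if st: "s \<le> t" "{s..t} \<subseteq> {c..d}" and B: "\<And>x. x \<in> {s..t} \<Longrightarrow> cmod (f1 x - l) \<le> B" for s t l B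
    proof -
      have stI: "{s..t} \<subseteq> I" using st cd by blast
      note F = primitive_onD[OF pr(1) st(1) stI]
      have ck: "(\<lambda>x. complex_of_real (1 / p x)) integrable_on {s..t}"
        "integral {s..t} (\<lambda>x. complex_of_real (1 / p x)) = complex_of_real (integral {s..t} ?k)"
        using integrable_linear[OF kI[OF st(2)] bounded_linear_of_real[where 'a = complex]]
          integral_linear[OF kI[OF st(2)] bounded_linear_of_real[where 'a = complex]] by (simp_all add: o_def)
      have i2: "(\<lambda>x. l * complex_of_real (1 / p x)) integrable_on {s..t}"
        using ck(1) integrable_on_mult_right by blast
      have "f t - f s - l * complex_of_real (integral {s..t} ?k) =
          integral {s..t} (\<lambda>x. f1 x / cp x - l * complex_of_real (1 / p x))"
        unfolding F(3)[symmetric] ck(2)[symmetric] integral_mult_right[symmetric]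
        by (rule integral_diff[OF F(2) i2, symmetric])
      also have "\<dots> = integral {s..t} (\<lambda>x. (f1 x - l) * complex_of_real (1 / p x))"
        by (simp add: diff_divide_distrib)
      also have "cmod \<dots> \<le> integral {s..t} (\<lambda>x. B * \<bar>1 / p x\<bar>)"
      proof (rule integral_norm_bound_integral)
        show "(\<lambda>x. (f1 x - l) * complex_of_real (1 / p x)) integrable_on {s..t}"
          using integrable_diff[OF F(2) i2] by (simp add: diff_divide_distrib)
        have "?k absolutely_integrable_on {s..t}" using k st(2) absolutely_integrable_on_subinterval by blast
        then show "(\<lambda>x. B * \<bar>1 / p x\<bar>) integrable_on {s..t}"
          by (intro integrable_on_mult_right) (auto simp: absolutely_integrable_on_def)
        show "cmod ((f1 x - l) * complex_of_real (1 / p x)) \<le> B * \<bar>1 / p x\<bar>" if "x \<in> {s..t}" for x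
          unfolding norm_mult norm_of_real by (rule mult_right_mono[OF B[OF that]]) simp
      qed
      also have "\<dots> = B * integral {s..t} (\<lambda>x. \<bar>1 / p x\<bar>)" by (rule integral_mult_right)
      also have "integral {s..t} (\<lambda>x. \<bar>1 / p x\<bar>) = integral {s..t} ?k"
        by (rule integral_spike[OF AE_lebesgue_negligible[OF pk]]) (use stI in \<open>auto simp: subset_iff\<close>)
      finally show ?thesis .
    qed
    have f1_diff: "cmod (f1 t - f1 s) \<le> m * Q + N"
      if st: "s \<le> t" "{s..t} \<subseteq> {c..d}" for s t
    proof -
      have stI: "{s..t} \<subseteq> I" using st cd by blast
      note F = primitive_onD[OF pr(2) st(1) stI]
      have qa: "(\<lambda>x. m * \<bar>q x\<bar>) integrable_on {c..d}"
        using qi integrable_on_mult_right by (auto simp: absolutely_integrable_on_def)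
      have ra: "(\<lambda>x. cmod (cr x * h x)) integrable_on {c..d}"
        using hr by (auto simp: absolutely_integrable_on_def)
      have bi: "(\<lambda>x. m * \<bar>q x\<bar> + cmod (cr x * h x)) integrable_on {c..d}" by (rule integrable_add[OF qa ra])
      have bst: "(\<lambda>x. m * \<bar>q x\<bar> + cmod (cr x * h x)) integrable_on {s..t}"
        using bi st(2) integrable_on_subinterval by blast
      have "cmod (f1 t - f1 s) \<le> integral {s..t} (\<lambda>x. m * \<bar>q x\<bar> + cmod (cr x * h x))"
        unfolding F(3)[symmetric]
      proof (rule integral_norm_bound_integral[OF F(2) bst])
        fix x assume "x \<in> {s..t}"
        then have "cmod (f x) \<le> m" using u(2) st by (auto simp: m_def)
        then have "cmod (cq x * f x) \<le> m * \<bar>q x\<bar>" using mult_right_mono[of "cmod (f x)" m "\<bar>q x\<bar>"] by (simp add: norm_mult mult.commute)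
        then show "cmod (cq x * f x - cr x * h x) \<le> m * \<bar>q x\<bar> + cmod (cr x * h x)"
          using norm_triangle_ineq4[of "cq x * f x" "cr x * h x"] by linarith
      qed
      also have "\<dots> \<le> integral {c..d} (\<lambda>x. m * \<bar>q x\<bar> + cmod (cr x * h x))"
        by (rule integral_subset_le[OF st(2) bst bi]) (simp add: m_def)
      also have "\<dots> = m * Q + N"
        by (subst integral_add[OF qa ra]) (simp add: Q_def N_def)
      finally show ?thesis .
    qed
    have k_le: "integral {s..t} ?k \<le> P" if st: "{s..t} \<subseteq> {c..d}" for s t
    proof -
      have "integral {s..t} ?k = integral {s..t} (\<lambda>x. \<bar>1 / p x\<bar>)"
        by (rule integral_spike[OF AE_lebesgue_negligible[OF pk]]) (use st cd in \<open>auto simp: subset_iff\<close>)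
      also have "\<dots> \<le> integral {c..d} (\<lambda>x. \<bar>1 / p x\<bar>)"
      proof (rule integral_subset_le[OF st])
        show "(\<lambda>x. \<bar>1 / p x\<bar>) integrable_on {c..d}" using k by (auto simp: absolutely_integrable_on_def)
        then show "(\<lambda>x. \<bar>1 / p x\<bar>) integrable_on {s..t}" using st integrable_on_subinterval by blast
      qed simp
      also have "\<dots> = P" unfolding P_def
        by (rule integral_spike[OF AE_lebesgue_negligible[OF pk]]) (use cd in \<open>auto simp: subset_iff\<close>)
      finally show ?thesis .
    qed
    have m_le: "m \<le> a * G + m1 * P"
    proof -
      have *: "cmod (f t - f s) \<le> m1 * P" if "s \<le> t" "{s..t} \<subseteq> {c..d}" for s t
      proof -
        have "cmod (f t - f s - 0 * complex_of_real (integral {s..t} ?k)) \<le> m1 * integral {s..t} ?k"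
          by (rule f_diff[OF that]) (use w(2) that in \<open>auto simp: m1_def\<close>)
        also have "\<dots> \<le> m1 * P" by (rule mult_left_mono[OF k_le[OF that(2)]]) (simp add: m1_def)
        finally show ?thesis by simp
      qed
      have "cmod (f u - f y) \<le> m1 * P"
        using *[of y u] *[of u y] u(1) yz by (cases "y \<le> u") (auto simp: norm_minus_commute)
      then show ?thesis using yb norm_triangle_sub[of "f u" "f y"] by (simp add: m_def)
    qed
    have m1_le: "m1 * (P / 2) \<le> a * G + b * G + (m * Q + N) * P"
    proof -
      have yz_sub: "{y..z} \<subseteq> {c..d}" using yz by auto
      have mN: "0 \<le> m * Q + N"
        using Q hr by (auto simp: m_def N_def absolutely_integrable_on_def intro!: add_nonneg_nonneg integral_nonneg)
      have "cmod (f z - f y - f1 w * complex_of_real (integral {y..z} ?k)) \<le> (m * Q + N) * integral {y..z} ?k"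
      proof (rule f_diff[OF yz(3) yz_sub])
        fix t assume t: "t \<in> {y..z}"
        then have "t \<in> {c..d}" using yz_sub by blast
        then show "cmod (f1 t - f1 w) \<le> m * Q + N"
          using f1_diff[of t w] f1_diff[of w t] w(1) by (cases "t \<le> w") (auto simp: norm_minus_commute)
      qed
      also have "\<dots> \<le> (m * Q + N) * P" by (rule mult_left_mono[OF k_le[OF yz_sub] mN])
      finally have 1: "cmod (f1 w * complex_of_real (integral {y..z} ?k)) \<le> cmod (f z - f y) + (m * Q + N) * P"
        using norm_triangle_sub[of "f1 w * complex_of_real (integral {y..z} ?k)" "f z - f y"]
        by (simp add: norm_minus_commute)
      have "P / 2 \<le> integral {y..z} ?k"
      proof -
        have "{c'..d'} \<subseteq> {y..z}" using y z by auto
        have "integral {c'..d'} ?k = integral {c'..d'} (\<lambda>x. \<bar>1 / p x\<bar>)"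
          by (rule integral_spike[OF AE_lebesgue_negligible[OF pk]]) (use c' d' cd in \<open>auto simp: subset_iff\<close>)
        also have "\<dots> \<le> integral {y..z} (\<lambda>x. \<bar>1 / p x\<bar>)"
        proof (rule integral_subset_le[OF \<open>{c'..d'} \<subseteq> {y..z}\<close>])
          have "(\<lambda>x. \<bar>1 / p x\<bar>) integrable_on {c..d}" using k by (auto simp: absolutely_integrable_on_def)
          then show "(\<lambda>x. \<bar>1 / p x\<bar>) integrable_on {c'..d'}" "(\<lambda>x. \<bar>1 / p x\<bar>) integrable_on {y..z}"
            using yz_sub \<open>{c'..d'} \<subseteq> {y..z}\<close> integrable_on_subinterval by blast+
        qed simp
        also have "\<dots> = integral {y..z} ?k"
          by (rule integral_spike[OF AE_lebesgue_negligible[OF pk]]) (use yz_sub cd in \<open>auto simp: subset_iff\<close>)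
        finally show ?thesis using mid by simp
      qed
      then have "m1 * (P / 2) \<le> m1 * integral {y..z} ?k" by (rule mult_left_mono) (simp add: m1_def)
      also have "\<dots> \<le> cmod (f1 w * complex_of_real (integral {y..z} ?k))"
        unfolding norm_mult norm_of_real m1_def by (intro mult_left_mono) auto
      finally have 2: "m1 * (P / 2) \<le> cmod (f z - f y) + (m * Q + N) * P" using 1 by linarith
      have "cmod (f z - f y) \<le> cmod (f z) + cmod (f y)" by (rule norm_triangle_ineq4)
      with 2 show ?thesis using yb zb by linarith
    qed
    have PQ': "P * Q \<le> 1 / 4" using PQ by (simp add: P_def Q_def)
    have aG: "0 \<le> a * G" "0 \<le> m1" using ab G by (simp_all add: m1_def)
    note est = interval_estimate_aux[OF P Q PQ' aG m_le m1_le]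
    have NP: "N * P \<le> K * G * P" using N P by (intro mult_right_mono) auto
    have sum_le: "a * G + b * G + a * G / 4 + N * P \<le> (a + b + a / 4 + K * P) * G"
      using NP by (simp add: algebra_simps)
    have "m1 \<le> (4 / P) * ((a + b + a / 4 + K * P) * G)"
      using order_trans[OF est(1) mult_left_mono[OF sum_le, of "4 / P"]] P by simp
    also have "\<dots> = (4 / P) * (a + b + a / 4 + K * P) * G" by simp
    also have "\<dots> \<le> C * G" using G(3) by (intro mult_right_mono) (auto simp: C_def)
    finally have A: "m1 \<le> C * G" .
    have "m \<le> a * G + 4 * ((a + b + a / 4 + K * P) * G)"
      using mult_left_mono[OF sum_le, of 4] by (intro order_trans[OF est(2)] add_left_mono) simp
    also have "\<dots> = (a + 4 * (a + b + a / 4 + K * P)) * G" by (simp add: algebra_simps)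
    also have "\<dots> \<le> C * G" using G(3) by (intro mult_right_mono) (auto simp: C_def)
    finally have B: "m \<le> C * G" .
    show ?thesis using u(2)[OF x] w(2)[OF x] A B by (simp add: m_def m1_def G_def)
  qed
  then show ?thesis unfolding bounded_by_graph_norm_def using C0 by blast
qed

lemma bounded_by_graph_norm_subset:
  assumes "bounded_by_graph_norm c d" "{u..v} \<subseteq> {c..d}"
  shows "bounded_by_graph_norm u v"
  using assms unfolding bounded_by_graph_norm_def by (meson subsetD)

text \<open>The interval is covered by finitely many short ones.\<close>

lemma compact_interval_estimate:
  assumes cd: "{c..d} \<subseteq> I"
  shows "bounded_by_graph_norm c d"
proof (cases "c \<le> d")
  case False
  then show ?thesis by (auto simp: bounded_by_graph_norm_def intro!: exI[of _ 0])
next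
  case True
  define Pr where "Pr u v \<longleftrightarrow> ({u..v} \<subseteq> {c..d} \<longrightarrow> bounded_by_graph_norm u v)" for u v
  have "Pr c d"
  proof (rule Bolzano[OF True])
    fix x y z assume *: "Pr x y" "Pr y z" "x \<le> y" "y \<le> z"
    show "Pr x z" unfolding Pr_def
    proof
      assume sub: "{x..z} \<subseteq> {c..d}"
      then have "bounded_by_graph_norm x y" "bounded_by_graph_norm y z"
        using * by (auto simp: Pr_def subset_iff)
      then obtain C1 C2 where C1: "C1 \<ge> 0" "\<And>f f1 h x'. sl_pair f f1 h \<Longrightarrow> f \<in> L2 M \<Longrightarrow> h \<in> L2 M \<Longrightarrow> x' \<in> {x..y} \<Longrightarrow>
         cmod (f x') \<le> C1 * (L2_norm M f + L2_norm M h) \<and> cmod (f1 x') \<le> C1 * (L2_norm M f + L2_norm M h)"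
        and C2: "C2 \<ge> 0" "\<And>f f1 h x'. sl_pair f f1 h \<Longrightarrow> f \<in> L2 M \<Longrightarrow> h \<in> L2 M \<Longrightarrow> x' \<in> {y..z} \<Longrightarrow>
         cmod (f x') \<le> C2 * (L2_norm M f + L2_norm M h) \<and> cmod (f1 x') \<le> C2 * (L2_norm M f + L2_norm M h)"
        unfolding bounded_by_graph_norm_def by (metis (no_types, lifting))
      have "cmod (f x') \<le> max C1 C2 * (L2_norm M f + L2_norm M h) \<and> cmod (f1 x') \<le> max C1 C2 * (L2_norm M f + L2_norm M h)"
        if P: "sl_pair f f1 h" "f \<in> L2 M" "h \<in> L2 M" and x': "x' \<in> {x..z}" for f f1 h x'
      proof -
        have G: "0 \<le> L2_norm M f + L2_norm M h" by (simp add: L2_norm_nonneg)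
        have "C1 * (L2_norm M f + L2_norm M h) \<le> max C1 C2 * (L2_norm M f + L2_norm M h)"
          "C2 * (L2_norm M f + L2_norm M h) \<le> max C1 C2 * (L2_norm M f + L2_norm M h)"
          using G by (intro mult_right_mono; simp)+
        moreover have "x' \<in> {x..y} \<or> x' \<in> {y..z}" using x' by auto
        ultimately show ?thesis using C1(2)[OF P, of x'] C2(2)[OF P, of x'] by (meson order_trans)
      qed
      then show "bounded_by_graph_norm x z" unfolding bounded_by_graph_norm_def
        using C1(1) by (intro exI[of _ "max C1 C2"]) auto
    qed
  next
    fix x assume x: "c \<le> x" "x \<le> d"
    then obtain e where e: "e > 0" "cball x e \<subseteq> I"
      using cd open_I open_contains_cball by (metis atLeastAtMost_iff subsetD)
    then have eI: "{x - e..x + e} \<subseteq> I" by (simp add: cball_eq_atLeastAtMost)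
    let ?w = "\<lambda>x. \<bar>1 / p x\<bar> + \<bar>q x\<bar>"
    have w: "?w integrable_on {x - e..x + e}"
      using coeff_absolutely_integrable[OF eI] by (auto simp: absolutely_integrable_on_def intro!: integrable_add)
    let ?F = "\<lambda>t. integral {x - e..t} ?w"
    have "continuous_on {x - e..x + e} ?F" by (rule indefinite_integral_continuous_1[OF w])
    then obtain \<delta> where \<delta>: "\<delta> > 0" "\<And>y. y \<in> {x - e..x + e} \<Longrightarrow> dist y x < \<delta> \<Longrightarrow> dist (?F y) (?F x) < 1 / 4"
      using continuous_on_iff[THEN iffD1, rule_format, of "{x - e..x + e}" ?F x "1 / 4"] e by auto
    define \<eta> where "\<eta> = min e (\<delta> / 2)"
    have \<eta>: "\<eta> > 0" "\<eta> \<le> e" "\<eta> < \<delta>" using e \<delta> by (auto simp: \<eta>_def min_def)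
    let ?u = "x - \<eta>" and ?v = "x + \<eta>"
    have sub: "{?u..?v} \<subseteq> {x - e..x + e}" using \<eta> by auto
    have "integral {?u..?v} ?w = ?F ?v - ?F ?u"
    proof -
      have "?F ?u + integral {?u..?v} ?w = ?F ?v"
        using \<eta> w by (intro Henstock_Kurzweil_Integration.integral_combine) (auto intro: integrable_on_subinterval)
      then show ?thesis by simp
    qed
    \<comment> \<open>The integrals of \<open>1 / p\<close> and of the absolute value of \<open>q\<close> then have sum at most \<open>1 / 2\<close>,
      hence product at most \<open>1 / 4\<close>.\<close>
    moreover have "dist (?F ?v) (?F x) < 1 / 4" "dist (?F ?u) (?F x) < 1 / 4"
      using \<eta> by (intro \<delta>(2); simp add: dist_real_def)+
    ultimately have small: "integral {?u..?v} ?w \<le> 1 / 2"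
      unfolding dist_real_def by linarith
    have uvI: "{?u..?v} \<subseteq> I" using sub eI by blast
    have ai: "(\<lambda>x. \<bar>1 / p x\<bar>) integrable_on {?u..?v}" "(\<lambda>x. 1 / p x) integrable_on {?u..?v}" "(\<lambda>x. \<bar>q x\<bar>) integrable_on {?u..?v}"
      using coeff_absolutely_integrable[OF uvI] by (auto simp: absolutely_integrable_on_def)
    have "integral {?u..?v} (\<lambda>x. \<bar>1 / p x\<bar>) + integral {?u..?v} (\<lambda>x. \<bar>q x\<bar>) \<le> 1 / 2"
      using small integral_add[OF ai(1,3)] by simp
    moreover have nn: "0 \<le> integral {?u..?v} (\<lambda>x. \<bar>1 / p x\<bar>)" "0 \<le> integral {?u..?v} (\<lambda>x. \<bar>q x\<bar>)"
      using ai by (intro integral_nonneg; simp)+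
    moreover have "integral {?u..?v} (\<lambda>x. 1 / p x) \<le> integral {?u..?v} (\<lambda>x. \<bar>1 / p x\<bar>)"
      using ai by (intro integral_le) (simp_all only: abs_ge_self)
    ultimately have "integral {?u..?v} (\<lambda>x. 1 / p x) * integral {?u..?v} (\<lambda>x. \<bar>q x\<bar>) \<le> (1 / 2) * (1 / 2)"
      by (intro mult_mono) (use nn in linarith)+
    then have b: "bounded_by_graph_norm ?u ?v"
      using \<eta> uvI by (intro short_interval_estimate) auto
    have "\<forall>a b. a \<le> x \<and> x \<le> b \<and> b - a < \<eta> \<longrightarrow> Pr a b"
    proof (intro allI impI)
      fix a b assume "a \<le> x \<and> x \<le> b \<and> b - a < \<eta>"
      then have "{a..b} \<subseteq> {?u..?v}" by auto
      then show "Pr a b" using bounded_by_graph_norm_subset[OF b] by (simp add: Pr_def)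
    qed
    then show "\<exists>d>0. \<forall>a b. a \<le> x \<and> x \<le> b \<and> b - a < d \<longrightarrow> Pr a b" using \<eta>(1) by blast
  qed
  then show ?thesis by (simp add: Pr_def)
qed

end

section \<open>The maximal operator is closed, and boundary values are bounded\<close>

context sl_problem
begin

lemma absolutely_integrable_continuous_mult:
  fixes k :: "real \<Rightarrow> complex" and w :: "real \<Rightarrow> real"
  assumes k: "continuous_on {c..d} k" and w: "w absolutely_integrable_on {c..d}"
  shows "(\<lambda>x. complex_of_real (w x) * k x) absolutely_integrable_on {c..d}"
proof -
  have w': "(\<lambda>x. complex_of_real (w x)) absolutely_integrable_on {c..d}"
    using absolutely_integrable_linear[OF w bounded_linear_of_real[where 'a = complex]] by (simp add: o_def)
  have "(\<lambda>x. k x * complex_of_real (w x)) absolutely_integrable_on {c..d}"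
  proof (rule absolutely_integrable_bounded_measurable_product[OF bilinear_conv_bounded_bilinear[THEN iffD2, OF bounded_bilinear_mult] _ _ _ w'])
    show "k \<in> borel_measurable (lebesgue_on {c..d})"
      by (rule continuous_imp_measurable_on_sets_lebesgue[OF k]) simp
    show "bounded (k ` {c..d})"
      by (rule compact_imp_bounded[OF compact_continuous_image[OF k]]) simp
  qed simp
  then show ?thesis by (simp add: mult.commute)
qed

lemma integral_continuous_mult_bound:
  fixes k :: "real \<Rightarrow> complex" and w :: "real \<Rightarrow> real"
  assumes k: "continuous_on {c..d} k" and w: "w absolutely_integrable_on {c..d}"
    and B: "\<And>x. x \<in> {c..d} \<Longrightarrow> cmod (k x) \<le> B"
  shows "cmod (integral {c..d} (\<lambda>x. complex_of_real (w x) * k x)) \<le> B * integral {c..d} (\<lambda>x. \<bar>w x\<bar>)"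
proof -
  have wi: "(\<lambda>x. \<bar>w x\<bar>) integrable_on {c..d}" using w by (auto simp: absolutely_integrable_on_def)
  have "cmod (integral {c..d} (\<lambda>x. complex_of_real (w x) * k x)) \<le> integral {c..d} (\<lambda>x. B * \<bar>w x\<bar>)"
  proof (rule integral_norm_bound_integral)
    show "(\<lambda>x. complex_of_real (w x) * k x) integrable_on {c..d}"
      using absolutely_integrable_continuous_mult[OF k w] by (simp add: absolutely_integrable_on_def)
    show "(\<lambda>x. B * \<bar>w x\<bar>) integrable_on {c..d}" using wi by (rule integrable_on_mult_right)
    show "cmod (complex_of_real (w x) * k x) \<le> B * \<bar>w x\<bar>" if "x \<in> {c..d}" for x
      using mult_right_mono[OF B[OF that], of "\<bar>w x\<bar>"] by (simp add: norm_mult mult.commute)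
  qed
  also have "\<dots> = B * integral {c..d} (\<lambda>x. \<bar>w x\<bar>)" by (rule integral_mult_right)
  finally show ?thesis .
qed

text \<open>A sequence that converges in the graph norm converges, together with its quasi-derivatives,
uniformly on compact subintervals.  The limits satisfy the integral equations because the
coefficients are locally integrable.\<close>

lemma T_max_closed:
  assumes g: "\<And>n. g n \<in> dom_max S" and f: "f \<in> L2 M" and h: "h \<in> L2 M"
    and lim: "(\<lambda>n. L2_norm M (\<lambda>x. f x - g n x)) \<longlonglongrightarrow> 0"
      "(\<lambda>n. L2_norm M (\<lambda>x. h x - tau S (g n) x)) \<longlonglongrightarrow> 0"
  obtains G where "G \<in> dom_max S" "AE x in M. f x = G x" "AE x in M. h x = tau S G x"
proof -
  define e where "e n = L2_norm M (\<lambda>x. f x - g n x) + L2_norm M (\<lambda>x. h x - tau S (g n) x)" for n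
  have e: "e \<longlonglongrightarrow> 0" unfolding e_def using tendsto_add[OF lim] by simp
  have e0: "0 \<le> e n" for n by (simp add: e_def L2_norm_nonneg)
  define g1 where "g1 n = quasi_deriv S (g n)" for n
  note gd = dom_max_D[OF g]
  have pair: "sl_pair (g n) (g1 n) (tau S (g n))" for n using gd(1) by (simp add: g1_def)
  have g1c: "continuous_on I (g1 n)" for n using sl_pair_continuous(2)[OF pair] .
  have norms: "L2_norm M (\<lambda>x. g n x - g m x) + L2_norm M (\<lambda>x. tau S (g n) x - tau S (g m) x) \<le> e n + e m" for n m
  proof -
    have "L2_norm M (\<lambda>x. (f x - g m x) - (f x - g n x)) \<le> L2_norm M (\<lambda>x. f x - g m x) + L2_norm M (\<lambda>x. f x - g n x)"
      by (intro L2_diff(2) L2_diff(1) f gd)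
    moreover have "L2_norm M (\<lambda>x. (h x - tau S (g m) x) - (h x - tau S (g n) x)) \<le>
        L2_norm M (\<lambda>x. h x - tau S (g m) x) + L2_norm M (\<lambda>x. h x - tau S (g n) x)"
      by (intro L2_diff(2) L2_diff(1) h gd)
    ultimately show ?thesis by (simp add: e_def)
  qed
  have cauchy: "\<exists>C\<ge>0. \<forall>n m. \<forall>x\<in>{c..d}. cmod (g n x - g m x) \<le> C * (e n + e m) \<and> cmod (g1 n x - g1 m x) \<le> C * (e n + e m)"
    if cd: "{c..d} \<subseteq> I" for c d
  proof -
    obtain C where C: "C \<ge> 0" "\<And>f f1 h x. sl_pair f f1 h \<Longrightarrow> f \<in> L2 M \<Longrightarrow> h \<in> L2 M \<Longrightarrow> x \<in> {c..d} \<Longrightarrow>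
        cmod (f x) \<le> C * (L2_norm M f + L2_norm M h) \<and> cmod (f1 x) \<le> C * (L2_norm M f + L2_norm M h)"
      using compact_interval_estimate[OF cd] unfolding bounded_by_graph_norm_def by (metis (no_types, lifting))
    have "cmod (g n x - g m x) \<le> C * (e n + e m) \<and> cmod (g1 n x - g1 m x) \<le> C * (e n + e m)"
      if "x \<in> {c..d}" for n m x
    proof -
      have "sl_pair (\<lambda>x. g n x - g m x) (\<lambda>x. g1 n x - g1 m x) (\<lambda>x. tau S (g n) x - tau S (g m) x)"
        using sl_pair_add[OF pair[of n] sl_pair_cmult[OF pair[of m], of "-1"]] by simp
      from C(2)[OF this L2_diff(1)[OF gd(2) gd(2)] L2_diff(1)[OF gd(3) gd(3)] that]
      show ?thesis using mult_left_mono[OF norms C(1), of n m] by linarith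
    qed
    then show ?thesis using C(1) by blast
  qed
  have conv: "convergent (\<lambda>n. g n x)" "convergent (\<lambda>n. g1 n x)" if x: "x \<in> I" for x
  proof -
    obtain C where C: "C \<ge> 0" "\<And>n m. cmod (g n x - g m x) \<le> C * (e n + e m)" "\<And>n m. cmod (g1 n x - g1 m x) \<le> C * (e n + e m)"
      using cauchy[of x x] x by auto
    have *: "convergent k" if k: "\<And>n m. cmod (k n - k m) \<le> C * (e n + e m)" for k :: "nat \<Rightarrow> complex"
    proof (rule Cauchy_convergent, rule CauchyI)
      fix \<epsilon> :: real assume \<epsilon>: "\<epsilon> > 0"
      then have "\<epsilon> / (2 * (C + 1)) > 0" using C by simp
      then obtain N where N: "\<And>n. n \<ge> N \<Longrightarrow> e n < \<epsilon> / (2 * (C + 1))"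
        using order_tendstoD(2)[OF e] by (metis eventually_sequentially)
      have "cmod (k n - k m) < \<epsilon>" if "n \<ge> N" "m \<ge> N" for n m
      proof -
        have "C * (e n + e m) \<le> (C + 1) * (e n + e m)" using e0 by (intro mult_right_mono) (auto intro: add_nonneg_nonneg)
        also have "\<dots> < (C + 1) * (\<epsilon> / (2 * (C + 1)) + \<epsilon> / (2 * (C + 1)))"
          using N[OF that(1)] N[OF that(2)] C by (intro mult_strict_left_mono add_strict_mono) auto
        also have "\<dots> = \<epsilon>"
        proof -
          have "D * (\<epsilon> / (2 * D) + \<epsilon> / (2 * D)) = \<epsilon>" if "D > 0" for D :: real
            using that by (simp add: field_simps)
          from this[of "C + 1"] show ?thesis using C(1) by argo
        qed
        finally show ?thesis using k[of n m] by linarith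
      qed
      then show "\<exists>N. \<forall>m\<ge>N. \<forall>n\<ge>N. cmod (k m - k n) < \<epsilon>" by blast
    qed
    show "convergent (\<lambda>n. g n x)" "convergent (\<lambda>n. g1 n x)" using *[OF C(2)] *[OF C(3)] by auto
  qed
  define G where "G x = lim (\<lambda>n. g n x)" for x
  define G1 where "G1 x = lim (\<lambda>n. g1 n x)" for x
  have G: "(\<lambda>n. g n x) \<longlonglongrightarrow> G x" "(\<lambda>n. g1 n x) \<longlonglongrightarrow> G1 x" if "x \<in> I" for x
    using conv[OF that] by (auto simp: G_def G1_def convergent_LIMSEQ_iff)
  have unif: "\<exists>C\<ge>0. \<forall>n. \<forall>x\<in>{c..d}. cmod (g n x - G x) \<le> C * e n \<and> cmod (g1 n x - G1 x) \<le> C * e n"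
    if cd: "{c..d} \<subseteq> I" for c d
  proof -
    obtain C where C: "C \<ge> 0" "\<And>n m x. x \<in> {c..d} \<Longrightarrow> cmod (g n x - g m x) \<le> C * (e n + e m)"
      "\<And>n m x. x \<in> {c..d} \<Longrightarrow> cmod (g1 n x - g1 m x) \<le> C * (e n + e m)"
      using cauchy[OF cd] by blast
    have "cmod (g n x - G x) \<le> C * e n \<and> cmod (g1 n x - G1 x) \<le> C * e n" if x: "x \<in> {c..d}" for n x
    proof -
      have xI: "x \<in> I" using x cd by blast
      have l: "(\<lambda>m. C * (e n + e m)) \<longlonglongrightarrow> C * (e n + 0)" by (intro tendsto_intros e)
      have "(\<lambda>m. cmod (g n x - g m x)) \<longlonglongrightarrow> cmod (g n x - G x)" by (intro tendsto_intros G xI)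
      from LIMSEQ_le[OF this l] have 1: "cmod (g n x - G x) \<le> C * e n" using C(2)[OF x] by auto
      have "(\<lambda>m. cmod (g1 n x - g1 m x)) \<longlonglongrightarrow> cmod (g1 n x - G1 x)" by (intro tendsto_intros G xI)
      from LIMSEQ_le[OF this l] show ?thesis using 1 C(3)[OF x] by auto
    qed
    then show ?thesis using C(1) by blast
  qed
  have cont: "continuous_on {c..d} G \<and> continuous_on {c..d} G1" if cd: "{c..d} \<subseteq> I" for c d
  proof -
    obtain C where C: "C \<ge> 0" "\<And>n x. x \<in> {c..d} \<Longrightarrow> cmod (g n x - G x) \<le> C * e n"
      "\<And>n x. x \<in> {c..d} \<Longrightarrow> cmod (g1 n x - G1 x) \<le> C * e n"
      using unif[OF cd] by blast
    have *: "uniform_limit {c..d} k K sequentially"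
      if k: "\<And>n x. x \<in> {c..d} \<Longrightarrow> cmod (k n x - K x) \<le> C * e n" for k :: "nat \<Rightarrow> real \<Rightarrow> complex" and K
      unfolding uniform_limit_iff
    proof (intro allI impI)
      fix \<epsilon> :: real assume "\<epsilon> > 0"
      have "(\<lambda>n. C * e n) \<longlonglongrightarrow> C * 0" by (intro tendsto_intros e)
      then have "\<forall>\<^sub>F n in sequentially. C * e n < \<epsilon>" using \<open>\<epsilon> > 0\<close> by (auto dest: order_tendstoD(2))
      then show "\<forall>\<^sub>F n in sequentially. \<forall>x\<in>{c..d}. dist (k n x) (K x) < \<epsilon>"
        by eventually_elim (auto simp: dist_norm intro: le_less_trans[OF k])
    qed
    have "continuous_on {c..d} (g n)" "continuous_on {c..d} (g1 n)" for n
      using gd(4)[of n] g1c[of n] cd by (auto intro: continuous_on_subset)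
    then show ?thesis
      using uniform_limit_theorem[OF _ *[OF C(2)]] uniform_limit_theorem[OF _ *[OF C(3)]]
      by (simp add: trivial_limit_sequentially)
  qed
  have pairG: "sl_pair G G1 h"
    unfolding sl_pair_def primitive_on_def
  proof (intro conjI allI impI)
    fix c d assume cd: "c \<le> (d::real)" "{c..d} \<subseteq> I"
    have Gc: "continuous_on {c..d} G" "continuous_on {c..d} G1" using cont[OF cd(2)] by auto
    have gc: "continuous_on {c..d} (g n)" "continuous_on {c..d} (g1 n)" for n
      using gd(4)[of n] g1c[of n] cd by (auto intro: continuous_on_subset)
    obtain C where C: "C \<ge> 0" "\<And>n x. x \<in> {c..d} \<Longrightarrow> cmod (g n x - G x) \<le> C * e n"
      "\<And>n x. x \<in> {c..d} \<Longrightarrow> cmod (g1 n x - G1 x) \<le> C * e n"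
      using unif[OF cd(2)] by blast
    have "c \<in> I" "d \<in> I" using cd by auto
    note coeff = coeff_absolutely_integrable[OF cd(2)]
    have A: "(\<lambda>x. complex_of_real (1 / p x) * G1 x) absolutely_integrable_on {c..d}"
      by (rule absolutely_integrable_continuous_mult[OF Gc(2) coeff(2)])
    then show "(\<lambda>x. G1 x / cp x) absolutely_integrable_on {c..d}" by simp
    have "(\<lambda>n. integral {c..d} (\<lambda>x. complex_of_real (1 / p x) * g1 n x)) \<longlonglongrightarrow>
        integral {c..d} (\<lambda>x. complex_of_real (1 / p x) * G1 x)"
    proof (rule LIM_zero_cancel, rule Lim_null_comparison)
      show "(\<lambda>n. C * e n * integral {c..d} (\<lambda>x. \<bar>1 / p x\<bar>)) \<longlonglongrightarrow> 0"
        using tendsto_mult[OF tendsto_mult[OF tendsto_const e] tendsto_const] by simp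
      have "norm (integral {c..d} (\<lambda>x. complex_of_real (1 / p x) * g1 n x) -
          integral {c..d} (\<lambda>x. complex_of_real (1 / p x) * G1 x)) \<le> C * e n * integral {c..d} (\<lambda>x. \<bar>1 / p x\<bar>)" for n
      proof -
        have "integral {c..d} (\<lambda>x. complex_of_real (1 / p x) * g1 n x) - integral {c..d} (\<lambda>x. complex_of_real (1 / p x) * G1 x)
            = integral {c..d} (\<lambda>x. complex_of_real (1 / p x) * (g1 n x - G1 x))"
          unfolding right_diff_distrib
          using absolutely_integrable_continuous_mult[OF gc(2) coeff(2)] A
          by (intro integral_diff[symmetric]) (auto simp: absolutely_integrable_on_def)
        then show ?thesis
          using integral_continuous_mult_bound[OF continuous_on_diff[OF gc(2) Gc(2)] coeff(2) C(3)] by simp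
      qed
      then show "\<forall>\<^sub>F n in sequentially. norm (integral {c..d} (\<lambda>x. complex_of_real (1 / p x) * g1 n x) -
          integral {c..d} (\<lambda>x. complex_of_real (1 / p x) * G1 x)) \<le> C * e n * integral {c..d} (\<lambda>x. \<bar>1 / p x\<bar>)"
        by simp
    qed
    moreover have "integral {c..d} (\<lambda>x. complex_of_real (1 / p x) * g1 n x) = g n d - g n c" for n
      using primitive_onD(3)[OF conjunct1[OF pair[of n, unfolded sl_pair_def]] cd] by simp
    moreover have "(\<lambda>n. g n d - g n c) \<longlonglongrightarrow> G d - G c"
      by (intro tendsto_intros G \<open>c \<in> I\<close> \<open>d \<in> I\<close>)
    ultimately have "integral {c..d} (\<lambda>x. complex_of_real (1 / p x) * G1 x) = G d - G c"
      using LIMSEQ_unique by auto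
    then show "integral {c..d} (\<lambda>x. G1 x / cp x) = G d - G c" by simp
    have B: "(\<lambda>x. cq x * G x) absolutely_integrable_on {c..d}"
      by (rule absolutely_integrable_continuous_mult[OF Gc(1) coeff(3)])
    have H: "(\<lambda>x. cr x * h x) absolutely_integrable_on {c..d}"
      by (rule L2_locally_integrable(1)[OF h cd(2)])
    show BH: "(\<lambda>x. cq x * G x - cr x * h x) absolutely_integrable_on {c..d}"
      by (rule set_integral_diff(1)[OF B H])
    define K where "K = L2_norm M (\<lambda>x. indicator {c..d} x)"
    have K: "K \<ge> 0" by (simp add: K_def L2_norm_nonneg)
    have "(\<lambda>n. integral {c..d} (\<lambda>x. cq x * g n x - cr x * tau S (g n) x)) \<longlonglongrightarrow>
        integral {c..d} (\<lambda>x. cq x * G x - cr x * h x)"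
    proof (rule LIM_zero_cancel, rule Lim_null_comparison)
      show "(\<lambda>n. C * e n * integral {c..d} (\<lambda>x. \<bar>q x\<bar>) + K * e n) \<longlonglongrightarrow> 0"
        using tendsto_add[OF tendsto_mult[OF tendsto_mult[OF tendsto_const e] tendsto_const] tendsto_mult[OF tendsto_const e]]
        by simp
      have "norm (integral {c..d} (\<lambda>x. cq x * g n x - cr x * tau S (g n) x) -
          integral {c..d} (\<lambda>x. cq x * G x - cr x * h x)) \<le> C * e n * integral {c..d} (\<lambda>x. \<bar>q x\<bar>) + K * e n" for n
      proof -
        have dh: "(\<lambda>x. h x - tau S (g n) x) \<in> L2 M" by (intro L2_diff h gd)
        have Bn: "(\<lambda>x. cq x * (g n x - G x)) absolutely_integrable_on {c..d}"
          by (rule absolutely_integrable_continuous_mult[OF continuous_on_diff[OF gc(1) Gc(1)] coeff(3)])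
        have Hn: "(\<lambda>x. cr x * (h x - tau S (g n) x)) absolutely_integrable_on {c..d}"
          by (rule L2_locally_integrable(1)[OF dh cd(2)])
        have "integral {c..d} (\<lambda>x. cq x * g n x - cr x * tau S (g n) x) - integral {c..d} (\<lambda>x. cq x * G x - cr x * h x)
            = integral {c..d} (\<lambda>x. (cq x * g n x - cr x * tau S (g n) x) - (cq x * G x - cr x * h x))"
          using primitive_onD(2)[OF conjunct2[OF pair[of n, unfolded sl_pair_def]] cd] BH
          by (intro integral_diff[symmetric]) (auto simp: absolutely_integrable_on_def)
        also have "\<dots> = integral {c..d} (\<lambda>x. cq x * (g n x - G x) + cr x * (h x - tau S (g n) x))"
          by (intro integral_cong) (simp add: algebra_simps)
        also have "\<dots> = integral {c..d} (\<lambda>x. cq x * (g n x - G x)) + integral {c..d} (\<lambda>x. cr x * (h x - tau S (g n) x))"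
          using Bn Hn by (intro integral_add) (auto simp: absolutely_integrable_on_def)
        also have "norm \<dots> \<le> C * e n * integral {c..d} (\<lambda>x. \<bar>q x\<bar>) + K * e n"
        proof (rule norm_triangle_mono)
          show "norm (integral {c..d} (\<lambda>x. cq x * (g n x - G x))) \<le> C * e n * integral {c..d} (\<lambda>x. \<bar>q x\<bar>)"
            using integral_continuous_mult_bound[OF continuous_on_diff[OF gc(1) Gc(1)] coeff(3) C(2)] .
          have "norm (integral {c..d} (\<lambda>x. cr x * (h x - tau S (g n) x))) \<le> integral {c..d} (\<lambda>x. cmod (cr x * (h x - tau S (g n) x)))"
            using Hn by (intro integral_norm_bound_integral) (auto simp: absolutely_integrable_on_def)
          also have "\<dots> \<le> K * L2_norm M (\<lambda>x. h x - tau S (g n) x)"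
            unfolding K_def by (rule L2_locally_integrable(2)[OF dh cd(2)])
          also have "\<dots> \<le> K * e n" by (intro mult_left_mono K) (simp add: e_def L2_norm_nonneg)
          finally show "norm (integral {c..d} (\<lambda>x. cr x * (h x - tau S (g n) x))) \<le> K * e n" .
        qed
        finally show ?thesis .
      qed
      then show "\<forall>\<^sub>F n in sequentially. norm (integral {c..d} (\<lambda>x. cq x * g n x - cr x * tau S (g n) x) -
          integral {c..d} (\<lambda>x. cq x * G x - cr x * h x)) \<le> C * e n * integral {c..d} (\<lambda>x. \<bar>q x\<bar>) + K * e n"
        by simp
    qed
    moreover have "integral {c..d} (\<lambda>x. cq x * g n x - cr x * tau S (g n) x) = g1 n d - g1 n c" for n
      using primitive_onD(3)[OF conjunct2[OF pair[of n, unfolded sl_pair_def]] cd] .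
    moreover have "(\<lambda>n. g1 n d - g1 n c) \<longlonglongrightarrow> G1 d - G1 c"
      by (intro tendsto_intros G \<open>c \<in> I\<close> \<open>d \<in> I\<close>)
    ultimately show "integral {c..d} (\<lambda>x. cq x * G x - cr x * h x) = G1 d - G1 c"
      using LIMSEQ_unique by auto
  qed
  have Gm: "G \<in> borel_measurable M" by (rule continuous_measurable_M[OF sl_pair_continuous(1)[OF pairG]])
  have eq: "AE x in M. f x = G x"
    unfolding AE_M
  proof (rule AE_open_rational_intervals[OF open_I])
    fix c d assume cd: "c \<le> (d::real)" "{c..d} \<subseteq> I"
    obtain C where C: "C \<ge> 0" "\<And>n x. x \<in> {c..d} \<Longrightarrow> cmod (g n x - G x) \<le> C * e n"
      using unif[OF cd(2)] by blast
    define K where "K = L2_norm M (\<lambda>x. indicator {c..d} x)"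
    have im: "(indicator {c..d} :: real \<Rightarrow> complex) \<in> borel_measurable M" using L2_indicator[OF cd(2)] by (simp add: L2_def)
    have bound: "(\<lambda>x. indicator {c..d} x * (f x - G x)) \<in> L2 M \<and>
        L2_norm M (\<lambda>x. indicator {c..d} x * (f x - G x)) \<le> e n + C * e n * K" for n
    proof -
      have 1: "(\<lambda>x. indicator {c..d} x * (f x - g n x)) \<in> L2 M \<and>
          L2_norm M (\<lambda>x. indicator {c..d} x * (f x - g n x)) \<le> L2_norm M (\<lambda>x. f x - g n x)"
      proof -
        have 3: "cmod (indicator {c..d} x * (f x - g n x)) \<le> cmod (f x - g n x)" for x
          by (auto simp: norm_mult indicator_def)
        have 4: "(\<lambda>x. indicator {c..d} x * (f x - g n x)) \<in> borel_measurable M"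
          using im gd(2)[of n] f by (auto simp: L2_def)
        show ?thesis using L2_mono[OF L2_diff(1)[OF f gd(2)] 4 3] by auto
      qed
      have 2: "(\<lambda>x. indicator {c..d} x * (g n x - G x)) \<in> L2 M \<and>
          L2_norm M (\<lambda>x. indicator {c..d} x * (g n x - G x)) \<le> L2_norm M (\<lambda>x. complex_of_real (C * e n) * indicator {c..d} x)"
      proof -
        have 3: "cmod (indicator {c..d} x * (g n x - G x)) \<le> cmod (complex_of_real (C * e n) * indicator {c..d} x)" for x
          using C(2)[of x n] e0[of n] C(1) by (auto simp: norm_mult indicator_def)
        have 4: "(\<lambda>x. indicator {c..d} x * (g n x - G x)) \<in> borel_measurable M"
          using im gd(2)[of n] Gm by (auto simp: L2_def)
        show ?thesis using L2_mono[OF L2_cmult(1)[OF L2_indicator[OF cd(2)]] 4 3] by auto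
      qed
      have "L2_norm M (\<lambda>x. complex_of_real (C * e n) * indicator {c..d} x) = C * e n * K"
        using L2_cmult(2)[OF L2_indicator[OF cd(2)], of "complex_of_real (C * e n)"] C(1) e0[of n] by (simp add: K_def norm_mult)
      moreover have "L2_norm M (\<lambda>x. f x - g n x) \<le> e n" by (simp add: e_def L2_norm_nonneg)
      moreover have "(\<lambda>x. indicator {c..d} x * (f x - g n x) + indicator {c..d} x * (g n x - G x)) = (\<lambda>x. indicator {c..d} x * (f x - G x))"
        by (auto simp: algebra_simps)
      ultimately show ?thesis using L2_add[OF conjunct1[OF 1] conjunct1[OF 2]] 1 2 by auto
    qed
    have "(\<lambda>n. e n + C * e n * K) \<longlonglongrightarrow> 0 + C * 0 * K" by (intro tendsto_intros e)
    then have "L2_norm M (\<lambda>x. indicator {c..d} x * (f x - G x)) \<le> 0"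
      using LIMSEQ_le_const[of "\<lambda>n. e n + C * e n * K" 0] bound by auto
    then have "L2_norm M (\<lambda>x. indicator {c..d} x * (f x - G x)) = 0"
      using L2_norm_nonneg[of M] by (metis antisym)
    then have "AE x in M. indicator {c..d} x * (f x - G x) = 0" using L2_norm_zero_AE bound by blast
    then have "negligible {x. \<not> (x \<in> I \<longrightarrow> indicator {c..d} x * (f x - G x) = 0)}"
      unfolding AE_M by (rule AE_lebesgue_negligible)
    then show "negligible {x \<in> {c<..<d}. f x \<noteq> G x}"
      by (rule negligible_subset) (use cd in \<open>auto simp: indicator_def subset_iff\<close>)
  qed
  have "G \<in> L2 M" by (rule L2_AE_cong[OF f Gm eq])
  then have "G \<in> dom_max S" using sl_pair_dom_max[OF pairG _ h] by blast
  moreover have "AE x in M. h x = tau S G x" using sl_pair_tau[OF pairG] by eventually_elim simp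
  ultimately show thesis using that eq by blast
qed

text \<open>With $c$ a fixed interior point, $W(v,f)(e)$ is $W(v,f)(c)$ plus an integral of \<open>lagr v f\<close>; the
former is bounded by the interior estimate, the latter by Cauchy--Schwarz.\<close>

lemma wronskian_end_bounded:
  assumes v: "v \<in> dom_max S" and e: "is_end e"
  obtains C where "C \<ge> 0" "\<And>f. f \<in> dom_max S \<Longrightarrow>
    cmod (wronskian_end S v f e) \<le> C * (L2_norm M f + L2_norm M (tau S f))"
proof -
  obtain c where c: "c \<in> I" by (rule I_nonempty)
  then obtain C where C: "C \<ge> 0" "\<And>f f1 h. sl_pair f f1 h \<Longrightarrow> f \<in> L2 M \<Longrightarrow> h \<in> L2 M \<Longrightarrow>
        cmod (f c) \<le> C * (L2_norm M f + L2_norm M h) \<and> cmod (f1 c) \<le> C * (L2_norm M f + L2_norm M h)"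
    using compact_interval_estimate[of c c] unfolding bounded_by_graph_norm_def
    by (metis (no_types, lifting) Icc_subset_I atLeastAtMost_singleton insertI1)
  define B where "B = cmod (v c) + cmod (quasi_deriv S v c)"
  define A where "A = L2_norm M v + L2_norm M (tau S v)"
  have "cmod (wronskian_end S v f e) \<le> (B * C + 2 * A) * (L2_norm M f + L2_norm M (tau S f))"
    if f: "f \<in> dom_max S" for f
  proof -
    define N where "N = L2_norm M f + L2_norm M (tau S f)"
    note vd = dom_max_D[OF v] and fd = dom_max_D[OF f]
    have N: "L2_norm M f \<le> N" "L2_norm M (tau S f) \<le> N" "0 \<le> N" by (simp_all add: N_def L2_norm_nonneg)
    have A: "L2_norm M v \<ge> 0" "L2_norm M (tau S v) \<ge> 0" by (simp_all add: L2_norm_nonneg)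
    have fc: "cmod (f c) \<le> C * N" "cmod (quasi_deriv S f c) \<le> C * N"
      using C(2)[OF fd(1-3)] by (auto simp: N_def)
    have W: "cmod (wronskian S v f c) \<le> B * C * N"
    proof -
      have "cmod (wronskian S v f c) \<le> cmod (v c) * cmod (quasi_deriv S f c) + cmod (quasi_deriv S v c) * cmod (f c)"
        unfolding wronskian_def by (metis norm_mult norm_triangle_ineq4)
      also have "\<dots> \<le> cmod (v c) * (C * N) + cmod (quasi_deriv S v c) * (C * N)"
        using fc by (intro add_mono mult_left_mono) auto
      also have "\<dots> = B * C * N" by (simp add: B_def algebra_simps)
      finally show ?thesis .
    qed
    have L: "(LINT y|M. cmod (lagr v f y)) \<le> A * N"
    proof -
      have i: "integrable M (\<lambda>y. cmod (tau S v y) * cmod (f y))" "integrable M (\<lambda>y. cmod (v y) * cmod (tau S f y))"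
        by (intro L2_mult_integrable(2) vd fd)+
      have "(LINT y|M. cmod (lagr v f y)) \<le> (LINT y|M. cmod (tau S v y) * cmod (f y) + cmod (v y) * cmod (tau S f y))"
      proof (rule integral_mono)
        show "integrable M (\<lambda>y. cmod (lagr v f y))" using integrable_norm[OF lagr_integrable[OF v f]] .
        show "integrable M (\<lambda>y. cmod (tau S v y) * cmod (f y) + cmod (v y) * cmod (tau S f y))" using i by simp
        show "cmod (lagr v f y) \<le> cmod (tau S v y) * cmod (f y) + cmod (v y) * cmod (tau S f y)" for y
          unfolding lagr_def by (metis norm_mult norm_triangle_ineq4)
      qed
      also have "\<dots> = (LINT y|M. cmod (tau S v y) * cmod (f y)) + (LINT y|M. cmod (v y) * cmod (tau S f y))"
        using i by simp
      also have "\<dots> \<le> L2_norm M (tau S v) * L2_norm M f + L2_norm M v * L2_norm M (tau S f)"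
        by (intro add_mono L2_Cauchy_Schwarz vd fd)
      also have "\<dots> \<le> L2_norm M (tau S v) * N + L2_norm M v * N"
        using N A by (intro add_mono mult_left_mono) auto
      finally show ?thesis by (simp add: A_def algebra_simps)
    qed
    have Q: "cmod (cumul v f c) \<le> A * N"
    proof -
      have "cmod (cumul v f c) \<le> (LINT y|M. norm (indicator {..c} y *\<^sub>R lagr v f y))"
        unfolding cumul_def by (rule integral_norm_bound)
      also have "\<dots> \<le> (LINT y|M. cmod (lagr v f y))"
      proof (rule integral_mono)
        show i: "integrable M (\<lambda>y. cmod (lagr v f y))" using integrable_norm[OF lagr_integrable[OF v f]] .
        have "(\<lambda>y. norm (indicator {..c} y *\<^sub>R lagr v f y)) \<in> borel_measurable M"
          by (rule measurable_compose[OF borel_measurable_scaleR[OF atMost_measurable_M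
                borel_measurable_integrable[OF lagr_integrable[OF v f]]] borel_measurable_norm])
        then show "integrable M (\<lambda>y. norm (indicator {..c} y *\<^sub>R lagr v f y))"
          by (rule Bochner_Integration.integrable_bound[OF i]) (auto simp: indicator_def)
      qed (auto simp: indicator_def)
      finally show ?thesis using L by linarith
    qed
    have T: "cmod (LINT y|M. lagr v f y) \<le> A * N"
      using integral_norm_bound[of M "lagr v f"] L by linarith
    have "cmod (wronskian_end S v f e) \<le> B * C * N + A * N + A * N"
    proof (cases "e = rend S")
      case True
      then show ?thesis
        using norm_triangle_ineq[of "wronskian S v f c - cumul v f c" "LINT y|M. lagr v f y"]
          norm_triangle_ineq4[of "wronskian S v f c" "cumul v f c"] W Q T
        by (simp add: wronskian_end_eq(1)[OF v f c])
    next
      case False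
      then have "e = lend S" using e by (simp add: is_end_def)
      moreover have "0 \<le> A * N" using Q norm_ge_zero order_trans by blast
      ultimately show ?thesis
        using norm_triangle_ineq4[of "wronskian S v f c" "cumul v f c"] W Q
        by (simp add: wronskian_end_eq(2)[OF v f c])
    qed
    then show ?thesis by (simp add: N_def algebra_simps)
  qed
  moreover have "B * C + 2 * A \<ge> 0" using C(1) by (simp add: A_def B_def L2_norm_nonneg)
  ultimately show thesis using that by blast
qed

lemma wronskian_end_compact_support:
  assumes v: "v \<in> dom_max S" and g: "g \<in> dom_max S" and e: "is_end e"
    and K: "compact K" "K \<subseteq> I" "\<And>x. x \<in> I - K \<Longrightarrow> g x = 0"
  shows "wronskian_end S v g e = 0"
proof (rule wronskian_end_eqI[OF e v g])
  fix X assume X: "\<And>n. X n \<in> I" "(\<lambda>n. ereal (X n)) \<longlonglongrightarrow> e"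
  have op: "open (I - K)" using open_I K(1) by (intro open_Diff compact_imp_closed)
  have qd0: "quasi_deriv S g x = 0" if x: "x \<in> I - K" for x
  proof (rule AE_eq_continuous_imp_eq[OF op _ _ _ x])
    show "continuous_on (I - K) (quasi_deriv S g)"
      using sl_pair_continuous(2)[OF dom_max_D(1)[OF g]] by (rule continuous_on_subset) auto
    have 1: "primitive_on (I - K) g (\<lambda>x. quasi_deriv S g x / cp x)"
      using dom_max_D(1)[OF g] primitive_on_subset[of I g _ "I - K"] by (auto simp: sl_pair_def)
    have "AE x in lebesgue. x \<in> I - K \<longrightarrow> quasi_deriv S g x / cp x = 0"
      by (rule primitive_on_AE_unique[OF op 1 primitive_on_const[of _ 0]]) (use K in auto)
    then show "AE x in lebesgue. x \<in> I - K \<longrightarrow> quasi_deriv S g x = 0"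
      using p_pos by eventually_elim auto
  qed simp
  have "\<forall>\<^sub>F n in sequentially. X n \<notin> K"
  proof (cases "K = {}")
    case False
    have "compact (ereal ` K)" by (intro compact_continuous_image K continuous_on_ereal continuous_on_id)
    then have "open (- (ereal ` K))" using compact_imp_closed by blast
    moreover have "e \<notin> ereal ` K" using K(2) e by (auto simp: sl_int_def einterval_iff is_end_def)
    ultimately have "\<forall>\<^sub>F n in sequentially. ereal (X n) \<in> - (ereal ` K)"
      using X(2) topological_tendstoD by blast
    then show ?thesis by eventually_elim auto
  qed simp
  then have "\<forall>\<^sub>F n in sequentially. wronskian S v g (X n) = 0"
    by eventually_elim (use X(1) K(3) qd0 in \<open>simp add: wronskian_def\<close>)
  then show "(\<lambda>n. wronskian S v g (X n)) \<longlonglongrightarrow> 0" by (rule tendsto_eventually)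
qed

end

context sl_boundary
begin

text \<open>The functions in $\mathrm{dom}(T_{max})$ whose generalized boundary values all vanish.\<close>

definition D_min :: "(real \<Rightarrow> complex) set" where
  "D_min = {g \<in> dom_max S. bv0 g (lend S) = 0 \<and> bv1 g (lend S) = 0 \<and> bv0 g (rend S) = 0 \<and> bv1 g (rend S) = 0}"

lemma realization_iff:
  assumes "D \<subseteq> dom_max S"
  shows "(f, h) \<in> realization S D \<longleftrightarrow> f \<in> L2 M \<and> h \<in> L2 M \<and>
    (\<exists>g\<in>D. (AE x in M. f x = g x) \<and> (AE x in M. h x = tau S g x))"
  by (simp add: realization_def)

text \<open>Vanishing boundary values persist under limits in the graph norm.\<close>

lemma T_min_subset: "T_min S \<subseteq> realization S D_min"
proof
  let ?Dc = "{g \<in> dom_max S. \<exists>K. compact K \<and> K \<subseteq> I \<and> (\<forall>x\<in>I - K. g x = 0)}"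
  fix fh assume "fh \<in> T_min S"
  then obtain f h where fh: "fh = (f, h)" and f: "f \<in> L2 M" and h: "h \<in> L2 M"
    and cl: "\<And>e. e > 0 \<Longrightarrow> \<exists>(u, v)\<in>realization S ?Dc. L2_norm M (\<lambda>x. f x - u x) < e \<and> L2_norm M (\<lambda>x. h x - v x) < e"
    by (auto simp: T_min_def op_closure_def)
  have ex: "\<exists>g\<in>?Dc. L2_norm M (\<lambda>x. f x - g x) < e \<and> L2_norm M (\<lambda>x. h x - tau S g x) < e" if e: "e > 0" for e
  proof -
    obtain u v where uv: "(u, v) \<in> realization S ?Dc" "L2_norm M (\<lambda>x. f x - u x) < e" "L2_norm M (\<lambda>x. h x - v x) < e"
      using cl[OF e] by blast
    then obtain g where g: "g \<in> ?Dc" "AE x in M. u x = g x" "AE x in M. v x = tau S g x" and "u \<in> L2 M" "v \<in> L2 M"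
      by (auto simp: realization_def)
    have gd: "g \<in> dom_max S" using g by simp
    have "L2_norm M (\<lambda>x. f x - u x) = L2_norm M (\<lambda>x. f x - g x)"
      using f \<open>u \<in> L2 M\<close> dom_max_D(2)[OF gd] g(2) by (intro L2_norm_AE_cong) (auto simp: L2_def)
    moreover have "L2_norm M (\<lambda>x. h x - v x) = L2_norm M (\<lambda>x. h x - tau S g x)"
      using h \<open>v \<in> L2 M\<close> dom_max_D(3)[OF gd] g(3) by (intro L2_norm_AE_cong) (auto simp: L2_def)
    ultimately show ?thesis using uv g by auto
  qed
  have "\<exists>g. g \<in> ?Dc \<and> L2_norm M (\<lambda>x. f x - g x) < inverse (Suc n) \<and> L2_norm M (\<lambda>x. h x - tau S g x) < inverse (Suc n)" for n
  proof -
    have "inverse (real (Suc n)) > 0" by simp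
    from ex[OF this] show ?thesis unfolding Bex_def .
  qed
  from choice[OF allI[OF this]] obtain g where g': "\<forall>n. g n \<in> ?Dc \<and>
      L2_norm M (\<lambda>x. f x - g n x) < inverse (Suc n) \<and> L2_norm M (\<lambda>x. h x - tau S (g n) x) < inverse (Suc n)"
    by (rule exE)
  have g: "g n \<in> ?Dc" "L2_norm M (\<lambda>x. f x - g n x) < inverse (Suc n)"
    "L2_norm M (\<lambda>x. h x - tau S (g n) x) < inverse (Suc n)" for n
    using g'[rule_format, of n] by (simp_all only:)
  have gd: "g n \<in> dom_max S" for n using g(1)[of n] by simp
  have lim: "(\<lambda>n. L2_norm M (\<lambda>x. f x - g n x)) \<longlonglongrightarrow> 0" "(\<lambda>n. L2_norm M (\<lambda>x. h x - tau S (g n) x)) \<longlonglongrightarrow> 0"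
    using g(2,3) by (intro real_tendsto_sandwich[OF _ _ tendsto_const LIMSEQ_inverse_real_of_nat]
        always_eventually; simp add: L2_norm_nonneg less_imp_le del: of_nat_Suc)+
  obtain G where G: "G \<in> dom_max S" "AE x in M. f x = G x" "AE x in M. h x = tau S G x"
    by (rule T_max_closed[OF gd f h lim]) (rule that)
  have W0: "wronskian_end S v G e = 0" if v: "v \<in> dom_max S" and e: "is_end e" for v e
  proof -
    obtain C where C: "C \<ge> 0" "\<And>f. f \<in> dom_max S \<Longrightarrow> cmod (wronskian_end S v f e) \<le> C * (L2_norm M f + L2_norm M (tau S f))"
      by (rule wronskian_end_bounded[OF v e]) (rule that)
    have "cmod (wronskian_end S v G e) \<le> C * (inverse (Suc n) + inverse (Suc n))" for n
    proof -
      let ?d = "\<lambda>x. G x + (- 1) * g n x"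
      have gn: "(\<lambda>x. (- 1) * g n x) \<in> dom_max S" by (rule dom_max_cmult(1)[OF gd])
      have d: "?d \<in> dom_max S" by (rule dom_max_add(1)[OF G(1) gn])
      have "wronskian_end S v (g n) e = 0"
        using g(1)[of n] wronskian_end_compact_support[OF v gd e] by blast
      then have "wronskian_end S v ?d e = wronskian_end S v G e"
        using wronskian_end_add[OF e v G(1) gn] wronskian_end_cmult[OF e v gd, of "-1" n] by simp
      moreover have "L2_norm M ?d = L2_norm M (\<lambda>x. f x - g n x)"
        using G(2) f dom_max_D(2)[OF d] dom_max_D(2)[OF gd[of n]]
        by (intro L2_norm_AE_cong) (auto simp: L2_def elim!: eventually_mono)
      moreover have "L2_norm M (tau S ?d) = L2_norm M (\<lambda>x. h x - tau S (g n) x)"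
      proof (rule L2_norm_AE_cong)
        show "AE x in M. tau S ?d x = h x - tau S (g n) x"
          using G(3) dom_max_add(3)[OF G(1) gn] dom_max_cmult(3)[OF gd, of "-1" n] by eventually_elim simp
      qed (use h dom_max_D(3)[OF d] dom_max_D(3)[OF gd[of n]] in \<open>auto simp: L2_def\<close>)
      ultimately have "cmod (wronskian_end S v G e) \<le> C * (L2_norm M (\<lambda>x. f x - g n x) + L2_norm M (\<lambda>x. h x - tau S (g n) x))"
        using C(2)[OF d] by simp
      also have "\<dots> \<le> C * (inverse (Suc n) + inverse (Suc n))"
        using g(2,3)[of n] C(1) by (intro mult_left_mono add_mono) auto
      finally show ?thesis .
    qed
    moreover have "(\<lambda>n. C * (inverse (Suc n) + inverse (Suc n))) \<longlonglongrightarrow> C * (0 + 0)"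
      by (intro tendsto_intros LIMSEQ_inverse_real_of_nat)
    ultimately have "cmod (wronskian_end S v G e) \<le> 0"
      using LIMSEQ_le_const by fastforce
    then show ?thesis by simp
  qed
  have "G \<in> D_min" using G(1) by (simp add: D_min_def bv_def bv'_def W0)
  then show "fh \<in> realization S D_min" using f h G fh by (auto simp: realization_def)
qed

end

section \<open>Patching solutions across a compact interval\<close>

context sl_problem
begin

lemma primitive_on_indefinite_M:
  fixes k :: "real \<Rightarrow> complex"
  assumes k: "integrable M k"
  shows "primitive_on I (\<lambda>x. LINT y|M. indicator {..x} y *\<^sub>R k y) (\<lambda>x. cr x * k x)"
  unfolding primitive_on_def
proof (intro allI impI)
  fix c d assume cd: "c \<le> (d::real)" "{c..d} \<subseteq> I"
  have s: "set_integrable M {c..d} k"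
    using integrable_mult_indicator[OF Icc_sets_M[OF cd(2)] k] by (simp add: set_integrable_def)
  have "c \<in> I" "d \<in> I" using cd by auto
  then show "(\<lambda>x. cr x * k x) absolutely_integrable_on {c..d} \<and> integral {c..d} (\<lambda>x. cr x * k x) =
      (LINT y|M. indicator {..d} y *\<^sub>R k y) - (LINT y|M. indicator {..c} y *\<^sub>R k y)"
    using set_integral_M[OF s cd(2)] integral_atMost_diff[OF k _ _ cd(1)] by (simp add: scaleR_conv_of_real)
qed

lemma L2_bounded_mult:
  assumes f: "f \<in> L2 M" and k: "k \<in> borel_measurable M" "\<And>x. cmod (k x) \<le> B"
  shows "(\<lambda>x. k x * f x) \<in> L2 M"
proof (rule L2_mono(1)[OF L2_cmult(1)[OF f, of "complex_of_real B"]])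
  show "(\<lambda>x. k x * f x) \<in> borel_measurable M" using f k by (auto simp: L2_def)
  show "cmod (k x * f x) \<le> cmod (complex_of_real B * f x)" for x
    using mult_right_mono[OF k(2)[of x], of "cmod (f x)"] order_trans[OF norm_ge_zero k(2)[of x]]
    by (simp add: norm_mult)
qed

lemma Cauchy_data_zero_of_integral_zero:
  assumes u: "u \<in> dom_max S" and cd: "{c..d} \<subseteq> I"
    and z: "(LINT x:{c..d}|M. u x * cnj (u x)) = 0" and x: "x \<in> {c<..<d}"
  shows "u x = 0" "quasi_deriv S u x = 0"
proof -
  have op: "open {c<..<d}" by simp
  have sub: "{c<..<d} \<subseteq> I" using cd by auto
  have uc: "continuous_on I u" using dom_max_D(4)[OF u] .
  have eq: "u x * cnj (u x) = complex_of_real ((cmod (u x))\<^sup>2)" for x by (rule complex_norm_square[symmetric])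
  have s: "set_integrable M {c..d} (\<lambda>x. (cmod (u x))\<^sup>2)"
    by (intro set_integrable_M_continuous[OF _ cd] continuous_on_power continuous_on_norm uc)
  have "complex_of_real (LINT x:{c..d}|M. (cmod (u x))\<^sup>2) = 0"
    using z unfolding eq by (simp only: set_integral_complex_of_real)
  then have z': "(LINT x|M. indicator {c..d} x *\<^sub>R (cmod (u x))\<^sup>2) = 0" by (simp add: set_lebesgue_integral_def)
  have "AE x in M. indicator {c..d} x *\<^sub>R (cmod (u x))\<^sup>2 = 0"
    using integral_nonneg_eq_0_iff_AE[of M "\<lambda>x. indicator {c..d} x *\<^sub>R (cmod (u x))\<^sup>2"] s z'
    by (auto simp: set_integrable_def)
  then have "AE x in lebesgue. x \<in> {c<..<d} \<longrightarrow> u x = 0"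
    unfolding AE_M by eventually_elim (use sub in \<open>auto simp: indicator_def split: if_splits\<close>)
  then have u0: "u x = 0" if "x \<in> {c<..<d}" for x
    using that uc sub by (intro AE_eq_continuous_imp_eq[OF op _ _ _ that]) (auto intro: continuous_on_subset)
  then show "u x = 0" using x .
  show "quasi_deriv S u x = 0"
  proof (rule AE_eq_continuous_imp_eq[OF op _ _ _ x])
    show "continuous_on {c<..<d} (quasi_deriv S u)"
      using sl_pair_continuous(2)[OF dom_max_D(1)[OF u]] sub by (rule continuous_on_subset)
    have 1: "primitive_on {c<..<d} u (\<lambda>x. quasi_deriv S u x / cp x)"
      using dom_max_D(1)[OF u] primitive_on_subset[OF _ sub] by (auto simp: sl_pair_def)
    have "AE x in lebesgue. x \<in> {c<..<d} \<longrightarrow> quasi_deriv S u x / cp x = 0"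
      by (rule primitive_on_AE_unique[OF op 1 primitive_on_const[of _ 0]]) (rule u0)
    then show "AE x in lebesgue. x \<in> {c<..<d} \<longrightarrow> quasi_deriv S u x = 0"
      using p_pos by eventually_elim (use sub in auto)
  qed simp
qed

text \<open>The Gram determinant of $v$ and $w$ in $L^2([c,d]; r\,dx)$.  If it were zero, the combination
$(w,w)v - (v,w)w$, with $(f,g)$ the integral of $f\overline g$, would vanish on $[c,d]$ together with its quasi-derivative, which is
incompatible with a nonzero Wronskian.\<close>

lemma gram_det_nonzero:
  assumes v: "v \<in> dom_max S" and w: "w \<in> dom_max S" and cd: "c < d" "{c..d} \<subseteq> I"
    and W: "\<And>x. x \<in> {c..d} \<Longrightarrow> wronskian S v w x \<noteq> 0"
  defines "ip \<equiv> \<lambda>f g. LINT x:{c..d}|M. f x * cnj (g x)"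
  shows "ip w w * ip v v \<noteq> ip w v * ip v w"
proof
  assume eq: "ip w w * ip v v = ip w v * ip v w"
  obtain x where x: "x \<in> {c<..<d}" using dense[OF cd(1)] by auto
  have fin: "set_integrable M {c..d} (\<lambda>x. f x * cnj (g x))" if "f \<in> dom_max S" "g \<in> dom_max S" for f g
    using dom_max_D(4)[OF that(1)] dom_max_D(4)[OF that(2)]
    by (intro set_integrable_M_continuous[OF _ cd(2)] continuous_intros)
  have herm: "cnj (ip f g) = ip g f" for f g
  proof -
    have "cnj (ip f g) = (LINT x|M. cnj (indicator {c..d} x *\<^sub>R (f x * cnj (g x))))"
      unfolding ip_def set_lebesgue_integral_def by (rule Bochner_Integration.integral_cnj[symmetric])
    also have "\<dots> = ip g f"
      unfolding ip_def set_lebesgue_integral_def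
      by (rule Bochner_Integration.integral_cong) (simp_all add: mult.commute scaleR_conv_of_real)
    finally show ?thesis .
  qed
  have wv: "ip w v = cnj (ip v w)" and ww: "cnj (ip w w) = ip w w" by (simp_all only: herm)
  have ww0: "ip w w \<noteq> 0"
  proof
    assume "ip w w = 0"
    then have "w x = 0" "quasi_deriv S w x = 0"
      using Cauchy_data_zero_of_integral_zero[OF w cd(2) _ x] by (auto simp: ip_def)
    then show False using W[of x] x by (simp add: wronskian_def)
  qed
  let ?D = "ip w w" and ?E = "- ip v w"
  let ?u = "\<lambda>x. ?D * v x + ?E * w x"
  have u: "?u \<in> dom_max S" by (intro dom_max_add(1) dom_max_cmult(1) v w)
  have "(LINT x:{c..d}|M. ?u x * cnj (?u x)) =
      (LINT x:{c..d}|M. ?D * cnj ?D * (v x * cnj (v x)) + ?D * cnj ?E * (v x * cnj (w x))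
        + (?E * cnj ?D * (w x * cnj (v x)) + ?E * cnj ?E * (w x * cnj (w x))))"
    by (simp add: algebra_simps)
  also have "\<dots> = ?D * cnj ?D * ip v v + ?D * cnj ?E * ip v w + (?E * cnj ?D * ip w v + ?E * cnj ?E * ip w w)"
    using fin v w by (simp add: set_integral_add set_integral_mult_right ip_def)
  also have "\<dots> = ?D * (ip w w * ip v v - ip w v * ip v w)"
    unfolding complex_cnj_minus ww by (simp add: wv algebra_simps)
  finally have "(LINT x:{c..d}|M. ?u x * cnj (?u x)) = 0" using eq by simp
  from Cauchy_data_zero_of_integral_zero[OF u cd(2) this x]
  moreover have "quasi_deriv S ?u x = ?D * quasi_deriv S v x + ?E * quasi_deriv S w x"
  proof -
    have "x \<in> I" using x cd(2) by auto
    then show ?thesis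
      using dom_max_add(2)[OF dom_max_cmult(1)[OF v] dom_max_cmult(1)[OF w]] dom_max_cmult(2)[OF v]
        dom_max_cmult(2)[OF w] by (simp only:)
  qed
  ultimately have u0: "?D * v x = ip v w * w x" "?D * quasi_deriv S v x = ip v w * quasi_deriv S w x"
    by simp_all
  have "?D * wronskian S v w x = (?D * v x) * quasi_deriv S w x - (?D * quasi_deriv S v x) * w x"
    by (simp add: wronskian_def algebra_simps)
  also have "\<dots> = 0" unfolding u0 by simp
  finally show False using ww0 W[of x] x by simp
qed

text \<open>For $v, w$ with nonzero Wronskian on $[c,d]$, there is a $y \in \mathrm{dom}(T_{max})$ equal to
$0$ to the left of $[c,d]$ and to $Av + Bw$ to the right.  Varying constants,
$y = \alpha v + \beta w$ with $\alpha' = r w k$ and $\beta' = -r v k$ on $[c,d]$; then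
$\alpha' v + \beta' w = 0$, so $y^{[1]} = \alpha v^{[1]} + \beta w^{[1]}$ and $y$ is regular.
The function $k$ is sought in the span of $\overline v, \overline w$, and the requirement
$\alpha = A$, $\beta = B$ at $d$ is a linear system whose determinant is, up to sign, the Gram
determinant.\<close>

lemma patching:
  assumes v: "v \<in> dom_max S" and w: "w \<in> dom_max S" and cd: "c < d" "{c..d} \<subseteq> I"
    and W: "\<And>x. x \<in> {c..d} \<Longrightarrow> wronskian S v w x \<noteq> 0"
  obtains y where "y \<in> dom_max S" "\<And>x. x \<in> I \<Longrightarrow> x < c \<Longrightarrow> y x = 0"
    "\<And>x. x \<in> I \<Longrightarrow> d \<le> x \<Longrightarrow> y x = A * v x + B * w x"
proof -
  define ip where "ip f g = (LINT x:{c..d}|M. f x * cnj (g x))" for f g :: "real \<Rightarrow> complex"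
  define \<Delta> where "\<Delta> = ip w w * ip v v - ip w v * ip v w"
  have \<Delta>: "\<Delta> \<noteq> 0" using gram_det_nonzero[OF v w cd W] by (simp add: \<Delta>_def ip_def)
  \<comment> \<open>The solution of the system \<open>ab\<close> by Cramer's rule.\<close>
  define a where "a = - (A * ip v w + B * ip w w) / \<Delta>"
  define b where "b = (A * ip v v + B * ip w v) / \<Delta>"
  have ab: "a * ip w v + b * ip w w = A" "a * ip v v + b * ip v w = - B"
    using \<Delta> unfolding a_def b_def by (simp_all add: field_simps) (simp_all add: \<Delta>_def algebra_simps)
  define k where "k x = a * cnj (v x) + b * cnj (w x)" for x
  note vc = dom_max_D(4)[OF v] and wc = dom_max_D(4)[OF w]
  have kc: "continuous_on I k" unfolding k_def by (intro continuous_intros vc wc)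
  have fin: "set_integrable M {c..d} (\<lambda>x. f x * g x)" if "continuous_on I f" "continuous_on I g" for f g :: "real \<Rightarrow> complex"
    using that by (intro set_integrable_M_continuous[OF _ cd(2)] continuous_intros)
  define \<alpha>' where "\<alpha>' x = indicator {c..d} x *\<^sub>R (w x * k x)" for x
  define \<beta>' where "\<beta>' x = indicator {c..d} x *\<^sub>R (- v x * k x)" for x
  have i: "integrable M \<alpha>'" "integrable M \<beta>'"
    using fin[OF wc kc] fin[OF continuous_on_minus[OF vc] kc]
    by (simp_all add: \<alpha>'_def[abs_def] \<beta>'_def[abs_def] set_integrable_def)
  define \<alpha> where "\<alpha> x = (LINT y|M. indicator {..x} y *\<^sub>R \<alpha>' y)" for x
  define \<beta> where "\<beta> x = (LINT y|M. indicator {..x} y *\<^sub>R \<beta>' y)" for x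
  have pr: "primitive_on I \<alpha> (\<lambda>x. cr x * \<alpha>' x)" "primitive_on I \<beta> (\<lambda>x. cr x * \<beta>' x)"
    unfolding \<alpha>_def[abs_def] \<beta>_def[abs_def] by (intro primitive_on_indefinite_M i)+
  have low: "\<alpha> x = 0" "\<beta> x = 0" if "x < c" for x
  proof -
    have z: "indicator {..x} y *\<^sub>R \<alpha>' y = 0" "indicator {..x} y *\<^sub>R \<beta>' y = 0" for y
      using that by (auto simp: \<alpha>'_def \<beta>'_def indicator_def)
    show "\<alpha> x = 0" "\<beta> x = 0" unfolding \<alpha>_def \<beta>_def z by simp_all
  qed
  have high: "\<alpha> x = A" "\<beta> x = B" if "d \<le> x" for x
  proof -
    have e: "indicator {..x} y *\<^sub>R \<alpha>' y = \<alpha>' y" "indicator {..x} y *\<^sub>R \<beta>' y = \<beta>' y" for y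
      using that by (auto simp: \<alpha>'_def \<beta>'_def indicator_def)
    have fin': "set_integrable M {c..d} (\<lambda>x. f x * cnj (g x))" if "continuous_on I f" "continuous_on I g" for f g
      using that by (intro fin continuous_intros)
    have "\<alpha> x = (LINT x:{c..d}|M. w x * k x)" unfolding \<alpha>_def e by (simp add: \<alpha>'_def set_lebesgue_integral_def)
    also have "\<dots> = (LINT x:{c..d}|M. a * (w x * cnj (v x)) + b * (w x * cnj (w x)))"
      by (simp add: k_def algebra_simps)
    also have "\<dots> = a * ip w v + b * ip w w"
      using fin' vc wc by (simp add: set_integral_add set_integral_mult_right ip_def)
    finally show "\<alpha> x = A" using ab by simp
    have "\<beta> x = (LINT x:{c..d}|M. - v x * k x)" unfolding \<beta>_def e by (simp add: \<beta>'_def set_lebesgue_integral_def)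
    also have "\<dots> = (LINT x:{c..d}|M. (- a) * (v x * cnj (v x)) + (- b) * (v x * cnj (w x)))"
      by (simp add: k_def algebra_simps)
    also have "\<dots> = (- a) * ip v v + (- b) * ip v w"
      using fin' vc wc by (simp only: set_integral_add set_integral_mult_right ip_def set_integrable_mult_right)
    finally show "\<beta> x = B" using ab(2) by (simp add: algebra_simps eq_neg_iff_add_eq_0)
  qed
  have bound: "cmod (\<alpha> x) \<le> (LINT y|M. cmod (\<alpha>' y))" "cmod (\<beta> x) \<le> (LINT y|M. cmod (\<beta>' y))" for x
  proof -
    have "cmod (LINT y|M. indicator {..x} y *\<^sub>R K y) \<le> (LINT y|M. cmod (K y))" if K: "integrable M K" for K :: "real \<Rightarrow> complex"
    proof (rule order_trans[OF integral_norm_bound], rule integral_mono)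
      have "(\<lambda>y. norm (indicator {..x} y *\<^sub>R K y)) \<in> borel_measurable M"
        by (rule measurable_compose[OF borel_measurable_scaleR[OF atMost_measurable_M
              borel_measurable_integrable[OF K]] borel_measurable_norm])
      then show "integrable M (\<lambda>y. norm (indicator {..x} y *\<^sub>R K y))"
        by (rule Bochner_Integration.integrable_bound[OF integrable_norm[OF K]]) (auto simp: indicator_def)
      show "integrable M (\<lambda>y. cmod (K y))" by (rule integrable_norm[OF K])
    qed (auto simp: indicator_def)
    then show "cmod (\<alpha> x) \<le> (LINT y|M. cmod (\<alpha>' y))" "cmod (\<beta> x) \<le> (LINT y|M. cmod (\<beta>' y))"
      using i by (auto simp: \<alpha>_def \<beta>_def)
  qed
  define v1 where "v1 = quasi_deriv S v"
  define w1 where "w1 = quasi_deriv S w"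
  have vp: "sl_pair v v1 (tau S v)" and wp: "sl_pair w w1 (tau S w)"
    using dom_max_D(1)[OF v] dom_max_D(1)[OF w] by (auto simp: v1_def w1_def)
  define y where "y x = \<alpha> x * v x + \<beta> x * w x" for x
  define y1 where "y1 x = \<alpha> x * v1 x + \<beta> x * w1 x" for x
  define h where "h x = \<alpha> x * tau S v x + \<beta> x * tau S w x + indicator {c..d} x *\<^sub>R (k x * (v x * w1 x - v1 x * w x))" for x
  have pair: "sl_pair y y1 h"
    unfolding sl_pair_def
  proof
    have "primitive_on I y (\<lambda>x. (\<alpha> x * (v1 x / cp x) + cr x * \<alpha>' x * v x) + (\<beta> x * (w1 x / cp x) + cr x * \<beta>' x * w x))"
      unfolding y_def[abs_def] using vp wp
      by (intro primitive_on_add primitive_on_mult open_I pr) (auto simp: sl_pair_def)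
    then show "primitive_on I y (\<lambda>x. y1 x / cp x)"
      by (rule primitive_on_cong)
         (auto simp: y1_def \<alpha>'_def \<beta>'_def add_divide_distrib scaleR_conv_of_real algebra_simps)
    have "primitive_on I y1 (\<lambda>x. (\<alpha> x * (cq x * v x - cr x * tau S v x) + cr x * \<alpha>' x * v1 x) +
        (\<beta> x * (cq x * w x - cr x * tau S w x) + cr x * \<beta>' x * w1 x))"
      unfolding y1_def[abs_def] using vp wp
      by (intro primitive_on_add primitive_on_mult open_I pr) (auto simp: sl_pair_def)
    then show "primitive_on I y1 (\<lambda>x. cq x * y x - cr x * h x)"
      by (rule primitive_on_cong)
         (auto simp: y_def h_def \<alpha>'_def \<beta>'_def scaleR_conv_of_real algebra_simps)
  qed
  have m: "\<alpha> \<in> borel_measurable M" "\<beta> \<in> borel_measurable M"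
    using pr primitive_on_continuous_on[OF open_I] continuous_measurable_M by blast+
  have "y \<in> L2 M"
    unfolding y_def[abs_def] by (intro L2_add(1) L2_bounded_mult[OF _ m(1) bound(1)] L2_bounded_mult[OF _ m(2) bound(2)] dom_max_D(2) v w)
  moreover have "h \<in> L2 M"
  proof -
    let ?c = "\<lambda>x. k x * (v x * w1 x - v1 x * w x)"
    have c: "continuous_on I ?c"
      using kc vc wc sl_pair_continuous(2)[OF vp] sl_pair_continuous(2)[OF wp] by (intro continuous_intros)
    have "set_integrable M {c..d} (\<lambda>x. (cmod (?c x))\<^sup>2)"
      by (intro set_integrable_M_continuous[OF _ cd(2)] continuous_on_power continuous_on_norm c)
    moreover have "(cmod (indicator {c..d} x *\<^sub>R ?c x))\<^sup>2 = indicator {c..d} x *\<^sub>R (cmod (?c x))\<^sup>2" for x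
      by (auto simp: indicator_def)
    moreover have "(\<lambda>x. indicator {c..d} x *\<^sub>R ?c x) \<in> borel_measurable M"
      using borel_measurable_integrable[OF set_integrable_M_continuous[OF c cd(2), unfolded set_integrable_def]] .
    ultimately have "(\<lambda>x. indicator {c..d} x *\<^sub>R ?c x) \<in> L2 M" by (simp add: L2_def set_integrable_def)
    then show ?thesis unfolding h_def[abs_def]
      by (intro L2_add(1) L2_bounded_mult[OF _ m(1) bound(1)] L2_bounded_mult[OF _ m(2) bound(2)] dom_max_D(3) v w)
  qed
  ultimately have "y \<in> dom_max S" using sl_pair_dom_max[OF pair] by blast
  moreover have "y x = 0" if "x < c" for x using low[OF that] by (simp add: y_def)
  moreover have "y x = A * v x + B * w x" if "d \<le> x" for x using high[OF that] by (simp add: y_def)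
  ultimately show thesis using that by blast
qed

end

context sl_boundary
begin

text \<open>Cut-offs of $v_1$ and $v_2$, which equal $v_1$, $v_2$ near $b$ and $0$ near $a$.  The patching
takes place around a point near $b$, where the Wronskian of $v_1$ and $v_2$ is close to $1$.\<close>

lemma transition_functions:
  "\<exists>c\<in>I. \<exists>d\<in>I. \<exists>P1\<in>dom_max S. \<exists>P2\<in>dom_max S. (\<forall>x\<in>I. x < c \<longrightarrow> P1 x = 0 \<and> P2 x = 0) \<and>
    (\<forall>x\<in>I. d \<le> x \<longrightarrow> P1 x = v1 x \<and> P2 x = v2 x)"
proof -
  obtain X where X: "\<And>n. X n \<in> I" "(\<lambda>n. ereal (X n)) \<longlonglongrightarrow> rend S"
    by (rule end_sequence[OF is_end(2)]) (rule that)
  have lim: "(\<lambda>n. wronskian S v1 v2 (X n)) \<longlonglongrightarrow> 1"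
    using wronskian_end_tendsto[OF v_dom is_end(2) X] wronskian_end_v[OF is_end(2)] by simp
  have "\<exists>n. wronskian S v1 v2 (X n) \<noteq> 0"
  proof (rule ccontr)
    assume "\<nexists>n. wronskian S v1 v2 (X n) \<noteq> 0"
    then have "(\<lambda>n. wronskian S v1 v2 (X n)) \<longlonglongrightarrow> 0" by simp
    then show False using LIMSEQ_unique[OF lim] by fastforce
  qed
  then obtain t where t: "t \<in> I" "wronskian S v1 v2 t \<noteq> 0" using X(1) by blast
  have Wc: "continuous_on I (wronskian S v1 v2)"
    unfolding wronskian_def[abs_def]
    using sl_pair_continuous[OF dom_max_D(1)[OF v_dom(1)]] sl_pair_continuous[OF dom_max_D(1)[OF v_dom(2)]]
    by (intro continuous_intros)
  have "open (wronskian S v1 v2 -` (- {0}) \<inter> I)"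
    using continuous_on_open_vimage[OF open_I, THEN iffD1, OF Wc, rule_format, of "- {0}"] by auto
  then obtain e where e: "e > 0" "cball t e \<subseteq> wronskian S v1 v2 -` (- {0}) \<inter> I"
    using t open_contains_cball by (metis (no_types, lifting) ComplI IntI singletonD vimageI)
  let ?c = "t - e" and ?d = "t + e"
  have sub: "{?c..?d} \<subseteq> wronskian S v1 v2 -` (- {0}) \<inter> I" using e(2) by (simp add: cball_eq_atLeastAtMost)
  have cd: "?c < ?d" "{?c..?d} \<subseteq> I" using e sub by auto
  have W: "wronskian S v1 v2 x \<noteq> 0" if "x \<in> {?c..?d}" for x using sub that by blast
  obtain P1 where P1: "P1 \<in> dom_max S" "\<And>x. x \<in> I \<Longrightarrow> x < ?c \<Longrightarrow> P1 x = 0"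
    "\<And>x. x \<in> I \<Longrightarrow> ?d \<le> x \<Longrightarrow> P1 x = 1 * v1 x + 0 * v2 x"
  proof (rule patching[OF v_dom cd W, of 1 0])
    show "x \<in> {?c..?d}" if "x \<in> {?c..?d}" for x by (rule that)
  qed (rule that)
  obtain P2 where P2: "P2 \<in> dom_max S" "\<And>x. x \<in> I \<Longrightarrow> x < ?c \<Longrightarrow> P2 x = 0"
    "\<And>x. x \<in> I \<Longrightarrow> ?d \<le> x \<Longrightarrow> P2 x = 0 * v1 x + 1 * v2 x"
  proof (rule patching[OF v_dom cd W, of 0 1])
    show "x \<in> {?c..?d}" if "x \<in> {?c..?d}" for x by (rule that)
  qed (rule that)
  have "?c \<in> I" "?d \<in> I" using cd by auto
  moreover have "\<forall>x\<in>I. x < ?c \<longrightarrow> P1 x = 0 \<and> P2 x = 0" using P1(2) P2(2) by blast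
  moreover have "\<forall>x\<in>I. ?d \<le> x \<longrightarrow> P1 x = v1 x \<and> P2 x = v2 x" using P1(3) P2(3) by simp
  ultimately show ?thesis using P1(1) P2(1) by blast
qed

end

section \<open>The minimal operator is given by vanishing boundary values\<close>

context sl_boundary
begin

lemma L2_tail_tendsto_zero:
  assumes f: "f \<in> L2 M" and m: "\<And>n. {x. \<theta> n x} \<inter> I \<in> sets M"
    and ev: "\<And>x. x \<in> I \<Longrightarrow> \<forall>\<^sub>F n in sequentially. \<not> \<theta> n x"
  shows "\<And>n. (\<lambda>x. if \<theta> n x then f x else 0) \<in> L2 M"
    "(\<lambda>n. L2_norm M (\<lambda>x. if \<theta> n x then f x else 0)) \<longlonglongrightarrow> 0"
proof -
  have fm: "f \<in> borel_measurable M" using f by (simp add: L2_def)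
  have meas: "(\<lambda>x. if \<theta> n x then f x else 0) \<in> borel_measurable M" for n
  proof (rule measurable_If[OF fm])
    have "{x \<in> space M. \<theta> n x} = {x. \<theta> n x} \<inter> I" by (auto simp: space_M)
    then show "{x \<in> space M. \<theta> n x} \<in> sets M" using m by simp
  qed simp
  show "(\<lambda>x. if \<theta> n x then f x else 0) \<in> L2 M" for n
    by (rule L2_mono(1)[OF f meas]) auto
  have "(\<lambda>n. LINT x|M. (cmod (if \<theta> n x then f x else 0))\<^sup>2) \<longlonglongrightarrow> (LINT x|M. 0)"
  proof (rule integral_dominated_convergence[where w = "\<lambda>x. (cmod (f x))\<^sup>2"])
    show "integrable M (\<lambda>x. (cmod (f x))\<^sup>2)" using f by (simp add: L2_def)
    show "(\<lambda>x. (cmod (if \<theta> n x then f x else 0))\<^sup>2) \<in> borel_measurable M" for n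
      using meas by (intro borel_measurable_power measurable_compose[OF meas borel_measurable_norm])
    show "AE x in M. (\<lambda>n. (cmod (if \<theta> n x then f x else 0))\<^sup>2) \<longlonglongrightarrow> 0"
    proof (rule AE_I2)
      fix x assume "x \<in> space M"
      then have "\<forall>\<^sub>F n in sequentially. \<not> \<theta> n x" using ev by (simp add: space_M)
      then show "(\<lambda>n. (cmod (if \<theta> n x then f x else 0))\<^sup>2) \<longlonglongrightarrow> 0"
        by (intro tendsto_eventually) (erule eventually_mono, simp)
    qed
  qed auto
  then show "(\<lambda>n. L2_norm M (\<lambda>x. if \<theta> n x then f x else 0)) \<longlonglongrightarrow> 0"
    using tendsto_real_sqrt[of _ 0] unfolding L2_norm_def by fastforce
qed

text \<open>One step of the truncation at the endpoint $e$; \<open>\<theta> n\<close> describes the points between $x_n$ and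
$e$.  Beyond $x_n$, adding the remainder $R$ replaces $g$ by
$\alpha(v_1 - P_1) + \beta(v_2 - P_2)$, where $\alpha v_1 + \beta v_2$ agrees with $g$ to first
order at $x_n$; before $x_n$, the term $-\alpha P_1 - \beta P_2$ is added.  Both endpoints are
covered, with the regularity of cut-offs as the hypothesis \<open>cut\<close>.  Since the boundary values of
$g$ at $e$ vanish, $\alpha$ and $\beta$ tend to $0$.\<close>

lemma truncation:
  assumes e: "is_end e" and g: "g \<in> dom_max S" and z: "bv0 g e = 0" "bv1 g e = 0"
    and X: "\<And>n. X n \<in> I" "(\<lambda>n. ereal (X n)) \<longlonglongrightarrow> e"
    and m: "\<And>n. {x. \<theta> n x} \<inter> I \<in> sets M"
    and ev: "\<And>x. x \<in> I \<Longrightarrow> \<forall>\<^sub>F n in sequentially. \<not> \<theta> n x"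
    and cut: "\<And>n D D1 h. sl_pair D D1 h \<Longrightarrow> D (X n) = 0 \<Longrightarrow> D1 (X n) = 0 \<Longrightarrow>
      sl_pair (\<lambda>x. if \<theta> n x then D x else 0) (\<lambda>x. if \<theta> n x then D1 x else 0) (\<lambda>x. if \<theta> n x then h x else 0)"
    and P: "P1 \<in> dom_max S" "P2 \<in> dom_max S" and \<epsilon>: "\<epsilon> > 0"
  obtains n \<alpha> \<beta> R where "R \<in> dom_max S" "L2_norm M R < \<epsilon>" "L2_norm M (tau S R) < \<epsilon>"
    "\<And>x. R x = \<alpha> * ((if \<theta> n x then v1 x else 0) - P1 x) + \<beta> * ((if \<theta> n x then v2 x else 0) - P2 x)
      - (if \<theta> n x then g x else 0)"
proof -
  define W where "W = wronskian S v1 v2"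
  define \<alpha> where "\<alpha> n = wronskian S g v2 (X n) / W (X n)" for n
  define \<beta> where "\<beta> n = wronskian S v1 g (X n) / W (X n)" for n
  note lim = wronskian_end_tendsto[OF _ _ e X]
  have W1: "(\<lambda>n. W (X n)) \<longlonglongrightarrow> 1"
    using lim[OF v_dom] wronskian_end_v[OF e] by (simp add: W_def)
  have W0: "\<forall>\<^sub>F n in sequentially. W (X n) \<noteq> 0"
    using tendsto_imp_eventually_ne[OF W1] by simp
  have anti: "wronskian S g v2 x = - wronskian S v2 g x" for x by (simp add: wronskian_def)
  have "(\<lambda>n. wronskian S v2 g (X n)) \<longlonglongrightarrow> 0" "(\<lambda>n. wronskian S v1 g (X n)) \<longlonglongrightarrow> 0"
    using lim[OF v_dom(2) g] lim[OF v_dom(1) g] z by (simp_all add: bv_def bv'_def)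
  then have "(\<lambda>n. - wronskian S v2 g (X n) / W (X n)) \<longlonglongrightarrow> - 0 / 1" "(\<lambda>n. wronskian S v1 g (X n) / W (X n)) \<longlonglongrightarrow> 0 / 1"
    using W1 by (intro tendsto_divide tendsto_minus; simp)+
  then have ab: "\<alpha> \<longlonglongrightarrow> 0" "\<beta> \<longlonglongrightarrow> 0"
    unfolding \<alpha>_def \<beta>_def anti by simp_all
  define cutf where "cutf n f x = (if \<theta> n x then f x else 0)" for n and f :: "real \<Rightarrow> complex" and x
  define R where "R n x = \<alpha> n * (cutf n v1 x - P1 x) + \<beta> n * (cutf n v2 x - P2 x) - cutf n g x" for n x
  define Q where "Q n x = \<alpha> n * (cutf n (tau S v1) x - tau S P1 x) + \<beta> n * (cutf n (tau S v2) x - tau S P2 x) - cutf n (tau S g) x" for n x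
  have cutL2: "cutf n f \<in> L2 M" "(\<lambda>n. L2_norm M (cutf n f)) \<longlonglongrightarrow> 0" if "f \<in> L2 M" for f n
    using L2_tail_tendsto_zero[OF that m ev] by (simp_all add: cutf_def[abs_def])
  have small: "(\<lambda>n. L2_norm M (\<lambda>x. \<alpha> n * (cutf n a x - pa x) + \<beta> n * (cutf n b x - pb x) - cutf n c x)) \<longlonglongrightarrow> 0"
    if L: "a \<in> L2 M" "b \<in> L2 M" "c \<in> L2 M" "pa \<in> L2 M" "pb \<in> L2 M" for a b c pa pb
  proof (rule real_tendsto_sandwich[OF always_eventually always_eventually tendsto_const])
    show "\<forall>n. 0 \<le> L2_norm M (\<lambda>x. \<alpha> n * (cutf n a x - pa x) + \<beta> n * (cutf n b x - pb x) - cutf n c x)"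
      by (simp add: L2_norm_nonneg)
    show "\<forall>n. L2_norm M (\<lambda>x. \<alpha> n * (cutf n a x - pa x) + \<beta> n * (cutf n b x - pb x) - cutf n c x) \<le>
        cmod (\<alpha> n) * (L2_norm M (cutf n a) + L2_norm M pa) + cmod (\<beta> n) * (L2_norm M (cutf n b) + L2_norm M pb)
          + L2_norm M (cutf n c)"
    proof
      fix n
      note A = L2_diff[OF cutL2(1)[OF L(1)] L(4), of n] and B = L2_diff[OF cutL2(1)[OF L(2)] L(5), of n]
      have "L2_norm M (\<lambda>x. \<alpha> n * (cutf n a x - pa x)) \<le> cmod (\<alpha> n) * (L2_norm M (cutf n a) + L2_norm M pa)"
        unfolding L2_cmult(2)[OF A(1)] by (rule mult_left_mono[OF A(2)]) simp
      moreover have "L2_norm M (\<lambda>x. \<beta> n * (cutf n b x - pb x)) \<le> cmod (\<beta> n) * (L2_norm M (cutf n b) + L2_norm M pb)"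
        unfolding L2_cmult(2)[OF B(1)] by (rule mult_left_mono[OF B(2)]) simp
      moreover note L2_add[OF L2_cmult(1)[OF A(1)] L2_cmult(1)[OF B(1)], of "\<alpha> n" "\<beta> n"]
      moreover note L2_diff(2)[OF L2_add(1)[OF L2_cmult(1)[OF A(1)] L2_cmult(1)[OF B(1)], of "\<alpha> n" "\<beta> n"] cutL2(1)[OF L(3)], of n]
      ultimately show "L2_norm M (\<lambda>x. \<alpha> n * (cutf n a x - pa x) + \<beta> n * (cutf n b x - pb x) - cutf n c x) \<le>
        cmod (\<alpha> n) * (L2_norm M (cutf n a) + L2_norm M pa) + cmod (\<beta> n) * (L2_norm M (cutf n b) + L2_norm M pb)
          + L2_norm M (cutf n c)" by linarith
    qed
    have "(\<lambda>n. cmod (\<alpha> n) * (L2_norm M (cutf n a) + L2_norm M pa) + cmod (\<beta> n) * (L2_norm M (cutf n b) + L2_norm M pb)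
          + L2_norm M (cutf n c)) \<longlonglongrightarrow> cmod 0 * (0 + L2_norm M pa) + cmod 0 * (0 + L2_norm M pb) + 0"
      by (intro tendsto_intros ab cutL2(2) L)
    then show "(\<lambda>n. cmod (\<alpha> n) * (L2_norm M (cutf n a) + L2_norm M pa) + cmod (\<beta> n) * (L2_norm M (cutf n b) + L2_norm M pb)
          + L2_norm M (cutf n c)) \<longlonglongrightarrow> 0" by simp
  qed
  have Rs: "(\<lambda>n. L2_norm M (R n)) \<longlonglongrightarrow> 0" "(\<lambda>n. L2_norm M (Q n)) \<longlonglongrightarrow> 0"
    unfolding R_def[abs_def] Q_def[abs_def] by (intro small dom_max_D(2,3) v_dom g P)+
  have pair: "sl_pair (R n) (\<lambda>x. \<alpha> n * (cutf n (quasi_deriv S v1) x - quasi_deriv S P1 x)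
      + \<beta> n * (cutf n (quasi_deriv S v2) x - quasi_deriv S P2 x) - cutf n (quasi_deriv S g) x) (Q n)"
    if n: "W (X n) \<noteq> 0" for n
  proof -
    note pairs = dom_max_D(1)[OF g] dom_max_D(1)[OF v_dom(1)] dom_max_D(1)[OF v_dom(2)]
    let ?D = "\<lambda>x. (\<alpha> n * v1 x + \<beta> n * v2 x) + (- 1) * g x"
    let ?D1 = "\<lambda>x. (\<alpha> n * quasi_deriv S v1 x + \<beta> n * quasi_deriv S v2 x) + (- 1) * quasi_deriv S g x"
    let ?h = "\<lambda>x. (\<alpha> n * tau S v1 x + \<beta> n * tau S v2 x) + (- 1) * tau S g x"
    have D: "sl_pair ?D ?D1 ?h" by (intro sl_pair_add sl_pair_cmult pairs)
    \<comment> \<open>Cramer's rule for the coefficients of \<open>g\<close> and its quasi-derivative with respect to \<open>v1\<close> and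
      \<open>v2\<close> at one point.\<close>
    have "W x * g x = wronskian S g v2 x * v1 x + wronskian S v1 g x * v2 x"
      "W x * quasi_deriv S g x = wronskian S g v2 x * quasi_deriv S v1 x + wronskian S v1 g x * quasi_deriv S v2 x" for x
      by (simp_all add: W_def wronskian_def algebra_simps)
    note ident = this[of "X n"]
    have "?D (X n) = 0" "?D1 (X n) = 0"
      using ident n by (simp_all add: \<alpha>_def \<beta>_def divide_simps) (simp_all add: algebra_simps)
    from cut[OF D this]
    have "sl_pair (\<lambda>x. (if \<theta> n x then ?D x else 0) + ((- \<alpha> n) * P1 x + (- \<beta> n) * P2 x))
      (\<lambda>x. (if \<theta> n x then ?D1 x else 0) + ((- \<alpha> n) * quasi_deriv S P1 x + (- \<beta> n) * quasi_deriv S P2 x))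
      (\<lambda>x. (if \<theta> n x then ?h x else 0) + ((- \<alpha> n) * tau S P1 x + (- \<beta> n) * tau S P2 x))"
      by (intro sl_pair_add sl_pair_cmult dom_max_D(1) P)
    then show ?thesis
      by (rule sl_pair_cong) (auto simp: R_def Q_def cutf_def algebra_simps)
  qed
  have L2s: "R n \<in> L2 M" "Q n \<in> L2 M" for n
    unfolding R_def[abs_def] Q_def[abs_def]
    by (intro L2_diff(1) L2_add(1) L2_cmult(1) cutL2(1) dom_max_D(2,3) v_dom g P)+
  have "\<forall>\<^sub>F n in sequentially. W (X n) \<noteq> 0 \<and> L2_norm M (R n) < \<epsilon> \<and> L2_norm M (Q n) < \<epsilon>"
    using W0 order_tendstoD(2)[OF Rs(1) \<epsilon>] order_tendstoD(2)[OF Rs(2) \<epsilon>] by eventually_elim simp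
  then obtain n where n: "W (X n) \<noteq> 0" "L2_norm M (R n) < \<epsilon>" "L2_norm M (Q n) < \<epsilon>"
    using eventually_happens'[OF sequentially_bot] by blast
  have Rd: "R n \<in> dom_max S" by (rule sl_pair_dom_max[OF pair[OF n(1)] L2s])
  moreover have "L2_norm M (tau S (R n)) = L2_norm M (Q n)"
    using sl_pair_tau[OF pair[OF n(1)]] dom_max_D(3)[OF Rd] L2s(2)[of n]
    by (intro L2_norm_AE_cong) (auto simp: L2_def)
  ultimately show thesis
    using n by (intro that[of "R n" "\<alpha> n" n "\<beta> n"]) (auto simp: R_def cutf_def)
qed

lemma sl_pair_cut_off_right:
  assumes "sl_pair f f1 h" "d \<in> I" "f d = 0" "f1 d = 0"
  shows "sl_pair (\<lambda>x. if x \<le> d then f x else 0) (\<lambda>x. if x \<le> d then f1 x else 0)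
    (\<lambda>x. if x \<le> d then h x else 0)"
  using sl_pair_add[OF assms(1) sl_pair_cmult[OF sl_pair_cut_off_left[OF assms], of "-1"]]
  by (rule sl_pair_cong) auto

text \<open>Truncation at both ends.  With $P_i$ the cut-offs that equal $v_i$ near $b$, the cut-offs for $a$
are $v_i - P_i$.\<close>

lemma D_min_approximation:
  assumes g: "g \<in> D_min" and \<epsilon>: "\<epsilon> > 0"
  obtains k where "k \<in> dom_max S" "\<exists>K. compact K \<and> K \<subseteq> I \<and> (\<forall>x\<in>I - K. k x = 0)"
    "L2_norm M (\<lambda>x. g x - k x) < \<epsilon>" "L2_norm M (\<lambda>x. tau S g x - tau S k x) < \<epsilon>"
proof -
  have gd: "g \<in> dom_max S" and z: "bv0 g (lend S) = 0" "bv1 g (lend S) = 0" "bv0 g (rend S) = 0" "bv1 g (rend S) = 0"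
    using g by (auto simp: D_min_def)
  have \<epsilon>2: "\<epsilon> / 2 > 0" using \<epsilon> by simp
  obtain c d P1 P2 where cd: "c \<in> I" "d \<in> I" and P: "P1 \<in> dom_max S" "P2 \<in> dom_max S"
    and P0: "\<forall>x\<in>I. x < c \<longrightarrow> P1 x = 0 \<and> P2 x = 0"
    and Pv: "\<forall>x\<in>I. d \<le> x \<longrightarrow> P1 x = v1 x \<and> P2 x = v2 x"
    using transition_functions by (elim bexE conjE) (rule that)
  obtain X where X: "\<And>n. X n \<in> I" "(\<lambda>n. ereal (X n)) \<longlonglongrightarrow> rend S"
    by (rule end_sequence[OF is_end(2)]) (rule that)
  obtain Y where Y: "\<And>n. Y n \<in> I" "(\<lambda>n. ereal (Y n)) \<longlonglongrightarrow> lend S"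
    by (rule end_sequence[OF is_end(1)]) (rule that)
  have sets: "{x. \<not> x \<le> t} \<inter> I \<in> sets M" "{x. x \<le> t} \<inter> I \<in> sets M" for t
  proof -
    have *: "A \<inter> I \<in> sets M" if "A \<in> sets lebesgue" for A
      using that I_lebesgue by (simp add: sets_M sets_restrict_space_iff sets.Int)
    have eq: "{x. \<not> x \<le> t} = {t<..}" "{x. x \<le> t} = {..t}" by auto
    show "{x. \<not> x \<le> t} \<inter> I \<in> sets M" "{x. x \<le> t} \<inter> I \<in> sets M"
      unfolding eq by (rule *; simp)+
  qed
  obtain n \<alpha> \<beta> R where R: "R \<in> dom_max S" "L2_norm M R < \<epsilon> / 2" "L2_norm M (tau S R) < \<epsilon> / 2"
    "\<And>x. R x = \<alpha> * ((if \<not> x \<le> X n then v1 x else 0) - P1 x) + \<beta> * ((if \<not> x \<le> X n then v2 x else 0) - P2 x)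
      - (if \<not> x \<le> X n then g x else 0)"
  proof (rule truncation[OF is_end(2) gd z(3,4) X, of "\<lambda>n x. \<not> x \<le> X n" P1 P2 "\<epsilon> / 2"])
    show "\<forall>\<^sub>F n in sequentially. \<not> \<not> x \<le> X n" if "x \<in> I" for x
    proof -
      have "ereal x < rend S" using that by (simp add: sl_int_def einterval_iff)
      then have "\<forall>\<^sub>F n in sequentially. ereal x < ereal (X n)" using X(2) order_tendstoD(1) by blast
      then show ?thesis by eventually_elim auto
    qed
    show "sl_pair (\<lambda>x. if \<not> x \<le> X n then D x else 0) (\<lambda>x. if \<not> x \<le> X n then D1 x else 0) (\<lambda>x. if \<not> x \<le> X n then h x else 0)"
      if "sl_pair D D1 h" "D (X n) = 0" "D1 (X n) = 0" for n D D1 h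
      using sl_pair_cut_off_left[OF that(1) X(1) that(2,3)] by (rule sl_pair_cong) auto
  qed (use sets P \<epsilon>2 in auto)
  obtain m \<gamma> \<delta> L where L: "L \<in> dom_max S" "L2_norm M L < \<epsilon> / 2" "L2_norm M (tau S L) < \<epsilon> / 2"
    "\<And>x. L x = \<gamma> * ((if x \<le> Y m then v1 x else 0) - (v1 x - P1 x)) + \<delta> * ((if x \<le> Y m then v2 x else 0) - (v2 x - P2 x))
      - (if x \<le> Y m then g x else 0)"
  proof (rule truncation[OF is_end(1) gd z(1,2) Y, of "\<lambda>n x. x \<le> Y n" "\<lambda>x. v1 x - P1 x" "\<lambda>x. v2 x - P2 x" "\<epsilon> / 2"])
    show "\<forall>\<^sub>F n in sequentially. \<not> x \<le> Y n" if "x \<in> I" for x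
    proof -
      have "lend S < ereal x" using that by (simp add: sl_int_def einterval_iff)
      then have "\<forall>\<^sub>F n in sequentially. ereal (Y n) < ereal x" using Y(2) order_tendstoD(2) by blast
      then show ?thesis by eventually_elim auto
    qed
    show "sl_pair (\<lambda>x. if x \<le> Y n then D x else 0) (\<lambda>x. if x \<le> Y n then D1 x else 0) (\<lambda>x. if x \<le> Y n then h x else 0)"
      if "sl_pair D D1 h" "D (Y n) = 0" "D1 (Y n) = 0" for n D D1 h
      by (rule sl_pair_cut_off_right[OF that(1) Y(1) that(2,3)])
  qed (use sets \<epsilon>2 dom_max_diff(1)[OF v_dom(1) P(1)] dom_max_diff(1)[OF v_dom(2) P(2)] in auto)
  define k where "k x = g x + (R x + L x)" for x
  have RL: "(\<lambda>x. R x + L x) \<in> dom_max S" by (rule dom_max_add(1)[OF R(1) L(1)])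
  have kd: "k \<in> dom_max S" unfolding k_def[abs_def] by (rule dom_max_add(1)[OF gd RL])
  define s where "s = min (min c d) (min (X n) (Y m))"
  define t where "t = max (max c d) (max (X n) (Y m))"
  have st: "s \<in> I" "t \<in> I"
    using cd X(1)[of n] Y(1)[of m] by (simp_all add: s_def t_def min_def max_def)
  have s: "s \<le> c" "s \<le> d" "s \<le> X n" "s \<le> Y m" by (simp_all add: s_def)
  have t: "c \<le> t" "d \<le> t" "X n \<le> t" "Y m \<le> t" by (simp_all add: t_def)
  have k0: "k x = 0" if x: "x \<in> I" "x \<notin> {s..t}" for x
  proof (cases "x < s")
    case True
    then have "x < c" "x \<le> X n" "x \<le> Y m" using s by auto
    then show ?thesis using P0 x(1) by (simp add: k_def R(4) L(4))
  next
    case False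
    then have "x > t" using x by auto
    then have "d \<le> x" "\<not> x \<le> X n" "\<not> x \<le> Y m" using t by auto
    then show ?thesis using Pv x(1) by (simp add: k_def R(4) L(4))
  qed
  show thesis
  proof (rule that[OF kd])
    show "\<exists>K. compact K \<and> K \<subseteq> I \<and> (\<forall>x\<in>I - K. k x = 0)"
      using k0 Icc_subset_I[OF st] by (intro exI[of _ "{s..t}"]) auto
    note RL2 = dom_max_D(2)[OF R(1)] dom_max_D(2)[OF L(1)] and RLt = dom_max_D(3)[OF R(1)] dom_max_D(3)[OF L(1)]
    have "L2_norm M (\<lambda>x. g x - k x) = L2_norm M (\<lambda>x. (- 1) * (R x + L x))"
      by (simp add: k_def)
    also have "\<dots> \<le> L2_norm M R + L2_norm M L"
      using L2_cmult(2)[OF L2_add(1)[OF RL2], of "-1"] L2_add(2)[OF RL2] by simp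
    finally show "L2_norm M (\<lambda>x. g x - k x) < \<epsilon>" using R(2) L(2) by linarith
    have "L2_norm M (\<lambda>x. tau S g x - tau S k x) = L2_norm M (\<lambda>x. (- 1) * (tau S R x + tau S L x))"
    proof (rule L2_norm_AE_cong)
      show "AE x in M. tau S g x - tau S k x = (- 1) * (tau S R x + tau S L x)"
        using dom_max_add(3)[OF gd RL] dom_max_add(3)[OF R(1) L(1)]
        unfolding k_def[abs_def] by eventually_elim simp
    qed (use dom_max_D(3)[OF gd] dom_max_D(3)[OF kd] RLt in \<open>auto simp: L2_def\<close>)
    also have "\<dots> \<le> L2_norm M (tau S R) + L2_norm M (tau S L)"
      using L2_cmult(2)[OF L2_add(1)[OF RLt], of "-1"] L2_add(2)[OF RLt] by simp
    finally show "L2_norm M (\<lambda>x. tau S g x - tau S k x) < \<epsilon>" using R(3) L(3) by linarith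
  qed
qed

text \<open>The minimal operator is the restriction of $T_{max}$ by vanishing boundary values.\<close>

lemma T_min_eq: "T_min S = realization S D_min"
proof
  show "T_min S \<subseteq> realization S D_min" by (rule T_min_subset)
  show "realization S D_min \<subseteq> T_min S"
  proof
    fix fh assume "fh \<in> realization S D_min"
    then obtain f h g where fh: "fh = (f, h)" and f: "f \<in> L2 M" and h: "h \<in> L2 M"
      and g: "g \<in> D_min" "AE x in M. f x = g x" "AE x in M. h x = tau S g x"
      by (auto simp: realization_def)
    have gd: "g \<in> dom_max S" using g by (simp add: D_min_def)
    have "\<exists>(u, v)\<in>realization S {g \<in> dom_max S. \<exists>K. compact K \<and> K \<subseteq> I \<and> (\<forall>x\<in>I - K. g x = 0)}.
        L2_norm M (\<lambda>x. f x - u x) < e \<and> L2_norm M (\<lambda>x. h x - v x) < e" if e: "e > 0" for e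
    proof -
      obtain k where k: "k \<in> dom_max S" "\<exists>K. compact K \<and> K \<subseteq> I \<and> (\<forall>x\<in>I - K. k x = 0)"
        "L2_norm M (\<lambda>x. g x - k x) < e" "L2_norm M (\<lambda>x. tau S g x - tau S k x) < e"
        by (rule D_min_approximation[OF g(1) e]) (rule that)
      have "(k, tau S k) \<in> realization S {g \<in> dom_max S. \<exists>K. compact K \<and> K \<subseteq> I \<and> (\<forall>x\<in>I - K. g x = 0)}"
        using k(1,2) dom_max_D(2,3)[OF k(1)] by (auto simp: realization_def)
      moreover have "L2_norm M (\<lambda>x. f x - k x) = L2_norm M (\<lambda>x. g x - k x)"
        using f g(2) dom_max_D(2)[OF gd] dom_max_D(2)[OF k(1)] by (intro L2_norm_AE_cong) (auto simp: L2_def)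
      moreover have "L2_norm M (\<lambda>x. h x - tau S k x) = L2_norm M (\<lambda>x. tau S g x - tau S k x)"
        using h g(3) dom_max_D(3)[OF gd] dom_max_D(3)[OF k(1)] by (intro L2_norm_AE_cong) (auto simp: L2_def)
      ultimately show ?thesis using k(3,4) by (intro bexI[of _ "(k, tau S k)"]) auto
    qed
    then show "fh \<in> T_min S" using f h by (simp add: fh T_min_def op_closure_def)
  qed
qed

section \<open>Common parts and resolvents\<close>

text \<open>The domains consist of continuous representatives, so that functions equal almost everywhere have
to be identified before intersecting.\<close>

lemma max_common_part_realization:
  assumes D1: "D1 \<subseteq> dom_max S" and D2: "D2 \<subseteq> dom_max S"
    and closed: "\<And>f g. f \<in> D1 \<Longrightarrow> g \<in> D2 \<Longrightarrow> (AE x in M. f x = g x) \<Longrightarrow> g \<in> D1"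
  shows "max_common_part (realization S D1) (realization S D2) = realization S (D1 \<inter> D2)"
proof
  show "max_common_part (realization S D1) (realization S D2) \<subseteq> realization S (D1 \<inter> D2)"
  proof
    fix fh assume "fh \<in> max_common_part (realization S D1) (realization S D2)"
    then obtain f h where fh: "fh = (f, h)" "(f, h) \<in> realization S D1" "(f, h) \<in> realization S D2"
      by (auto simp: max_common_part_def)
    then obtain g1 g2 where g: "g1 \<in> D1" "AE x in M. f x = g1 x" "g2 \<in> D2" "AE x in M. f x = g2 x"
      "AE x in M. h x = tau S g2 x" and "f \<in> L2 M" "h \<in> L2 M"
      by (auto simp: realization_def)
    have "AE x in M. g1 x = g2 x" using g(2,4) by eventually_elim simp
    then have "g2 \<in> D1" by (rule closed[OF g(1,3)])
    then show "fh \<in> realization S (D1 \<inter> D2)"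
      using g \<open>f \<in> L2 M\<close> \<open>h \<in> L2 M\<close> fh by (auto simp: realization_def)
  qed
  show "realization S (D1 \<inter> D2) \<subseteq> max_common_part (realization S D1) (realization S D2)"
    by (auto simp: max_common_part_def realization_def)
qed

lemma resolvent_realization:
  assumes z: "z \<in> resolvent_set M (realization S D)" and D: "D \<subseteq> dom_max S" and h: "h \<in> L2 M"
  obtains f where "f \<in> D" "AE x in M. resolvent (realization S D) z h x = f x"
    "AE x in M. h x = tau S f x - z * f x"
proof -
  have "\<exists>f. (f, h) \<in> op_shift (realization S D) z" using z h by (simp add: resolvent_set_def)
  then have "(resolvent (realization S D) z h, h) \<in> op_shift (realization S D) z"
    unfolding resolvent_def by (rule someI_ex)
  then obtain k where k: "(resolvent (realization S D) z h, k) \<in> realization S D"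
    "h = (\<lambda>x. k x - z * resolvent (realization S D) z h x)"
    by (auto simp: op_shift_def)
  then obtain f where f: "f \<in> D" "AE x in M. resolvent (realization S D) z h x = f x" "AE x in M. k x = tau S f x"
    by (auto simp: realization_def)
  have "AE x in M. h x = tau S f x - z * f x"
    using f(2,3)
  proof eventually_elim
    case (elim x)
    then show ?case using fun_cong[OF k(2), of x] by simp
  qed
  with f show thesis using that by blast
qed

lemma resolvent_set_injective:
  assumes z: "z \<in> resolvent_set M (realization S D)" and D: "D \<subseteq> dom_max S" and y: "y \<in> D"
    and eq: "AE x in M. tau S y x = z * y x"
  shows "AE x in M. y x = 0"
proof -
  have yd: "y \<in> L2 M" using D y dom_max_D(2) by blast
  have "(y, \<lambda>x. z * y x) \<in> realization S D"
    using yd L2_cmult(1)[OF yd] y eq by (auto simp: realization_def intro!: bexI[of _ y] elim!: eventually_mono)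
  then have "(y, \<lambda>x. z * y x - z * y x) \<in> op_shift (realization S D) z"
    unfolding op_shift_def by (intro CollectI exI[of _ y] exI[of _ "\<lambda>x. z * y x"]) simp
  moreover obtain C where "\<forall>(f, h)\<in>op_shift (realization S D) z. L2_norm M f \<le> C * L2_norm M h"
    using z by (auto simp: resolvent_set_def)
  ultimately have "L2_norm M y \<le> C * L2_norm M (\<lambda>x. z * y x - z * y x)" by blast
  then have "L2_norm M y = 0" using L2_norm_nonneg[of M y] by simp
  then show ?thesis by (rule L2_norm_zero_AE[OF yd])
qed

text \<open>In the limit circle case at both ends every solution is in $\mathrm{dom}(T_{max})$.\<close>

lemma limit_circle_L2:
  assumes lc: "limit_circle_at S (lend S)" "limit_circle_at S (rend S)" and u: "sl_solution S z u"
  shows "u \<in> dom_max S" "AE x in M. tau S u x = z * u x"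
proof -
  have reg: "u \<in> sl_regular S" and eq: "AE x in M. tau S u x = z * u x"
    using u by (auto simp: sl_solution_def AE_M)
  have uc: "continuous_on I u" using sl_pair_continuous(1)[OF sl_regular_pair[OF reg]] .
  obtain c d where c: "c \<in> I" "interval_lebesgue_integrable M (lend S) (ereal c) (\<lambda>x. (cmod (u x))\<^sup>2)"
    and d: "d \<in> I" "interval_lebesgue_integrable M (rend S) (ereal d) (\<lambda>x. (cmod (u x))\<^sup>2)"
    using lc u unfolding limit_circle_at_def by blast
  have cI: "lend S < ereal c" "ereal c < rend S" "lend S < ereal d" "ereal d < rend S"
    using c(1) d(1) by (auto simp: sl_int_def einterval_iff)
  let ?f = "\<lambda>x. (cmod (u x))\<^sup>2"
  have A: "set_integrable M (einterval (lend S) (ereal c)) ?f"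
    using c(2) cI by (simp add: interval_lebesgue_integrable_def)
  have B: "set_integrable M (einterval (ereal d) (rend S)) ?f"
    using d(2) cI by (simp add: interval_lebesgue_integrable_def)
  have cd: "{c..d} \<subseteq> I" by (rule Icc_subset_I[OF c(1) d(1)])
  have C: "set_integrable M {c..d} ?f"
    by (intro set_integrable_M_continuous[OF _ cd] continuous_on_power continuous_on_norm uc)
  have e: "einterval a b \<subseteq> I \<Longrightarrow> einterval a b \<in> sets M" for a b
    by (auto simp: sets_M sets_restrict_space_iff)
  have sub: "einterval (lend S) (ereal c) \<subseteq> I" "einterval (ereal d) (rend S) \<subseteq> I"
    using less_trans[OF _ cI(2)] less_trans[OF cI(3)] by (auto simp: sl_int_def einterval_iff)
  have "set_integrable M ((einterval (lend S) (ereal c) \<union> {c..d}) \<union> einterval (ereal d) (rend S)) ?f"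
    by (intro set_integrable_Un A B C e sub Icc_sets_M[OF cd] sets.Un)
  moreover have "(einterval (lend S) (ereal c) \<union> {c..d}) \<union> einterval (ereal d) (rend S) = I"
    using sub cd by (auto simp: sl_int_def einterval_iff)
  ultimately have "set_integrable M I ?f" by simp
  then have "integrable M (\<lambda>x. indicator I x *\<^sub>R ?f x)" by (simp add: set_integrable_def)
  then have "integrable M ?f"
    by (rule Bochner_Integration.integrable_cong[THEN iffD1, rotated -1]) (auto simp: space_M)
  then have "u \<in> L2 M" using continuous_measurable_M[OF uc] by (simp add: L2_def)
  moreover have "AE x in M. z * u x = tau S u x" using eq by eventually_elim simp
  ultimately have "u \<in> L2 M" "tau S u \<in> L2 M" using L2_M_AE_cong[OF L2_cmult(1)] by auto
  then show "u \<in> dom_max S" using reg by (simp add: dom_max_def)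
  show "AE x in M. tau S u x = z * u x" by (rule eq)
qed

end

section \<open>Krein resolvent identities\<close>

lemma invertible_2_if_injective:
  fixes K :: "complex^2^2"
  assumes "\<And>c d. c * K $ 1 $ 1 + d * K $ 2 $ 1 = 0 \<Longrightarrow> c * K $ 1 $ 2 + d * K $ 2 $ 2 = 0 \<Longrightarrow> c = 0 \<and> d = 0"
  shows "invertible K"
proof -
  have "K $ 1 $ 1 * K $ 2 $ 2 - K $ 1 $ 2 * K $ 2 $ 1 \<noteq> 0"
  proof
    assume det: "K $ 1 $ 1 * K $ 2 $ 2 - K $ 1 $ 2 * K $ 2 $ 1 = 0"
    have "K $ 2 $ 1 = 0 \<and> - K $ 1 $ 1 = 0"
      by (rule assms) (use det in \<open>simp_all add: algebra_simps\<close>)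
    moreover have "K $ 2 $ 2 = 0 \<and> - K $ 1 $ 2 = 0"
      by (rule assms) (use det in \<open>simp_all add: algebra_simps\<close>)
    ultimately show False using assms[of 1 0] by simp
  qed
  then show ?thesis by (simp add: invertible_det_nz det_2)
qed

text \<open>The system has the transposed matrix, as for the coefficients in the resolvent identity.\<close>

lemma matrix_inv_2_solve:
  fixes K :: "complex^2^2"
  assumes K: "invertible K"
    and eq: "c * K $ 1 $ 1 + d * K $ 2 $ 1 = w1" "c * K $ 1 $ 2 + d * K $ 2 $ 2 = w2"
  shows "c = w1 * matrix_inv K $ 1 $ 1 + w2 * matrix_inv K $ 2 $ 1"
    "d = w1 * matrix_inv K $ 1 $ 2 + w2 * matrix_inv K $ 2 $ 2"
proof -
  let ?V = "matrix_inv K"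
  have "K ** ?V = mat 1"
    using K someI_ex[of "\<lambda>A'. K ** A' = mat 1 \<and> A' ** K = mat 1"] unfolding invertible_def matrix_inv_def by blast
  then have e: "K $ 1 $ 1 * ?V $ 1 $ 1 + K $ 1 $ 2 * ?V $ 2 $ 1 = 1" "K $ 1 $ 1 * ?V $ 1 $ 2 + K $ 1 $ 2 * ?V $ 2 $ 2 = 0"
    "K $ 2 $ 1 * ?V $ 1 $ 1 + K $ 2 $ 2 * ?V $ 2 $ 1 = 0" "K $ 2 $ 1 * ?V $ 1 $ 2 + K $ 2 $ 2 * ?V $ 2 $ 2 = 1"
    by (simp_all add: vec_eq_iff forall_2 matrix_matrix_mult_def sum_2 mat_def)
  have "w1 * ?V $ 1 $ 1 + w2 * ?V $ 2 $ 1 = c * (K $ 1 $ 1 * ?V $ 1 $ 1 + K $ 1 $ 2 * ?V $ 2 $ 1)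
      + d * (K $ 2 $ 1 * ?V $ 1 $ 1 + K $ 2 $ 2 * ?V $ 2 $ 1)"
    unfolding eq[symmetric] by (simp add: algebra_simps)
  then show "c = w1 * ?V $ 1 $ 1 + w2 * ?V $ 2 $ 1" by (simp add: e)
  have "w1 * ?V $ 1 $ 2 + w2 * ?V $ 2 $ 2 = c * (K $ 1 $ 1 * ?V $ 1 $ 2 + K $ 1 $ 2 * ?V $ 2 $ 2)
      + d * (K $ 2 $ 1 * ?V $ 1 $ 2 + K $ 2 $ 2 * ?V $ 2 $ 2)"
    unfolding eq[symmetric] by (simp add: algebra_simps)
  then show "d = w1 * ?V $ 1 $ 2 + w2 * ?V $ 2 $ 2" by (simp add: e)
qed

text \<open>Coupled boundary conditions with $R_{1,2} \ne 0$, solved for the two values of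
$\widetilde g^{\,\prime}$.  The variables $a, a_1$ and $b, b_1$ stand for
$\widetilde g, \widetilde g^{\,\prime}$ at the left and at the right endpoint, $e$ for
$e^{i\varphi}$ and $e'$ for its inverse.\<close>

lemma coupled_boundary_conditions:
  fixes e e' r11 r12 r21 r22 a a1 b b1 :: complex
  assumes e: "e * e' = 1" and r: "r12 \<noteq> 0" "r11 * r22 - r12 * r21 = 1"
  shows "b = e * (r11 * a + r12 * a1) \<and> b1 = e * (r21 * a + r22 * a1) \<longleftrightarrow>
    (- (r22 / r12)) * b + e / r12 * a + b1 = 0 \<and> e' / r12 * b + (- (r11 / r12)) * a - a1 = 0"
proof -
  have e0: "e \<noteq> 0" using e by auto
  then have e': "e' = 1 / e" using e by (simp add: eq_divide_eq mult.commute)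
  have "r12 * e * (e' / r12 * b + (- (r11 / r12)) * a - a1) = b - e * (r11 * a + r12 * a1)"
    using e0 r(1) unfolding e' by (simp add: field_simps)
  then have 1: "b = e * (r11 * a + r12 * a1) \<longleftrightarrow> e' / r12 * b + (- (r11 / r12)) * a - a1 = 0"
    using e0 r(1) by (metis eq_iff_diff_eq_0 mult_eq_0_iff)
  have "(- (r22 / r12)) * b + e / r12 * a + b1 = b1 - e * (r21 * a + r22 * a1)"
    if b: "b = e * (r11 * a + r12 * a1)"
  proof -
    have "r12 * ((- (r22 / r12)) * b + e / r12 * a + b1) = - r22 * b + e * a + r12 * b1"
      using r(1) by (simp add: field_simps)
    also have "\<dots> = e * a * (1 - r11 * r22) - e * r22 * r12 * a1 + r12 * b1"
      unfolding b by (simp add: algebra_simps)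
    also have "1 - r11 * r22 = - r12 * r21" using r(2) by (simp add: algebra_simps)
    finally have "r12 * ((- (r22 / r12)) * b + e / r12 * a + b1) = r12 * (b1 - e * (r21 * a + r22 * a1))"
      by (simp add: algebra_simps)
    then show ?thesis using r(1) by simp
  qed
  then show ?thesis using 1 by auto
qed

text \<open>If $R_{1,2} = 0$, then $\det R = 1$ means $R_{1,1}R_{2,2} = 1$, and the values $\widetilde g(a)$,
$\widetilde g(b)$ are proportional.\<close>

lemma coupled_boundary_conditions_diagonal:
  fixes e e' r11 r12 r21 r22 a a1 b b1 :: complex
  assumes e: "e * e' = 1" and r: "r11 * r22 = 1" "r12 = 0"
  shows "b = e * (r11 * a + r12 * a1) \<and> b1 = e * (r21 * a + r22 * a1) \<longleftrightarrow>
    a = e' * r22 * b \<and> b1 = r21 * r22 * b + e * r22 * a1"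
proof -
  have 1: "b = e * (r11 * a) \<longleftrightarrow> a = e' * r22 * b"
  proof
    assume "b = e * (r11 * a)"
    then have "e' * r22 * b = (e * e') * (r11 * r22) * a" by simp
    then show "a = e' * r22 * b" by (simp add: e r)
  next
    assume "a = e' * r22 * b"
    then have "e * (r11 * a) = (e * e') * (r11 * r22) * b" by simp
    then show "b = e * (r11 * a)" by (simp add: e r)
  qed
  have 2: "e * (r21 * a + r22 * a1) = r21 * r22 * b + e * r22 * a1" if "a = e' * r22 * b"
  proof -
    have "e * (r21 * a + r22 * a1) = (e * e') * (r21 * r22 * b) + e * r22 * a1"
      unfolding that by (simp add: algebra_simps)
    then show ?thesis by (simp add: e)
  qed
  show ?thesis unfolding r(2) mult_zero_left add_0_right using 1 2 by metis
qed

context sl_boundary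
begin

text \<open>The domain of $T_{\alpha,\beta}$.\<close>

definition D_sep :: "real \<Rightarrow> real \<Rightarrow> (real \<Rightarrow> complex) set" where
  "D_sep \<alpha> \<beta> = {g \<in> dom_max S.
     complex_of_real (cos \<alpha>) * bv0 g (lend S) + complex_of_real (sin \<alpha>) * bv1 g (lend S) = 0 \<and>
     complex_of_real (cos \<beta>) * bv0 g (rend S) + complex_of_real (sin \<beta>) * bv1 g (rend S) = 0}"

text \<open>The domain of $T_{\varphi,R}$, with the matrix equation written out.\<close>

definition D_coupled :: "real \<Rightarrow> real^2^2 \<Rightarrow> (real \<Rightarrow> complex) set" where
  "D_coupled \<phi> R = {g \<in> dom_max S.
     bv0 g (rend S) = exp (\<i> * complex_of_real \<phi>) * (complex_of_real (R $ 1 $ 1) * bv0 g (lend S)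
       + complex_of_real (R $ 1 $ 2) * bv1 g (lend S)) \<and>
     bv1 g (rend S) = exp (\<i> * complex_of_real \<phi>) * (complex_of_real (R $ 2 $ 1) * bv0 g (lend S)
       + complex_of_real (R $ 2 $ 2) * bv1 g (lend S))}"

text \<open>The domain of $T_{0,0}$.\<close>

definition D_00 :: "(real \<Rightarrow> complex) set" where
  "D_00 = {g \<in> dom_max S. bv0 g (lend S) = 0 \<and> bv0 g (rend S) = 0}"

lemma T_sep_eq: "T_sep S v1 v2 \<alpha> \<beta> = realization S (D_sep \<alpha> \<beta>)"
  by (simp add: T_sep_def D_sep_def)

lemma T_coupled_eq: "T_coupled S v1 v2 \<phi> R = realization S (D_coupled \<phi> R)"
  by (simp add: T_coupled_def D_coupled_def vec_eq_iff forall_2 matrix_vector_mult_def sum_2)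

lemma T_00_eq: "T_sep S v1 v2 0 0 = realization S D_00"
  by (simp add: T_sep_def D_00_def)

lemma D_subset: "D_sep \<alpha> \<beta> \<subseteq> dom_max S" "D_coupled \<phi> R \<subseteq> dom_max S" "D_00 \<subseteq> dom_max S"
  by (auto simp: D_sep_def D_coupled_def D_00_def)

lemma D_AE_cong:
  assumes "g \<in> dom_max S" "f \<in> dom_max S" "AE x in M. f x = g x"
  shows "f \<in> D_sep \<alpha> \<beta> \<longleftrightarrow> g \<in> D_sep \<alpha> \<beta>" "f \<in> D_coupled \<phi> R \<longleftrightarrow> g \<in> D_coupled \<phi> R" "f \<in> D_00 \<longleftrightarrow> g \<in> D_00"
  using assms bv_cong[OF is_end(1) assms(2,1,3)] bv_cong[OF is_end(2) assms(2,1,3)]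
  by (simp_all add: D_sep_def D_coupled_def D_00_def)

lemma common_part_sep:
  "max_common_part (T_sep S v1 v2 0 0) (T_sep S v1 v2 \<alpha> \<beta>) = realization S (D_00 \<inter> D_sep \<alpha> \<beta>)"
  unfolding T_00_eq T_sep_eq[of \<alpha> \<beta>]
  by (rule max_common_part_realization[OF D_subset(3,1)]) (use D_AE_cong(3) D_subset in blast)

lemma common_part_coupled:
  "max_common_part (T_sep S v1 v2 0 0) (T_coupled S v1 v2 \<phi> R) = realization S (D_00 \<inter> D_coupled \<phi> R)"
  "max_common_part (T_coupled S v1 v2 \<phi> R) (T_sep S v1 v2 0 0) = realization S (D_coupled \<phi> R \<inter> D_00)"
  unfolding T_00_eq T_coupled_eq
  by (rule max_common_part_realization[OF D_subset(3,2)]; use D_AE_cong(3) D_subset in blast)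
     (rule max_common_part_realization[OF D_subset(2,3)]; use D_AE_cong(2) D_subset in blast)

lemma op_shift_D_00_cnj:
  assumes "(f, h) \<in> op_shift (realization S D_00) z"
  shows "(\<lambda>x. cnj (f x), \<lambda>x. cnj (h x)) \<in> op_shift (realization S D_00) (cnj z)"
proof -
  obtain k g where k: "h = (\<lambda>x. k x - z * f x)" "f \<in> L2 M" "k \<in> L2 M" and g: "g \<in> D_00"
    "AE x in M. f x = g x" "AE x in M. k x = tau S g x"
    using assms by (auto simp: op_shift_def realization_def)
  have gd: "g \<in> dom_max S" using g(1) D_subset(3) by blast
  have "(\<lambda>x. cnj (g x)) \<in> D_00"
    using g(1) dom_max_cnj(1)[OF gd] bv_cnj[OF is_end(1) gd] bv_cnj[OF is_end(2) gd] by (simp add: D_00_def)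
  moreover have "AE x in M. cnj (f x) = cnj (g x)" using g(2) by eventually_elim simp
  moreover have "AE x in M. cnj (k x) = tau S (\<lambda>x. cnj (g x)) x"
    using g(3) dom_max_cnj(3)[OF gd] by eventually_elim simp
  ultimately have "(\<lambda>x. cnj (f x), \<lambda>x. cnj (k x)) \<in> realization S D_00"
    using L2_cnj[OF k(2)] L2_cnj[OF k(3)] by (auto simp only: realization_iff[OF D_subset(3)])
  then have "(\<lambda>x. cnj (f x), \<lambda>x. cnj (k x) - cnj z * cnj (f x)) \<in> op_shift (realization S D_00) (cnj z)"
    unfolding op_shift_def by (intro CollectI exI[of _ "\<lambda>x. cnj (f x)"] exI[of _ "\<lambda>x. cnj (k x)"]) simp
  then show ?thesis by (simp add: k(1))
qed

lemma L2_norm_cnj: "L2_norm M (\<lambda>x. cnj (f x)) = L2_norm M f"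
  by (simp add: L2_norm_def)

text \<open>The resolvent set of $T_{0,0}$ is symmetric, since the coefficients and the boundary conditions are
real.\<close>

lemma resolvent_set_cnj:
  assumes "z \<in> resolvent_set M (realization S D_00)"
  shows "cnj z \<in> resolvent_set M (realization S D_00)"
proof -
  let ?T = "realization S D_00"
  have onto: "\<exists>f. (f, h) \<in> op_shift ?T z" if "h \<in> L2 M" for h using assms that by (simp add: resolvent_set_def)
  obtain C where C': "\<forall>(f, h)\<in>op_shift ?T z. L2_norm M f \<le> C * L2_norm M h"
    using assms by (auto simp: resolvent_set_def)
  then have C: "L2_norm M f \<le> C * L2_norm M h" if "(f, h) \<in> op_shift ?T z" for f h using that by blast
  have "\<exists>f. (f, h) \<in> op_shift ?T (cnj z)" if h: "h \<in> L2 M" for h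
  proof -
    obtain f where "(f, \<lambda>x. cnj (h x)) \<in> op_shift ?T z" using onto[OF L2_cnj[OF h]] by blast
    from op_shift_D_00_cnj[OF this] show ?thesis by auto
  qed
  moreover have "L2_norm M f \<le> C * L2_norm M h" if "(f, h) \<in> op_shift ?T (cnj z)" for f h
    using C[of "\<lambda>x. cnj (f x)" "\<lambda>x. cnj (h x)"] op_shift_D_00_cnj[OF that] by (simp add: L2_norm_cnj)
  ultimately show ?thesis by (auto simp: resolvent_set_def)
qed

text \<open>Green's formula for $\overline u$, a solution of $\tau w = zw$, and $f = (T_{0,0} - z)^{-1}h$.\<close>

lemma inner_solution:
  assumes u: "u \<in> dom_max S" "AE x in M. tau S u x = cnj z * u x"
    and f: "f \<in> D_00" and h: "h \<in> L2 M" "AE x in M. h x = tau S f x - z * f x"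
  shows "L2_inner M u h = cnj (bv0 u (lend S)) * bv1 f (lend S) - cnj (bv0 u (rend S)) * bv1 f (rend S)"
proof -
  let ?w = "\<lambda>x. cnj (u x)"
  have fd: "f \<in> dom_max S" using f D_subset(3) by blast
  have w: "?w \<in> dom_max S" by (rule dom_max_cnj(1)[OF u(1)])
  have "L2_inner M u h = (LINT x|M. - lagr ?w f x)"
    unfolding L2_inner_def
  proof (rule integral_cong_AE)
    show "AE x in M. cnj (u x) * h x = - lagr ?w f x"
      using u(2) h(2) dom_max_cnj(3)[OF u(1)] by eventually_elim (simp only: lagr_def, simp add: algebra_simps)
    show "(\<lambda>x. cnj (u x) * h x) \<in> borel_measurable M"
      by (rule borel_measurable_integrable[OF L2_mult_integrable(1)[OF dom_max_D(2)[OF w] h(1)]])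
    show "(\<lambda>x. - lagr ?w f x) \<in> borel_measurable M"
      by (intro borel_measurable_uminus borel_measurable_integrable[OF lagr_integrable[OF w fd]])
  qed
  also have "\<dots> = wronskian_end S ?w f (lend S) - wronskian_end S ?w f (rend S)"
    using green[OF w fd] by simp
  also have "\<dots> = cnj (bv0 u (lend S)) * bv1 f (lend S) - cnj (bv0 u (rend S)) * bv1 f (rend S)"
    using f by (simp add: wronskian_end_bv[OF _ w fd] bv_cnj u(1) D_00_def)
  finally show ?thesis .
qed

end

text \<open>The setting of the resolvent identities: both endpoints are in the limit circle case, and
\<open>u 1 z\<close>, \<open>u 2 z\<close> are the solutions with boundary values $0, 1$ and $1, 0$ at $a, b$.\<close>

locale sl_krein = sl_boundary +
  fixes u :: "2 \<Rightarrow> complex \<Rightarrow> real \<Rightarrow> complex"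
  assumes lc: "limit_circle_at S (lend S)" "limit_circle_at S (rend S)"
    and u1: "\<And>z. z \<in> resolvent_set M (realization S D_00) \<Longrightarrow>
       sl_solution S z (u 1 z) \<and> bv0 (u 1 z) (lend S) = 0 \<and> bv0 (u 1 z) (rend S) = 1"
    and u2: "\<And>z. z \<in> resolvent_set M (realization S D_00) \<Longrightarrow>
       sl_solution S z (u 2 z) \<and> bv0 (u 2 z) (lend S) = 1 \<and> bv0 (u 2 z) (rend S) = 0"
begin

abbreviation \<rho> where "\<rho> D \<equiv> resolvent_set M (realization S D)"

lemma u_dom:
  assumes "z \<in> \<rho> D_00"
  shows "u 1 z \<in> dom_max S" "AE x in M. tau S (u 1 z) x = z * u 1 z x"
    "u 2 z \<in> dom_max S" "AE x in M. tau S (u 2 z) x = z * u 2 z x"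
  using limit_circle_L2[OF lc] u1[OF assms] u2[OF assms] by blast+

text \<open>The solution $c\,u_1(z,\cdot) + d\,u_2(z,\cdot)$, which has the value $d$ at $a$ and $c$ at $b$.\<close>

definition comb :: "complex \<Rightarrow> complex \<Rightarrow> complex \<Rightarrow> real \<Rightarrow> complex" where
  "comb c d z x = c * u 1 z x + d * u 2 z x"

lemma comb:
  assumes z: "z \<in> \<rho> D_00"
  shows "comb c d z \<in> dom_max S" "AE x in M. tau S (comb c d z) x = z * comb c d z x"
    "bv0 (comb c d z) (lend S) = d" "bv0 (comb c d z) (rend S) = c"
    "is_end e \<Longrightarrow> bv1 (comb c d z) e = c * bv1 (u 1 z) e + d * bv1 (u 2 z) e"
proof -
  note ud = u_dom[OF z] and b1 = u1[OF z] and b2 = u2[OF z]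
  have eq: "comb c d z = (\<lambda>x. c * u 1 z x + d * u 2 z x)" by (simp add: comb_def fun_eq_iff)
  note c1 = dom_max_cmult[OF ud(1), where c = c] and c2 = dom_max_cmult[OF ud(3), where c = d]
  show "comb c d z \<in> dom_max S" unfolding eq by (rule dom_max_add(1)[OF c1(1) c2(1)])
  show "AE x in M. tau S (comb c d z) x = z * comb c d z x"
    unfolding eq using dom_max_add(3)[OF c1(1) c2(1)] c1(3) c2(3) ud(2,4)
    by eventually_elim (simp add: algebra_simps)
  show "bv0 (comb c d z) (lend S) = d" "bv0 (comb c d z) (rend S) = c"
    unfolding eq using b1 b2 by (simp_all add: bv_add(1)[OF _ c1(1) c2(1)] bv_cmult(1) ud)
  show "bv1 (comb c d z) e = c * bv1 (u 1 z) e + d * bv1 (u 2 z) e" if "is_end e"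
    unfolding eq using that by (simp add: bv_add(2)[OF _ c1(1) c2(1)] bv_cmult(2) ud)
qed

text \<open>A nonzero combination in the domain of a realization would be an eigenfunction.\<close>

lemma comb_in_domain_zero:
  assumes z: "z \<in> \<rho> D_00" "z \<in> \<rho> D" and D: "D \<subseteq> dom_max S" and c: "comb c d z \<in> D"
  shows "c = 0 \<and> d = 0"
proof -
  note cz = comb[OF z(1), where c = c and d = d]
  have "AE x in M. comb c d z x = 0" by (rule resolvent_set_injective[OF z(2) D c cz(2)])
  moreover have "(\<lambda>x. 0 * u 1 z x) \<in> dom_max S" by (rule dom_max_cmult(1)[OF u_dom(1)[OF z(1)]])
  ultimately have "bv0 (comb c d z) e = bv0 (\<lambda>x. 0 * u 1 z x) e" if "is_end e" for e
    using bv_cong(1)[OF that cz(1)] by simp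
  then have "bv0 (comb c d z) (lend S) = 0" "bv0 (comb c d z) (rend S) = 0"
    using bv_cmult(1)[OF _ u_dom(1)[OF z(1)], of _ 0] by simp_all
  then show ?thesis using cz(3,4) by metis
qed

text \<open>$(T - z)^{-1}h$ and $(T_{0,0} - z)^{-1}h$ differ by the solution with the boundary values of
$(T - z)^{-1}h$; here $f$ and $g$ are the representatives of the two resolvents.\<close>

lemma resolvent_decomposition:
  assumes z: "z \<in> \<rho> D_00" "z \<in> \<rho> D" and D: "D \<subseteq> dom_max S" and h: "h \<in> L2 M"
  obtains f g c d where "f \<in> D" "g \<in> D_00" "c = bv0 f (rend S)" "d = bv0 f (lend S)"
    "AE x in M. resolvent (realization S D) z h x = resolvent (realization S D_00) z h x + comb c d z x"
    "\<And>e. is_end e \<Longrightarrow> bv1 f e = bv1 g e + bv1 (comb c d z) e"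
    "\<And>a b. L2_inner M (comb a b (cnj z)) h = cnj b * bv1 g (lend S) - cnj a * bv1 g (rend S)"
proof -
  obtain f where f: "f \<in> D" "AE x in M. resolvent (realization S D) z h x = f x" "AE x in M. h x = tau S f x - z * f x"
    by (rule resolvent_realization[OF z(2) D h]) (rule that)
  obtain g where g: "g \<in> D_00" "AE x in M. resolvent (realization S D_00) z h x = g x" "AE x in M. h x = tau S g x - z * g x"
    by (rule resolvent_realization[OF z(1) D_subset(3) h]) (rule that)
  have fd: "f \<in> dom_max S" and gd: "g \<in> dom_max S" using f(1) g(1) D D_subset(3) by blast+
  define c where "c = bv0 f (rend S)"
  define d where "d = bv0 f (lend S)"
  note cz = comb[OF z(1), where c = c and d = d]
  let ?s = "\<lambda>x. g x + comb c d z x"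
  let ?y = "\<lambda>x. f x - ?s x"
  have s: "?s \<in> dom_max S" by (rule dom_max_add(1)[OF gd cz(1)])
  have y: "?y \<in> dom_max S" by (rule dom_max_diff(1)[OF fd s])
  have "?y \<in> D_00"
    using y g(1) bv_diff(1)[OF _ fd s] bv_add(1)[OF _ gd cz(1)] by (simp add: D_00_def cz(3,4) c_def[symmetric] d_def[symmetric])
  moreover have "AE x in M. tau S ?y x = z * ?y x"
    using dom_max_diff(3)[OF fd s] dom_max_add(3)[OF gd cz(1)] cz(2) f(3) g(3)
  proof eventually_elim
    case (elim x)
    have "tau S f x = h x + z * f x" "tau S g x = h x + z * g x" using elim(4,5) by (metis diff_add_cancel)+
    then show ?case unfolding elim(1) elim(2) elim(3) by (simp add: algebra_simps)
  qed
  ultimately have y0: "AE x in M. ?y x = 0"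
    using resolvent_set_injective[OF z(1) D_subset(3)] by blast
  then have eq: "AE x in M. f x = ?s x" by eventually_elim simp
  show thesis
  proof (rule that[OF f(1) g(1) c_def d_def])
    show "AE x in M. resolvent (realization S D) z h x = resolvent (realization S D_00) z h x + comb c d z x"
      using f(2) g(2) eq by eventually_elim simp
    show "bv1 f e = bv1 g e + bv1 (comb c d z) e" if "is_end e" for e
      using bv_cong(2)[OF that fd s eq] bv_add(2)[OF that gd cz(1)] by simp
    show "L2_inner M (comb a b (cnj z)) h = cnj b * bv1 g (lend S) - cnj a * bv1 g (rend S)" for a b
      using inner_solution[OF comb(1,2)[OF resolvent_set_cnj[OF z(1)]] g(1) h g(3)]
        comb(3,4)[OF resolvent_set_cnj[OF z(1)]] by simp
  qed
qed

text \<open>The resolvent identity for boundary conditions that express $\widetilde g^{\,\prime}(b)$ and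
$\widetilde g^{\,\prime}(a)$ by $\widetilde g(b)$ and $\widetilde g(a)$, with coefficients $a_{ij}$;
the matrix $K$ has the transposed indexing.\<close>

lemma krein_matrix:
  fixes K :: "complex^2^2"
  assumes z: "z \<in> \<rho> D_00" "z \<in> \<rho> D" and D: "D \<subseteq> dom_max S"
    and iff: "\<And>g. g \<in> dom_max S \<Longrightarrow> g \<in> D \<longleftrightarrow>
      a11 * bv0 g (rend S) + a12 * bv0 g (lend S) + bv1 g (rend S) = 0 \<and>
      a21 * bv0 g (rend S) + a22 * bv0 g (lend S) - bv1 g (lend S) = 0"
    and K: "K $ 1 $ 1 = a11 + bv1 (u 1 z) (rend S)" "K $ 1 $ 2 = a21 - bv1 (u 1 z) (lend S)"
      "K $ 2 $ 1 = a12 + bv1 (u 2 z) (rend S)" "K $ 2 $ 2 = a22 - bv1 (u 2 z) (lend S)"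
  shows "invertible K"
    "h \<in> L2 M \<Longrightarrow> AE x in M. resolvent (realization S D) z h x = resolvent (realization S D_00) z h x +
       (\<Sum>j\<in>UNIV. \<Sum>k\<in>UNIV. matrix_inv K $ j $ k * rank_one M (u j (cnj z)) (u k z) h x)"
proof -
  show inv: "invertible K"
  proof (rule invertible_2_if_injective)
    fix c d assume eqs: "c * K $ 1 $ 1 + d * K $ 2 $ 1 = 0" "c * K $ 1 $ 2 + d * K $ 2 $ 2 = 0"
    have "comb c d z \<in> D"
      using eqs by (subst iff[OF comb(1)[OF z(1)]]) (simp add: comb[OF z(1)] K algebra_simps)
    then show "c = 0 \<and> d = 0" by (rule comb_in_domain_zero[OF z D])
  qed
  assume h: "h \<in> L2 M"
  obtain f g c d where fg: "f \<in> D" "g \<in> D_00" "c = bv0 f (rend S)" "d = bv0 f (lend S)"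
    "AE x in M. resolvent (realization S D) z h x = resolvent (realization S D_00) z h x + comb c d z x"
    "\<And>e. is_end e \<Longrightarrow> bv1 f e = bv1 g e + bv1 (comb c d z) e"
    "\<And>a b. L2_inner M (comb a b (cnj z)) h = cnj b * bv1 g (lend S) - cnj a * bv1 g (rend S)"
    by (rule resolvent_decomposition[OF z D h]) (rule that)
  have c10: "comb 1 0 (cnj z) = u 1 (cnj z)" "comb 0 1 (cnj z) = u 2 (cnj z)" by (simp_all add: comb_def fun_eq_iff)
  have w: "L2_inner M (u 1 (cnj z)) h = - bv1 g (rend S)" "L2_inner M (u 2 (cnj z)) h = bv1 g (lend S)"
    using fg(7)[of 1 0] fg(7)[of 0 1] by (simp_all add: c10)
  have fd: "f \<in> dom_max S" using fg(1) D by blast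
  have "a11 * c + a12 * d + bv1 f (rend S) = 0" "a21 * c + a22 * d - bv1 f (lend S) = 0"
    using iff[OF fd] fg(1,3,4) by simp_all
  then have e: "c * K $ 1 $ 1 + d * K $ 2 $ 1 = L2_inner M (u 1 (cnj z)) h"
    "c * K $ 1 $ 2 + d * K $ 2 $ 2 = L2_inner M (u 2 (cnj z)) h"
    unfolding w fg(6)[OF is_end(1)] fg(6)[OF is_end(2)] K comb(5)[OF z(1) is_end(1)] comb(5)[OF z(1) is_end(2)]
    by (simp_all add: algebra_simps eq_neg_iff_add_eq_0)
  have cd: "c = L2_inner M (u 1 (cnj z)) h * matrix_inv K $ 1 $ 1 + L2_inner M (u 2 (cnj z)) h * matrix_inv K $ 2 $ 1"
    "d = L2_inner M (u 1 (cnj z)) h * matrix_inv K $ 1 $ 2 + L2_inner M (u 2 (cnj z)) h * matrix_inv K $ 2 $ 2"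
    using matrix_inv_2_solve[OF inv e] .
  have "comb c d z x = (\<Sum>j\<in>UNIV. \<Sum>k\<in>UNIV. matrix_inv K $ j $ k * rank_one M (u j (cnj z)) (u k z) h x)" for x
    unfolding comb_def cd by (simp add: sum_2 rank_one_def algebra_simps)
  then show "AE x in M. resolvent (realization S D) z h x = resolvent (realization S D_00) z h x +
       (\<Sum>j\<in>UNIV. \<Sum>k\<in>UNIV. matrix_inv K $ j $ k * rank_one M (u j (cnj z)) (u k z) h x)"
    using fg(5) by simp
qed

text \<open>The resolvent identity for boundary conditions that force $(\widetilde g(b), \widetilde g(a))$ to be a
multiple $c(s,t)$ of a fixed nonzero vector, together with one equation for
$\overline s\,\widetilde g^{\,\prime}(b) - \overline t\,\widetilde g^{\,\prime}(a)$.  The conjugates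
make this combination the inner product with the solution $U = s u_1 + t u_2$ at $\overline z$.\<close>

lemma krein_scalar:
  assumes z: "z \<in> \<rho> D_00" "z \<in> \<rho> D" and D: "D \<subseteq> dom_max S"
    and iff: "\<And>g. g \<in> dom_max S \<Longrightarrow> g \<in> D \<longleftrightarrow>
      (\<exists>c. bv0 g (rend S) = s * c \<and> bv0 g (lend S) = t * c \<and>
        m * c + cnj s * bv1 g (rend S) - cnj t * bv1 g (lend S) = 0)"
    and st: "s \<noteq> 0 \<or> t \<noteq> 0"
    and U: "U = comb s t"
    and k: "k = m + cnj s * bv1 (U z) (rend S) - cnj t * bv1 (U z) (lend S)"
  shows "k \<noteq> 0"
    "h \<in> L2 M \<Longrightarrow> AE x in M. resolvent (realization S D) z h x = resolvent (realization S D_00) z h x +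
       inverse k * rank_one M (U (cnj z)) (U z) h x"
proof -
  show k0: "k \<noteq> 0"
  proof
    assume "k = 0"
    then have "comb s t z \<in> D"
      by (subst iff[OF comb(1)[OF z(1)]]) (auto simp: comb(3,4)[OF z(1)] k U intro!: exI[of _ 1])
    then show False using comb_in_domain_zero[OF z D] st by blast
  qed
  assume h: "h \<in> L2 M"
  obtain f g c' d' where fg: "f \<in> D" "g \<in> D_00" "c' = bv0 f (rend S)" "d' = bv0 f (lend S)"
    "AE x in M. resolvent (realization S D) z h x = resolvent (realization S D_00) z h x + comb c' d' z x"
    "\<And>e. is_end e \<Longrightarrow> bv1 f e = bv1 g e + bv1 (comb c' d' z) e"
    "\<And>a b. L2_inner M (comb a b (cnj z)) h = cnj b * bv1 g (lend S) - cnj a * bv1 g (rend S)"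
    by (rule resolvent_decomposition[OF z D h]) (rule that)
  have fd: "f \<in> dom_max S" using fg(1) D by blast
  obtain c where c: "bv0 f (rend S) = s * c" "bv0 f (lend S) = t * c"
    "m * c + cnj s * bv1 f (rend S) - cnj t * bv1 f (lend S) = 0"
    using iff[OF fd] fg(1) by blast
  have cd: "c' = s * c" "d' = t * c" using c fg by simp_all
  have sc: "bv1 (comb c' d' z) e = c * bv1 (U z) e" if "is_end e" for e
    unfolding cd U using comb(5)[OF z(1) that] by (simp add: algebra_simps)
  have "c * k = L2_inner M (U (cnj z)) h"
    using c(3) unfolding fg(6)[OF is_end(1)] fg(6)[OF is_end(2)] sc[OF is_end(1)] sc[OF is_end(2)]
    by (simp add: U fg(7) k algebra_simps eq_neg_iff_add_eq_0)
  then have ck: "c = inverse k * L2_inner M (U (cnj z)) h" using k0 by (simp add: field_simps)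
  have "comb c' d' z x = c * U z x" for x by (simp add: comb_def U cd algebra_simps)
  then have "comb c' d' z x = inverse k * rank_one M (U (cnj z)) (U z) h x" for x
    by (simp add: ck rank_one_def)
  then show "AE x in M. resolvent (realization S D) z h x = resolvent (realization S D_00) z h x +
       inverse k * rank_one M (U (cnj z)) (U z) h x"
    using fg(5) by simp
qed

lemma D_sep_iff:
  assumes "sin \<alpha> \<noteq> 0" "sin \<beta> \<noteq> 0" "g \<in> dom_max S"
  shows "g \<in> D_sep \<alpha> \<beta> \<longleftrightarrow>
    complex_of_real (cot \<beta>) * bv0 g (rend S) + bv1 g (rend S) = 0 \<and>
    complex_of_real (cot \<alpha>) * bv0 g (lend S) + bv1 g (lend S) = 0"
  using assms unfolding D_sep_def cot_def
  by (auto simp: field_simps)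

lemma D_sep_0_iff:
  assumes "g \<in> dom_max S"
  shows "sin \<beta> \<noteq> 0 \<Longrightarrow> g \<in> D_sep 0 \<beta> \<longleftrightarrow> bv0 g (lend S) = 0 \<and>
      complex_of_real (cot \<beta>) * bv0 g (rend S) + bv1 g (rend S) = 0"
    "sin \<alpha> \<noteq> 0 \<Longrightarrow> g \<in> D_sep \<alpha> 0 \<longleftrightarrow> bv0 g (rend S) = 0 \<and>
      complex_of_real (cot \<alpha>) * bv0 g (lend S) + bv1 g (lend S) = 0"
  using assms unfolding D_sep_def cot_def
  by (auto simp: field_simps)

end

theorem theorem4p2:
  fixes S :: sl_data
    and v1 v2 :: "real \<Rightarrow> complex"
    and u :: "2 \<Rightarrow> complex \<Rightarrow> real \<Rightarrow> complex"
  assumes sl: "sturm_liouville S"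
    and lca: "limit_circle_at S (lend S)"
    and lcb: "limit_circle_at S (rend S)"
    and v: "boundary_pair S v1 v2"
    and u1: "\<And>z. z \<in> resolvent_set (sl_measure S) (T_sep S v1 v2 0 0) \<Longrightarrow>
       sl_solution S z (u 1 z) \<and>
       bv S v1 v2 (u 1 z) (lend S) = 0 \<and> bv S v1 v2 (u 1 z) (rend S) = 1"
    and u2: "\<And>z. z \<in> resolvent_set (sl_measure S) (T_sep S v1 v2 0 0) \<Longrightarrow>
       sl_solution S z (u 2 z) \<and>
       bv S v1 v2 (u 2 z) (lend S) = 1 \<and> bv S v1 v2 (u 2 z) (rend S) = 0"
  shows
    \<comment> \<open>(i)\<close>
    "(\<forall>\<alpha>\<in>{0<..<pi}. \<forall>\<beta>\<in>{0<..<pi}.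
        relatively_prime (T_min S) (T_sep S v1 v2 0 0) (T_sep S v1 v2 \<alpha> \<beta>) \<and>
        (\<forall>z\<in>resolvent_set (sl_measure S) (T_sep S v1 v2 0 0)
              \<inter> resolvent_set (sl_measure S) (T_sep S v1 v2 \<alpha> \<beta>).
          let K = (vector
            [vector [complex_of_real (cot \<beta>) + bv' S v1 v2 (u 1 z) (rend S),
                     - bv' S v1 v2 (u 1 z) (lend S)],
             vector [bv' S v1 v2 (u 2 z) (rend S),
                     - complex_of_real (cot \<alpha>) - bv' S v1 v2 (u 2 z) (lend S)]] :: complex^2^2)
          in invertible K \<and>
             (\<forall>h\<in>L2 (sl_measure S). AE x in sl_measure S.
                resolvent (T_sep S v1 v2 \<alpha> \<beta>) z h x =
                  resolvent (T_sep S v1 v2 0 0) z h x +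
                  (\<Sum>j\<in>UNIV. \<Sum>k\<in>UNIV. matrix_inv K $ j $ k *
                     rank_one (sl_measure S) (u j (cnj z)) (u k z) h x))))
     \<and>
     (\<forall>\<beta>\<in>{0<..<pi}.
        max_common_part (T_sep S v1 v2 0 0) (T_sep S v1 v2 0 \<beta>) =
          realization S {y \<in> dom_max S. bv S v1 v2 y (lend S) = 0 \<and>
            bv S v1 v2 y (rend S) = 0 \<and> bv' S v1 v2 y (rend S) = 0} \<and>
        (\<forall>z\<in>resolvent_set (sl_measure S) (T_sep S v1 v2 0 0)
              \<inter> resolvent_set (sl_measure S) (T_sep S v1 v2 0 \<beta>).
          let K = complex_of_real (cot \<beta>) + bv' S v1 v2 (u 1 z) (rend S)
          in K \<noteq> 0 \<and>
             (\<forall>h\<in>L2 (sl_measure S). AE x in sl_measure S.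
                resolvent (T_sep S v1 v2 0 \<beta>) z h x =
                  resolvent (T_sep S v1 v2 0 0) z h x +
                  inverse K * rank_one (sl_measure S) (u 1 (cnj z)) (u 1 z) h x)))
     \<and>
     (\<forall>\<alpha>\<in>{0<..<pi}.
        max_common_part (T_sep S v1 v2 0 0) (T_sep S v1 v2 \<alpha> 0) =
          realization S {y \<in> dom_max S. bv S v1 v2 y (lend S) = 0 \<and>
            bv S v1 v2 y (rend S) = 0 \<and> bv' S v1 v2 y (lend S) = 0} \<and>
        (\<forall>z\<in>resolvent_set (sl_measure S) (T_sep S v1 v2 0 0)
              \<inter> resolvent_set (sl_measure S) (T_sep S v1 v2 \<alpha> 0).
          let K = - complex_of_real (cot \<alpha>) - bv' S v1 v2 (u 2 z) (lend S)
          in K \<noteq> 0 \<and>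
             (\<forall>h\<in>L2 (sl_measure S). AE x in sl_measure S.
                resolvent (T_sep S v1 v2 \<alpha> 0) z h x =
                  resolvent (T_sep S v1 v2 0 0) z h x +
                  inverse K * rank_one (sl_measure S) (u 2 (cnj z)) (u 2 z) h x)))
     \<and>
     (\<forall>\<phi>\<in>{0..<2*pi}. \<forall>R::real^2^2. det R = 1 \<and> R $ 1 $ 2 \<noteq> 0 \<longrightarrow>
        relatively_prime (T_min S) (T_sep S v1 v2 0 0) (T_coupled S v1 v2 \<phi> R) \<and>
        (\<forall>z\<in>resolvent_set (sl_measure S) (T_sep S v1 v2 0 0)
              \<inter> resolvent_set (sl_measure S) (T_coupled S v1 v2 \<phi> R).
          let K = (vector
            [vector [- complex_of_real (R $ 2 $ 2 / R $ 1 $ 2) + bv' S v1 v2 (u 1 z) (rend S),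
                     exp (- \<i> * complex_of_real \<phi>) / complex_of_real (R $ 1 $ 2)
                       - bv' S v1 v2 (u 1 z) (lend S)],
             vector [exp (\<i> * complex_of_real \<phi>) / complex_of_real (R $ 1 $ 2)
                       + bv' S v1 v2 (u 2 z) (rend S),
                     - complex_of_real (R $ 1 $ 1 / R $ 1 $ 2) - bv' S v1 v2 (u 2 z) (lend S)]]
              :: complex^2^2)
          in invertible K \<and>
             (\<forall>h\<in>L2 (sl_measure S). AE x in sl_measure S.
                resolvent (T_coupled S v1 v2 \<phi> R) z h x =
                  resolvent (T_sep S v1 v2 0 0) z h x +
                  (\<Sum>j\<in>UNIV. \<Sum>k\<in>UNIV. matrix_inv K $ j $ k *
                     rank_one (sl_measure S) (u j (cnj z)) (u k z) h x))))
     \<and>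
     (\<forall>\<phi>\<in>{0..<2*pi}. \<forall>R::real^2^2. det R = 1 \<and> R $ 1 $ 2 = 0 \<longrightarrow>
        max_common_part (T_coupled S v1 v2 \<phi> R) (T_sep S v1 v2 0 0) =
          realization S {y \<in> dom_max S. bv S v1 v2 y (lend S) = 0 \<and> bv S v1 v2 y (rend S) = 0 \<and>
            bv' S v1 v2 y (rend S) =
              exp (\<i> * complex_of_real \<phi>) * complex_of_real (R $ 2 $ 2) * bv' S v1 v2 y (lend S)} \<and>
        (let uR = (\<lambda>\<zeta> x. exp (- \<i> * complex_of_real \<phi>) * complex_of_real (R $ 2 $ 2) * u 2 \<zeta> x
                        + u 1 \<zeta> x)
         in \<forall>z\<in>resolvent_set (sl_measure S) (T_sep S v1 v2 0 0)
                \<inter> resolvent_set (sl_measure S) (T_coupled S v1 v2 \<phi> R).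
          let k = - complex_of_real (R $ 2 $ 1 * R $ 2 $ 2)
                  - exp (\<i> * complex_of_real \<phi>) * complex_of_real (R $ 2 $ 2)
                      * bv' S v1 v2 (uR z) (lend S)
                  + bv' S v1 v2 (uR z) (rend S)
          in k \<noteq> 0 \<and>
             (\<forall>h\<in>L2 (sl_measure S). AE x in sl_measure S.
                resolvent (T_coupled S v1 v2 \<phi> R) z h x =
                  resolvent (T_sep S v1 v2 0 0) z h x +
                  inverse k * rank_one (sl_measure S) (uR (cnj z)) (uR z) h x)))"
proof -
  interpret sl_boundary S v1 v2
    by unfold_locales (rule sl, rule v)
  interpret sl_krein S v1 v2 u
    by unfold_locales (use lca lcb u1 u2 in \<open>simp_all only: T_00_eq\<close>)
  show ?thesis
  proof (intro conjI ballI allI impI)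
    fix \<alpha> \<beta> :: real assume "\<alpha> \<in> {0<..<pi}" "\<beta> \<in> {0<..<pi}"
    then have sin: "sin \<alpha> \<noteq> 0" "sin \<beta> \<noteq> 0"
      using sin_gt_zero[of \<alpha>] sin_gt_zero[of \<beta>] by auto
    have "D_00 \<inter> D_sep \<alpha> \<beta> = D_min"
      using D_sep_iff[OF sin] by (auto simp: D_00_def D_min_def)
    then show "relatively_prime (T_min S) (T_sep S v1 v2 0 0) (T_sep S v1 v2 \<alpha> \<beta>)"
      by (simp add: relatively_prime_def common_part_sep T_min_eq)
    fix z assume z: "z \<in> resolvent_set (sl_measure S) (T_sep S v1 v2 0 0) \<inter> resolvent_set (sl_measure S) (T_sep S v1 v2 \<alpha> \<beta>)"
    have z': "z \<in> \<rho> D_00" "z \<in> \<rho> (D_sep \<alpha> \<beta>)"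
      using z by (simp_all add: T_00_eq T_sep_eq[of \<alpha> \<beta>])
    have iff: "g \<in> D_sep \<alpha> \<beta> \<longleftrightarrow>
      complex_of_real (cot \<beta>) * bv0 g (rend S) + 0 * bv0 g (lend S) + bv1 g (rend S) = 0 \<and>
      0 * bv0 g (rend S) + (- complex_of_real (cot \<alpha>)) * bv0 g (lend S) - bv1 g (lend S) = 0"
      if "g \<in> dom_max S" for g
    proof -
      have "- X - Y = 0 \<longleftrightarrow> X + Y = 0" for X Y :: complex
        using neg_equal_0_iff_equal[of "X + Y"] by (simp add: minus_add_distrib)
      then show ?thesis unfolding D_sep_iff[OF sin that] by simp
    qed
    note kr = krein_matrix[OF z' D_subset(1) iff]
    show "let K = (vector
            [vector [complex_of_real (cot \<beta>) + bv' S v1 v2 (u 1 z) (rend S),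
                     - bv' S v1 v2 (u 1 z) (lend S)],
             vector [bv' S v1 v2 (u 2 z) (rend S),
                     - complex_of_real (cot \<alpha>) - bv' S v1 v2 (u 2 z) (lend S)]] :: complex^2^2)
          in invertible K \<and>
             (\<forall>h\<in>L2 (sl_measure S). AE x in sl_measure S.
                resolvent (T_sep S v1 v2 \<alpha> \<beta>) z h x =
                  resolvent (T_sep S v1 v2 0 0) z h x +
                  (\<Sum>j\<in>UNIV. \<Sum>k\<in>UNIV. matrix_inv K $ j $ k *
                     rank_one (sl_measure S) (u j (cnj z)) (u k z) h x))"
      unfolding Let_def T_00_eq T_sep_eq[of \<alpha> \<beta>]
      by (intro conjI ballI kr) simp_all
  next
    fix \<beta> :: real assume "\<beta> \<in> {0<..<pi}"
    then have sin: "sin \<beta> \<noteq> 0" using sin_gt_zero[of \<beta>] by auto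
    have "D_00 \<inter> D_sep 0 \<beta> = {y \<in> dom_max S. bv S v1 v2 y (lend S) = 0 \<and>
            bv S v1 v2 y (rend S) = 0 \<and> bv' S v1 v2 y (rend S) = 0}"
      using D_sep_0_iff(1)[OF _ sin] by (auto simp: D_00_def)
    then show "max_common_part (T_sep S v1 v2 0 0) (T_sep S v1 v2 0 \<beta>) =
          realization S {y \<in> dom_max S. bv S v1 v2 y (lend S) = 0 \<and>
            bv S v1 v2 y (rend S) = 0 \<and> bv' S v1 v2 y (rend S) = 0}"
      by (simp add: common_part_sep)
    fix z assume z: "z \<in> resolvent_set (sl_measure S) (T_sep S v1 v2 0 0) \<inter> resolvent_set (sl_measure S) (T_sep S v1 v2 0 \<beta>)"
    have z': "z \<in> \<rho> D_00" "z \<in> \<rho> (D_sep 0 \<beta>)"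
      using z by (simp_all add: T_00_eq T_sep_eq[of 0 \<beta>])
    have iff: "g \<in> D_sep 0 \<beta> \<longleftrightarrow>
      (\<exists>c. bv0 g (rend S) = 1 * c \<and> bv0 g (lend S) = 0 * c \<and>
        complex_of_real (cot \<beta>) * c + cnj 1 * bv1 g (rend S) - cnj 0 * bv1 g (lend S) = 0)"
      if "g \<in> dom_max S" for g
      unfolding D_sep_0_iff(1)[OF that sin] by auto
    have U: "u 1 = comb 1 0" by (simp add: comb_def fun_eq_iff)
    note kr = krein_scalar[OF z' D_subset(1) iff _ U]
    show "let K = complex_of_real (cot \<beta>) + bv' S v1 v2 (u 1 z) (rend S)
          in K \<noteq> 0 \<and>
             (\<forall>h\<in>L2 (sl_measure S). AE x in sl_measure S.
                resolvent (T_sep S v1 v2 0 \<beta>) z h x =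
                  resolvent (T_sep S v1 v2 0 0) z h x +
                  inverse K * rank_one (sl_measure S) (u 1 (cnj z)) (u 1 z) h x)"
      unfolding Let_def T_00_eq T_sep_eq[of 0 \<beta>]
      by (intro conjI ballI kr) simp_all
  next
    fix \<alpha> :: real assume "\<alpha> \<in> {0<..<pi}"
    then have sin: "sin \<alpha> \<noteq> 0" using sin_gt_zero[of \<alpha>] by auto
    have "D_00 \<inter> D_sep \<alpha> 0 = {y \<in> dom_max S. bv S v1 v2 y (lend S) = 0 \<and>
            bv S v1 v2 y (rend S) = 0 \<and> bv' S v1 v2 y (lend S) = 0}"
      using D_sep_0_iff(2)[OF _ sin] by (auto simp: D_00_def)
    then show "max_common_part (T_sep S v1 v2 0 0) (T_sep S v1 v2 \<alpha> 0) =
          realization S {y \<in> dom_max S. bv S v1 v2 y (lend S) = 0 \<and>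
            bv S v1 v2 y (rend S) = 0 \<and> bv' S v1 v2 y (lend S) = 0}"
      by (simp add: common_part_sep)
    fix z assume z: "z \<in> resolvent_set (sl_measure S) (T_sep S v1 v2 0 0) \<inter> resolvent_set (sl_measure S) (T_sep S v1 v2 \<alpha> 0)"
    have z': "z \<in> \<rho> D_00" "z \<in> \<rho> (D_sep \<alpha> 0)"
      using z by (simp_all add: T_00_eq T_sep_eq[of \<alpha> 0])
    have iff: "g \<in> D_sep \<alpha> 0 \<longleftrightarrow>
      (\<exists>c. bv0 g (rend S) = 0 * c \<and> bv0 g (lend S) = 1 * c \<and>
        (- complex_of_real (cot \<alpha>)) * c + cnj 0 * bv1 g (rend S) - cnj 1 * bv1 g (lend S) = 0)"
      if "g \<in> dom_max S" for g
      unfolding D_sep_0_iff(2)[OF that sin] by (auto simp: add_eq_0_iff)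
    have U: "u 2 = comb 0 1" by (simp add: comb_def fun_eq_iff)
    note kr = krein_scalar[OF z' D_subset(1) iff _ U]
    show "let K = - complex_of_real (cot \<alpha>) - bv' S v1 v2 (u 2 z) (lend S)
          in K \<noteq> 0 \<and>
             (\<forall>h\<in>L2 (sl_measure S). AE x in sl_measure S.
                resolvent (T_sep S v1 v2 \<alpha> 0) z h x =
                  resolvent (T_sep S v1 v2 0 0) z h x +
                  inverse K * rank_one (sl_measure S) (u 2 (cnj z)) (u 2 z) h x)"
      unfolding Let_def T_00_eq T_sep_eq[of \<alpha> 0]
      by (intro conjI ballI kr) simp_all
  next
    fix \<phi> :: real and R :: "real^2^2" assume "\<phi> \<in> {0..<2 * pi}" and R: "det R = 1 \<and> R $ 1 $ 2 \<noteq> 0"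
    let ?e = "exp (\<i> * complex_of_real \<phi>)"
    have e: "?e * exp (- \<i> * complex_of_real \<phi>) = 1" by (simp add: exp_add[symmetric])
    let ?r = "\<lambda>i j. complex_of_real (R $ i $ j)"
    have r: "?r 1 2 \<noteq> 0" "?r 1 1 * ?r 2 2 - ?r 1 2 * ?r 2 1 = 1"
      using R unfolding det_2 by (simp_all flip: of_real_mult of_real_diff)
    have iff: "g \<in> D_coupled \<phi> R \<longleftrightarrow>
      (- complex_of_real (R $ 2 $ 2 / R $ 1 $ 2)) * bv0 g (rend S) + ?e / ?r 1 2 * bv0 g (lend S) + bv1 g (rend S) = 0 \<and>
      exp (- \<i> * complex_of_real \<phi>) / ?r 1 2 * bv0 g (rend S) + (- complex_of_real (R $ 1 $ 1 / R $ 1 $ 2)) * bv0 g (lend S)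
        - bv1 g (lend S) = 0"
      if "g \<in> dom_max S" for g
      using coupled_boundary_conditions[OF e r] that by (simp add: D_coupled_def)
    have "D_00 \<inter> D_coupled \<phi> R = D_min"
      using iff r(1) by (auto simp: D_00_def D_min_def)
    then show "relatively_prime (T_min S) (T_sep S v1 v2 0 0) (T_coupled S v1 v2 \<phi> R)"
      by (simp add: relatively_prime_def common_part_coupled T_min_eq)
    fix z assume z: "z \<in> resolvent_set (sl_measure S) (T_sep S v1 v2 0 0) \<inter> resolvent_set (sl_measure S) (T_coupled S v1 v2 \<phi> R)"
    have z': "z \<in> \<rho> D_00" "z \<in> \<rho> (D_coupled \<phi> R)"
      using z by (simp_all add: T_00_eq T_coupled_eq)
    note kr = krein_matrix[OF z' D_subset(2) iff]
    show "let K = (vector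
            [vector [- complex_of_real (R $ 2 $ 2 / R $ 1 $ 2) + bv' S v1 v2 (u 1 z) (rend S),
                     exp (- \<i> * complex_of_real \<phi>) / complex_of_real (R $ 1 $ 2)
                       - bv' S v1 v2 (u 1 z) (lend S)],
             vector [exp (\<i> * complex_of_real \<phi>) / complex_of_real (R $ 1 $ 2)
                       + bv' S v1 v2 (u 2 z) (rend S),
                     - complex_of_real (R $ 1 $ 1 / R $ 1 $ 2) - bv' S v1 v2 (u 2 z) (lend S)]]
              :: complex^2^2)
          in invertible K \<and>
             (\<forall>h\<in>L2 (sl_measure S). AE x in sl_measure S.
                resolvent (T_coupled S v1 v2 \<phi> R) z h x =
                  resolvent (T_sep S v1 v2 0 0) z h x +
                  (\<Sum>j\<in>UNIV. \<Sum>k\<in>UNIV. matrix_inv K $ j $ k *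
                     rank_one (sl_measure S) (u j (cnj z)) (u k z) h x))"
      unfolding Let_def T_00_eq T_coupled_eq
      by (intro conjI ballI kr) simp_all
  next
    fix \<phi> :: real and R :: "real^2^2" assume "\<phi> \<in> {0..<2 * pi}" and R: "det R = 1 \<and> R $ 1 $ 2 = 0"
    let ?e = "exp (\<i> * complex_of_real \<phi>)" and ?e' = "exp (- \<i> * complex_of_real \<phi>)"
    have e: "?e * ?e' = 1" by (simp add: exp_add[symmetric])
    have ce: "cnj ?e' = ?e" by (simp add: exp_cnj)
    let ?r = "\<lambda>i j. complex_of_real (R $ i $ j)"
    have "R $ 1 $ 1 * R $ 2 $ 2 = 1" using conjunct1[OF R] conjunct2[OF R] by (simp add: det_2)
    then have r: "?r 1 1 * ?r 2 2 = 1" "?r 1 2 = 0"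
      using R by (simp_all flip: of_real_mult)
    have common: "D_coupled \<phi> R \<inter> D_00 = {y \<in> dom_max S. bv S v1 v2 y (lend S) = 0 \<and> bv S v1 v2 y (rend S) = 0 \<and>
            bv' S v1 v2 y (rend S) =
              exp (\<i> * complex_of_real \<phi>) * complex_of_real (R $ 2 $ 2) * bv' S v1 v2 y (lend S)}"
      using R by (auto simp: D_00_def D_coupled_def)
    show "max_common_part (T_coupled S v1 v2 \<phi> R) (T_sep S v1 v2 0 0) =
          realization S {y \<in> dom_max S. bv S v1 v2 y (lend S) = 0 \<and> bv S v1 v2 y (rend S) = 0 \<and>
            bv' S v1 v2 y (rend S) =
              exp (\<i> * complex_of_real \<phi>) * complex_of_real (R $ 2 $ 2) * bv' S v1 v2 y (lend S)}"
      unfolding common_part_coupled common ..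
    define uR where "uR = (\<lambda>\<zeta> x. ?e' * ?r 2 2 * u 2 \<zeta> x + u 1 \<zeta> x)"
    have U: "uR = comb 1 (?e' * ?r 2 2)" by (simp add: uR_def comb_def fun_eq_iff)
    \<comment> \<open>The boundary values at \<open>b\<close> and \<open>a\<close> are the multiples of the vector with entries \<open>1\<close> and
      \<open>?e' * ?r 2 2\<close>, the coefficients of \<open>u 1\<close> and \<open>u 2\<close> in \<open>uR\<close>.\<close>
    have iff: "g \<in> D_coupled \<phi> R \<longleftrightarrow>
      (\<exists>c. bv0 g (rend S) = 1 * c \<and> bv0 g (lend S) = ?e' * ?r 2 2 * c \<and>
        (- (?r 2 1 * ?r 2 2)) * c + cnj 1 * bv1 g (rend S) - cnj (?e' * ?r 2 2) * bv1 g (lend S) = 0)"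
      if "g \<in> dom_max S" for g
      using coupled_boundary_conditions_diagonal[OF e r] that ce
      by (simp add: D_coupled_def diff_eq_eq add.commute)
    show "let uR = (\<lambda>\<zeta> x. exp (- \<i> * complex_of_real \<phi>) * complex_of_real (R $ 2 $ 2) * u 2 \<zeta> x
                        + u 1 \<zeta> x)
         in \<forall>z\<in>resolvent_set (sl_measure S) (T_sep S v1 v2 0 0)
                \<inter> resolvent_set (sl_measure S) (T_coupled S v1 v2 \<phi> R).
          let k = - complex_of_real (R $ 2 $ 1 * R $ 2 $ 2)
                  - exp (\<i> * complex_of_real \<phi>) * complex_of_real (R $ 2 $ 2)
                      * bv' S v1 v2 (uR z) (lend S)
                  + bv' S v1 v2 (uR z) (rend S)
          in k \<noteq> 0 \<and>
             (\<forall>h\<in>L2 (sl_measure S). AE x in sl_measure S.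
                resolvent (T_coupled S v1 v2 \<phi> R) z h x =
                  resolvent (T_sep S v1 v2 0 0) z h x +
                  inverse k * rank_one (sl_measure S) (uR (cnj z)) (uR z) h x)"
      unfolding Let_def uR_def[symmetric]
    proof
      fix z assume z: "z \<in> resolvent_set (sl_measure S) (T_sep S v1 v2 0 0) \<inter> resolvent_set (sl_measure S) (T_coupled S v1 v2 \<phi> R)"
      have z': "z \<in> \<rho> D_00" "z \<in> \<rho> (D_coupled \<phi> R)"
        using z by (simp_all add: T_00_eq T_coupled_eq)
      define k where "k = - complex_of_real (R $ 2 $ 1 * R $ 2 $ 2) - ?e * ?r 2 2 * bv1 (uR z) (lend S) + bv1 (uR z) (rend S)"
      have k: "k = (- (?r 2 1 * ?r 2 2)) + cnj 1 * bv1 (uR z) (rend S) - cnj (?e' * ?r 2 2) * bv1 (uR z) (lend S)"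
        using ce by (simp add: k_def)
      note kr = krein_scalar[OF z' D_subset(2) iff _ U k]
      show "- complex_of_real (R $ 2 $ 1 * R $ 2 $ 2)
                  - exp (\<i> * complex_of_real \<phi>) * complex_of_real (R $ 2 $ 2)
                      * bv' S v1 v2 (uR z) (lend S)
                  + bv' S v1 v2 (uR z) (rend S) \<noteq> 0 \<and>
             (\<forall>h\<in>L2 (sl_measure S). AE x in sl_measure S.
                resolvent (T_coupled S v1 v2 \<phi> R) z h x =
                  resolvent (T_sep S v1 v2 0 0) z h x +
                  inverse (- complex_of_real (R $ 2 $ 1 * R $ 2 $ 2)
                  - exp (\<i> * complex_of_real \<phi>) * complex_of_real (R $ 2 $ 2)
                      * bv' S v1 v2 (uR z) (lend S)
                  + bv' S v1 v2 (uR z) (rend S)) * rank_one (sl_measure S) (uR (cnj z)) (uR z) h x)"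
        unfolding k_def[symmetric] T_00_eq T_coupled_eq
        by (intro conjI ballI kr) simp_all
    qed
  qed
qed

end
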